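(* There are absolute constants $c,C>0$ such that for every $n\in\mathbb{N}$ and every unconditional convex body $K\subset\mathbb{R}^n$, $$c\sqrt n\le \mathrm{lvr}(K)\le C\sqrt n .$$
   Context: A convex body in $\mathbb{R}^n$ is a compact convex set with non-empty interior; $|\cdot|$ denotes Lebesgue measure. A convex body $K$ is unconditional if for every choice of signs $(\varepsilon_k)_{k=1}^n\in\{-1,+1\}^n$, $(\varepsilon_1x_1,\dots,\varepsilon_nx_n)\in K$ if and only if $(x_1,\dots,x_n)\in K$. For convex bodies $K,L\subset\mathbb{R}^n$, $$\mathrm{vr}(K,L):=\inf\left\{\left(\frac{|K|}{|T(L)|}\right)^{1/n}: T(L)\subset K\right\},$$ the infimum being over all (invertible) affine transformations $T$ of $\mathbb{R}^n$, and $\mathrm{lvr}(K):=\sup_{L}\mathrm{vr}(K,L)$, the supremum being over all convex bodies $L\subset\mathbb{R}^n$. *)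

theory Defs
  imports "HOL-Analysis.Analysis"
begin

text \<open>
  The dimension is bound inside the theorem, after the absolute constants, so it cannot be a type.
  A point of n-dimensional space is a function in \<open>{..<n} \<rightarrow>\<^sub>E UNIV\<close>: its coordinates are indexed
  by \<open>{..<n}\<close> and it is \<open>undefined\<close> elsewhere. This is the underlying set both of the library's
  product topology \<open>powertop_real {..<n}\<close> and of its product measure.
\<close>

abbreviation Rn :: "nat \<Rightarrow> (nat \<Rightarrow> real) set" where
  "Rn n \<equiv> {..<n} \<rightarrow>\<^sub>E UNIV"

lemma topspace_powertop_real_lessThan: "topspace (powertop_real {..<n}) = Rn n"
  by simp

text \<open>
  This is Lebesgue measure on Borel sets. It is only applied to compact sets, so the completion
  is not needed.
\<close>

definition vol :: "nat \<Rightarrow> (nat \<Rightarrow> real) set \<Rightarrow> real" where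
  "vol n A = measure (\<Pi>\<^sub>M i\<in>{..<n}. lborel) A"

definition convex_Rn :: "nat \<Rightarrow> (nat \<Rightarrow> real) set \<Rightarrow> bool" where
  "convex_Rn n K \<longleftrightarrow>
     (\<forall>x\<in>K. \<forall>y\<in>K. \<forall>u\<ge>0. \<forall>v\<ge>0. u + v = 1 \<longrightarrow> (\<lambda>i\<in>{..<n}. u * x i + v * y i) \<in> K)"

definition convex_body :: "nat \<Rightarrow> (nat \<Rightarrow> real) set \<Rightarrow> bool" where
  "convex_body n K \<longleftrightarrow>
     compactin (powertop_real {..<n}) K \<and> convex_Rn n K \<and> powertop_real {..<n} interior_of K \<noteq> {}"

definition unconditional :: "nat \<Rightarrow> (nat \<Rightarrow> real) set \<Rightarrow> bool" where
  "unconditional n K \<longleftrightarrow>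
     (\<forall>\<epsilon>. (\<forall>k<n. \<epsilon> k \<in> {-1, 1}) \<longrightarrow>
        (\<forall>x\<in>Rn n. (\<lambda>k\<in>{..<n}. \<epsilon> k * x k) \<in> K \<longleftrightarrow> x \<in> K))"

definition invertible_affine :: "nat \<Rightarrow> ((nat \<Rightarrow> real) \<Rightarrow> (nat \<Rightarrow> real)) \<Rightarrow> bool" where
  "invertible_affine n T \<longleftrightarrow>
     (\<exists>A b. \<forall>x\<in>Rn n. T x = (\<lambda>i\<in>{..<n}. (\<Sum>j<n. A i j * x j) + b i)) \<and>
     bij_betw T (Rn n) (Rn n)"

text \<open>
  The infimum and supremum are taken in \<^typ>\<open>ereal\<close>, because the real supremum of an unbounded set
  is unspecified; an upper bound on \<open>lvr n K\<close> thus also says that it is finite.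
\<close>

definition vr :: "nat \<Rightarrow> (nat \<Rightarrow> real) set \<Rightarrow> (nat \<Rightarrow> real) set \<Rightarrow> ereal" where
  "vr n K L =
     (INF T \<in> {T. invertible_affine n T \<and> T ` L \<subseteq> K}.
        ereal ((vol n K / vol n (T ` L)) powr (1 / real n)))"

definition lvr :: "nat \<Rightarrow> (nat \<Rightarrow> real) set \<Rightarrow> ereal" where
  "lvr n K = (SUP L \<in> {L. convex_body n L}. vr n K L)"

end

theory Submission
  imports Defs "Jordan_Normal_Form.Determinant"
begin

text \<open>
  Let \<open>d\<close> maximise \<open>\<Prod>\<^sub>k |x\<^sub>k|\<close> over the unconditional body \<open>K\<close>. Then \<open>K\<close> contains the cuboid
  \<open>|x\<^sub>k| \<le> d\<^sub>k\<close> and lies in the cross-polytope \<open>\<Sum>\<^sub>k |x\<^sub>k| / d\<^sub>k \<le> n\<close>, whose volume is larger by a factor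
  \<open>C\<^sup>n\<close> only. So it suffices to bound the volume of affine images of \<open>L\<close> that fit into the cuboid from
  below, for all \<open>L\<close>, and of those that fit into the cross-polytope from above, for one \<open>L\<close>.

  Upper estimate of \<open>lvr\<close>. Choose \<open>u\<^sub>1, \<dots>, u\<^sub>2\<^sub>n\<close> in the polar body of \<open>L - L\<close> such that the determinant
  of \<open>M = \<Sum>\<^sub>j u\<^sub>j u\<^sub>j\<^sup>T\<close> is almost maximal. Then \<open>L - L\<close> contains a dilate of the ellipsoid of \<open>M\<close>, and by
  the Cauchy--Binet formula some \<open>n\<close> of the \<open>u\<^sub>j\<close> have a determinant comparable to \<open>(det M)\<^sup>1\<^sup>/\<^sup>2\<close>. These map
  \<open>L\<close> into a cube, and the image of \<open>L - L\<close> contains a parallelepiped of relative volume \<open>(c / \<surd>n)\<^sup>n\<close>. A weak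
  Rogers--Shephard inequality passes from \<open>L - L\<close> to \<open>L\<close>.

  Lower estimate of \<open>lvr\<close>. Take for \<open>L\<close> the absolutely convex hull of \<open>O(n)\<close> points \<open>x\<^sub>i \<in> [-1, 1]\<^sup>n\<close> with
  \<open>\<Sum>\<^sub>i |\<langle>t, x\<^sub>i\<rangle>| \<ge> c n |t|\<close> for all \<open>t\<close>, obtained from a random sign matrix as in Kashin's theorem. If an
  affine map sends \<open>L\<close> into the cross-polytope, then the norms of its rows, relative to \<open>d\<close>, add up
  to \<open>O(n)\<close>, and rounding covers the image by \<open>C\<^sup>n\<close> cuboids of volume \<open>(C / \<surd>n)\<^sup>n \<Prod>\<^sub>k d\<^sub>k\<close>.
\<close>

section \<open>Determinants\<close>

text \<open>The number 2 n of vectors balances two losses. For N vectors whose determinant is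
  maximal up to a factor 2, the leverage s of a further polar vector is at most (N + n) / (2 N + 1),
  and s / (1 - s) bounds (v . x)^2 relative to x^T M x. N = n would only give 2 n there; N = 2 n
  gives 3. On the other side, passing from det M to a single minor costs N^n / n!, which is at most
  6^n for N = 2 n. Tolerating the factor 2 turns a maximum into a supremum, which is finite because
  the polar body is bounded. In the lower estimate the covering has only C^n members because each
  rounding leaves an integer vector of l1 norm O(n) in dimension O(n). The rounding errors are
  controlled in l2, and this is where the sides of the cuboids gain the factor 1 / sqrt n. As the
  dimension is a bound variable, vectors and matrices are functions of indices, and the change of
  variables and the polar duality are proved in coordinates.\<close>

definition detn :: "nat \<Rightarrow> (nat \<Rightarrow> nat \<Rightarrow> real) \<Rightarrow> real" where
  "detn n A = Determinant.det (Matrix.mat n n (\<lambda>(i, j). A i j))"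

definition mulf :: "nat \<Rightarrow> (nat \<Rightarrow> nat \<Rightarrow> real) \<Rightarrow> (nat \<Rightarrow> nat \<Rightarrow> real) \<Rightarrow> nat \<Rightarrow> nat \<Rightarrow> real" where
  "mulf n A B = (\<lambda>i j. \<Sum>k<n. A i k * B k j)"

definition idf :: "nat \<Rightarrow> nat \<Rightarrow> real" where
  "idf i j = (if i = j then 1 else 0)"

lemma detn_cong:
  assumes "\<And>i j. i < n \<Longrightarrow> j < n \<Longrightarrow> A i j = B i j"
  shows "detn n A = detn n B"
proof -
  have "Matrix.mat n n (\<lambda>(i, j). A i j) = Matrix.mat n n (\<lambda>(i, j). B i j)"
    using assms by (intro eq_matI) auto
  then show ?thesis by (simp add: detn_def)
qed

lemma detn_leibniz:
  "detn n A = (\<Sum>p | p permutes {..<n}. of_int (sign p) * (\<Prod>i<n. A i (p i)))"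
proof -
  let ?A = "Matrix.mat n n (\<lambda>(i, j). A i j)"
  have *: "(\<Prod>i = 0..<n. ?A $$ (i, p i)) = (\<Prod>i = 0..<n. A i (p i))"
    if "p permutes {0..<n}" for p
    using permutes_in_image[OF that] by (intro prod.cong) auto
  have "detn n A = (\<Sum>p | p permutes {0..<n}. of_int (sign p) * (\<Prod>i = 0..<n. ?A $$ (i, p i)))"
    unfolding detn_def by (rule det_def') simp
  also have "\<dots> = (\<Sum>p | p permutes {0..<n}. of_int (sign p) * (\<Prod>i = 0..<n. A i (p i)))"
    by (rule sum.cong[OF refl], rule arg_cong2[where f = times, OF refl], rule *) simp
  finally show ?thesis by (simp only: lessThan_atLeast0)
qed

lemma detn_mulf: "detn n (mulf n A B) = detn n A * detn n B"
proof -
  have "Matrix.mat n n (\<lambda>(i, j). mulf n A B i j) =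
      Matrix.mat n n (\<lambda>(i, j). A i j) * Matrix.mat n n (\<lambda>(i, j). B i j)"
    by (rule eq_matI) (simp_all add: mulf_def scalar_prod_def lessThan_atLeast0)
  then show ?thesis
    unfolding detn_def by (simp add: det_mult[where n = n])
qed

lemma detn_transpose: "detn n (\<lambda>i j. A j i) = detn n A"
proof -
  have "Matrix.mat n n (\<lambda>(i, j). A j i) = transpose_mat (Matrix.mat n n (\<lambda>(i, j). A i j))"
    by (intro eq_matI) auto
  then show ?thesis
    unfolding detn_def by (simp add: det_transpose[where n = n])
qed

lemma detn_permute_rows:
  assumes "p permutes {..<n}"
  shows "detn n (\<lambda>i. A (p i)) = of_int (sign p) * detn n A"
proof -
  have "Matrix.mat n n (\<lambda>(i, j). A (p i) j) =
      Matrix.mat n n (\<lambda>(i, j). Matrix.mat n n (\<lambda>(i, j). A i j) $$ (p i, j))"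
    using permutes_in_image[OF assms] by (intro eq_matI) auto
  then show ?thesis
    unfolding detn_def
    using det_permute_rows[of "Matrix.mat n n (\<lambda>(i, j). A i j)" n p] assms
    by (simp add: lessThan_atLeast0)
qed

lemma detn_idf: "detn n idf = 1"
proof -
  have "Matrix.mat n n (\<lambda>(i, j). idf i j) = 1\<^sub>m n"
    by (intro eq_matI) (auto simp: idf_def)
  then show ?thesis by (simp add: detn_def)
qed

lemma detn_diagonal: "detn n (\<lambda>i j. if i = j then d i else 0) = (\<Prod>i<n. d i)"
  unfolding detn_def
  by (subst det_upper_triangular[of _ n])
     (auto simp: prod_list_diag_prod lessThan_atLeast0 intro!: prod.cong)

lemma sum_idf_mult:
  assumes "finite S"
  shows "(\<Sum>k\<in>S. idf i k * f k) = (if i \<in> S then f i else 0)"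
    and "(\<Sum>k\<in>S. f k * idf k i) = (if i \<in> S then f i else 0)"
proof -
  have "(\<Sum>k\<in>S. idf i k * f k) = (\<Sum>k\<in>S. if k = i then f k else 0)"
    and "(\<Sum>k\<in>S. f k * idf k i) = (\<Sum>k\<in>S. if k = i then f k else 0)"
    by (auto simp: idf_def intro!: sum.cong)
  then show "(\<Sum>k\<in>S. idf i k * f k) = (if i \<in> S then f i else 0)"
    and "(\<Sum>k\<in>S. f k * idf k i) = (if i \<in> S then f i else 0)"
    using assms by simp_all
qed

lemma mulf_idf_left: "i < n \<Longrightarrow> mulf n idf A i j = A i j"
  by (simp add: mulf_def sum_idf_mult)

lemma mulf_idf_right: "j < n \<Longrightarrow> mulf n A idf i j = A i j"
  by (simp add: mulf_def sum_idf_mult)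

lemma detn_inverse:
  assumes "detn n A \<noteq> 0"
  obtains B where "\<And>i j. i < n \<Longrightarrow> j < n \<Longrightarrow> mulf n A B i j = idf i j"
    and "\<And>i j. i < n \<Longrightarrow> j < n \<Longrightarrow> mulf n B A i j = idf i j"
proof -
  let ?A = "Matrix.mat n n (\<lambda>(i, j). A i j)"
  have "?A \<in> Units (ring_mat TYPE(real) n n)"
    using assms by (intro det_non_zero_imp_unit) (auto simp: detn_def)
  then obtain B where B: "B \<in> carrier_mat n n" "B * ?A = 1\<^sub>m n" "?A * B = 1\<^sub>m n"
    by (auto simp: Units_def ring_mat_def)
  show thesis
  proof (rule that[of "\<lambda>i j. B $$ (i, j)"])
    fix i j assume ij: "i < n" "j < n"
    have "(?A * B) $$ (i, j) = idf i j" "(B * ?A) $$ (i, j) = idf i j"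
      using ij B(2,3) by (auto simp: idf_def)
    then show "mulf n A (\<lambda>i j. B $$ (i, j)) i j = idf i j" "mulf n (\<lambda>i j. B $$ (i, j)) A i j = idf i j"
      using ij B(1) by (auto simp: mulf_def scalar_prod_def lessThan_atLeast0)
  qed
qed

text \<open>Both sides are the determinant of the block matrix with rows \<open>(1, a)\<close> and \<open>(w, 1)\<close>,
  computed by eliminating either off-diagonal block.\<close>

lemma detn_rank_one: "detn n (\<lambda>i j. idf i j - a i * w j) = 1 - (\<Sum>i<n. w i * a i)"
proof -
  define I where "I = (1\<^sub>m n :: real mat)"
  define E1 where "E1 = (1\<^sub>m 1 :: real mat)"
  define a' where "a' = Matrix.mat n 1 (\<lambda>(i, j). a i)"
  define w' where "w' = Matrix.mat 1 n (\<lambda>(i, j). w j)"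
  define P where "P = Matrix.mat n n (\<lambda>(i, j). idf i j - a i * w j)"
  define q where "q = Matrix.mat 1 1 (\<lambda>(i, j). 1 - (\<Sum>i<n. w i * a i))"
  note defs = I_def E1_def a'_def w'_def P_def q_def
  have carr: "I \<in> carrier_mat n n" "E1 \<in> carrier_mat 1 1" "a' \<in> carrier_mat n 1"
    "w' \<in> carrier_mat 1 n" "P \<in> carrier_mat n n" "q \<in> carrier_mat 1 1"
    by (auto simp: defs)
  have 1: "four_block_mat I (0\<^sub>m n 1) w' E1 * four_block_mat I a' (0\<^sub>m 1 n) q = four_block_mat I a' w' E1"
    using carr
    apply (subst mult_four_block_mat[of _ n n _ 1 _ 1 _ _ n _ 1])
            apply auto
    by (rule cong_four_block_mat)
       (auto simp: defs scalar_prod_def lessThan_atLeast0 intro!: eq_matI)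
  have 2: "four_block_mat P a' (0\<^sub>m 1 n) E1 * four_block_mat I (0\<^sub>m n 1) w' E1 = four_block_mat I a' w' E1"
    using carr
    apply (subst mult_four_block_mat[of _ n n _ 1 _ 1 _ _ n _ 1])
            apply auto
    by (rule cong_four_block_mat)
       (auto simp: defs scalar_prod_def idf_def intro!: eq_matI)
  have c: "four_block_mat I (0\<^sub>m n 1) w' E1 \<in> carrier_mat (n+1) (n+1)" 
    "four_block_mat I a' (0\<^sub>m 1 n) q \<in> carrier_mat (n+1) (n+1)"
    "four_block_mat P a' (0\<^sub>m 1 n) E1 \<in> carrier_mat (n+1) (n+1)"
    using carr by (auto intro!: four_block_carrier_mat)
  have d1: "Determinant.det (four_block_mat I (0\<^sub>m n 1) w' E1) = 1"
    using carr by (subst det_four_block_mat_upper_right_zero[of _ n _ 1]) (auto simp: I_def E1_def)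
  have d2: "Determinant.det (four_block_mat I a' (0\<^sub>m 1 n) q) = Determinant.det q"
    using carr by (subst det_four_block_mat_lower_left_zero[of _ n _ 1]) (auto simp: I_def)
  have d3: "Determinant.det (four_block_mat P a' (0\<^sub>m 1 n) E1) = Determinant.det P"
    using carr by (subst det_four_block_mat_lower_left_zero[of _ n _ 1]) (auto simp: E1_def)
  have "Determinant.det q = Determinant.det P"
    using arg_cong[OF trans[OF 1 2[symmetric]], of Determinant.det] d1 d2 d3 c
    by (simp add: det_mult[where n = "n+1"])
  moreover have "Determinant.det q = 1 - (\<Sum>i<n. w i * a i)"
    by (subst det_single) (auto simp: q_def)
  ultimately show ?thesis by (simp add: detn_def P_def)
qed

text \<open>The matrix is the identity minus the rank-one matrix with column e_k and row e_k -
  c.\<close>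

lemma detn_row_replace:
  assumes "k < n"
  shows "detn n (\<lambda>i j. if i = k then c j else idf i j) = c k"
proof -
  have "detn n (\<lambda>i j. if i = k then c j else idf i j)
      = detn n (\<lambda>i j. idf i j - idf i k * (idf k j - c j))"
    by (intro detn_cong) (auto simp: idf_def)
  also have "\<dots> = 1 - (\<Sum>i<n. (idf k i - c i) * idf i k)"
    by (rule detn_rank_one)
  also have "(\<Sum>i<n. (idf k i - c i) * idf i k) = 1 - c k"
    using assms by (subst sum_idf_mult) (simp_all add: idf_def)
  finally show ?thesis by simp
qed

text \<open>Matrix determinant lemma: \<open>M - w w\<^sup>T = M (1 - (Y w) w\<^sup>T)\<close> when \<open>Y\<close> is a right inverse of \<open>M\<close>.\<close>

lemma detn_minus_rank_one:
  assumes "\<And>i j. i < n \<Longrightarrow> j < n \<Longrightarrow> mulf n M Y i j = idf i j"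
  shows "detn n (\<lambda>i j. M i j - w i * w j) = detn n M * (1 - (\<Sum>i<n. w i * (\<Sum>j<n. Y i j * w j)))"
proof -
  define a where "a i = (\<Sum>j<n. Y i j * w j)" for i
  have a: "(\<Sum>k<n. M i k * a k) = w i" if "i < n" for i
  proof -
    have "(\<Sum>k<n. M i k * a k) = (\<Sum>j<n. mulf n M Y i j * w j)"
      unfolding a_def mulf_def
      by (simp add: sum_distrib_left sum_distrib_right mult.assoc) (rule sum.swap)
    also have "\<dots> = (\<Sum>j<n. idf i j * w j)"
      using that assms by (intro sum.cong) auto
    also have "\<dots> = w i"
      using that by (simp add: sum_idf_mult)
    finally show ?thesis .
  qed
  have "detn n (\<lambda>i j. M i j - w i * w j) = detn n (mulf n M (\<lambda>i j. idf i j - a i * w j))"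
  proof (rule detn_cong)
    fix i j assume ij: "i < n" "j < n"
    have "mulf n M (\<lambda>i j. idf i j - a i * w j) i j = mulf n M idf i j - (\<Sum>k<n. M i k * a k) * w j"
      by (simp add: mulf_def right_diff_distrib sum_subtractf sum_distrib_right mult.assoc)
    then show "M i j - w i * w j = mulf n M (\<lambda>i j. idf i j - a i * w j) i j"
      using ij by (simp add: a mulf_idf_right)
  qed
  then show ?thesis
    by (simp add: detn_mulf detn_rank_one a_def)
qed

text \<open>Cauchy--Binet, summed over all index functions instead of n-subsets: non-injective ones
  contribute 0 and every subset is counted n! times. One of the two determinant factors is expanded
  by the Leibniz formula; every permutation then contributes the same amount \<open>M\<close>, which
  is the expansion of the determinant on the right.\<close>

lemma sum_detn_square:
  fixes u :: "'a \<Rightarrow> nat \<Rightarrow> real"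
  assumes "finite J"
  shows "(\<Sum>f \<in> {..<n} \<rightarrow>\<^sub>E J. (detn n (\<lambda>i. u (f i)))\<^sup>2) = fact n * detn n (\<lambda>i k. \<Sum>j\<in>J. u j i * u j k)"
proof -
  let ?F = "{..<n} \<rightarrow>\<^sub>E J" and ?S = "{p. p permutes {..<n}}"
  define M where "M = (\<Sum>g\<in>?F. (\<Prod>k<n. u (g k) k) * detn n (\<lambda>i. u (g i)))"
  have Meq: "M = detn n (\<lambda>i k. \<Sum>j\<in>J. u j i * u j k)"
  proof -
    have "detn n (\<lambda>i k. \<Sum>j\<in>J. u j i * u j k)
        = (\<Sum>p\<in>?S. of_int (sign p) * (\<Sum>g\<in>?F. \<Prod>i<n. u (g i) i * u (g i) (p i)))"
      unfolding detn_leibniz using assms by (subst prod_sum_PiE) auto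
    also have "\<dots> = (\<Sum>g\<in>?F. \<Sum>p\<in>?S. of_int (sign p) * (\<Prod>i<n. u (g i) i * u (g i) (p i)))"
      by (simp add: sum_distrib_left) (rule sum.swap)
    also have "\<dots> = M"
      unfolding M_def detn_leibniz
      by (intro sum.cong) (auto simp: sum_distrib_left prod.distrib mult_ac)
    finally show ?thesis ..
  qed
  \<comment> \<open>Substituting f = g o p cancels the sign of p against that of the permuted rows,
    and p disappears from the product.\<close>
  have inner: "(\<Sum>f\<in>?F. of_int (sign p) * (\<Prod>i<n. u (f i) (p i)) * detn n (\<lambda>i. u (f i))) = M"
    if p: "p permutes {..<n}" for p
  proof -
    have pin: "p i < n \<longleftrightarrow> i < n" for i using permutes_in_image[OF p, of i] by simp
    have q: "inv_into UNIV p permutes {..<n}" by (rule permutes_inv[OF p])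
    have qin: "inv_into UNIV p i < n \<longleftrightarrow> i < n" for i using permutes_in_image[OF q, of i] by simp
    have bij: "bij_betw (\<lambda>g. restrict (g \<circ> p) {..<n}) ?F ?F"
    proof (rule bij_betw_byWitness[where f' = "\<lambda>g. restrict (g \<circ> inv_into UNIV p) {..<n}"])
      have "restrict (restrict (g \<circ> p) {..<n} \<circ> inv_into UNIV p) {..<n} = g"
        and "restrict (restrict (g \<circ> inv_into UNIV p) {..<n} \<circ> p) {..<n} = g" if "g \<in> ?F" for g
      proof -
        have g: "g i = undefined" if "\<not> i < n" for i
          using \<open>g \<in> ?F\<close> that by (auto simp: PiE_def extensional_def)
        show "restrict (restrict (g \<circ> p) {..<n} \<circ> inv_into UNIV p) {..<n} = g"
          by (rule ext) (simp add: restrict_def qin permutes_inverses[OF p] g)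
        show "restrict (restrict (g \<circ> inv_into UNIV p) {..<n} \<circ> p) {..<n} = g"
          by (rule ext) (simp add: restrict_def pin permutes_inverses[OF p] g)
      qed
      then show "\<forall>g\<in>?F. restrict (restrict (g \<circ> p) {..<n} \<circ> inv_into UNIV p) {..<n} = g"
        "\<forall>g\<in>?F. restrict (restrict (g \<circ> inv_into UNIV p) {..<n} \<circ> p) {..<n} = g" by blast+
      show "(\<lambda>g. restrict (g \<circ> p) {..<n}) ` ?F \<subseteq> ?F"
        "(\<lambda>g. restrict (g \<circ> inv_into UNIV p) {..<n}) ` ?F \<subseteq> ?F"
        using PiE_mem[of _ "{..<n}" "\<lambda>_. J"] by (auto simp: image_subset_iff restrict_PiE_iff pin qin)
    qed
    have "(\<Sum>f\<in>?F. of_int (sign p) * (\<Prod>i<n. u (f i) (p i)) * detn n (\<lambda>i. u (f i)))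
        = (\<Sum>g\<in>?F. of_int (sign p) * (\<Prod>i<n. u (restrict (g \<circ> p) {..<n} i) (p i))
            * detn n (\<lambda>i. u (restrict (g \<circ> p) {..<n} i)))"
      by (rule sum.reindex_bij_betw[OF bij, symmetric])
    also have "\<dots> = (\<Sum>g\<in>?F. (\<Prod>k<n. u (g k) k) * detn n (\<lambda>i. u (g i)))"
    proof (rule sum.cong[OF refl])
      fix g assume "g \<in> ?F"
      have "detn n (\<lambda>i. u (restrict (g \<circ> p) {..<n} i)) = detn n (\<lambda>i. (\<lambda>i. u (g i)) (p i))"
        by (intro detn_cong) auto
      also have "\<dots> = of_int (sign p) * detn n (\<lambda>i. u (g i))"
        by (rule detn_permute_rows[OF p])
      finally have d: "detn n (\<lambda>i. u (restrict (g \<circ> p) {..<n} i)) = of_int (sign p) * detn n (\<lambda>i. u (g i))" .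
      have "(\<Prod>i<n. u (restrict (g \<circ> p) {..<n} i) (p i)) = (\<Prod>i<n. (\<lambda>k. u (g k) k) (p i))"
        by (intro prod.cong) auto
      also have "\<dots> = (\<Prod>k<n. u (g k) k)"
        using prod.permute[OF p, of "\<lambda>k. u (g k) k"] by (simp add: comp_def)
      finally have e: "(\<Prod>i<n. u (restrict (g \<circ> p) {..<n} i) (p i)) = (\<Prod>k<n. u (g k) k)" .
      show "of_int (sign p) * (\<Prod>i<n. u (restrict (g \<circ> p) {..<n} i) (p i))
          * detn n (\<lambda>i. u (restrict (g \<circ> p) {..<n} i)) = (\<Prod>k<n. u (g k) k) * detn n (\<lambda>i. u (g i))"
        unfolding d e
        by (simp only: sign_def) simp
    qed
    finally show ?thesis by (simp add: M_def)
  qed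
  have "(\<Sum>f\<in>?F. (detn n (\<lambda>i. u (f i)))\<^sup>2)
      = (\<Sum>f\<in>?F. \<Sum>p\<in>?S. of_int (sign p) * (\<Prod>i<n. u (f i) (p i)) * detn n (\<lambda>i. u (f i)))"
    unfolding power2_eq_square
    by (intro sum.cong refl, subst (1) detn_leibniz) (rule sum_distrib_right)
  also have "\<dots> = (\<Sum>p\<in>?S. M)"
    by (subst sum.swap) (auto intro!: sum.cong simp: inner)
  also have "\<dots> = fact n * M"
    by (simp add: card_permutations[OF refl])
  finally show ?thesis using Meq by simp
qed

section \<open>Linear change of variables\<close>

abbreviation lbn :: "nat \<Rightarrow> (nat \<Rightarrow> real) measure" where
  "lbn n \<equiv> \<Pi>\<^sub>M i\<in>{..<n}. lborel"

definition mvf :: "nat \<Rightarrow> (nat \<Rightarrow> nat \<Rightarrow> real) \<Rightarrow> (nat \<Rightarrow> real) \<Rightarrow> nat \<Rightarrow> real" where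
  "mvf n A x = (\<lambda>i\<in>{..<n}. \<Sum>j<n. A i j * x j)"

definition addf :: "nat \<Rightarrow> (nat \<Rightarrow> real) \<Rightarrow> (nat \<Rightarrow> real) \<Rightarrow> nat \<Rightarrow> real" where
  "addf n x y = (\<lambda>i\<in>{..<n}. x i + y i)"

lemma space_lbn: "space (lbn n) = Rn n"
  by (simp add: space_PiM)

lemma mvf_in_Rn [simp]: "mvf n A x \<in> Rn n"
  by (simp add: mvf_def)

lemma addf_in_Rn [simp]: "addf n x y \<in> Rn n"
  by (simp add: addf_def)

lemma mvf_mulf: "mvf n (mulf n A B) x = mvf n A (mvf n B x)"
proof -
  have "(\<Sum>j<n. mulf n A B i j * x j) = (\<Sum>k<n. A i k * (\<Sum>j<n. B k j * x j))" for i
  proof -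
    have "(\<Sum>j<n. mulf n A B i j * x j) = (\<Sum>j<n. \<Sum>k<n. A i k * B k j * x j)"
      by (simp add: mulf_def sum_distrib_right)
    also have "\<dots> = (\<Sum>k<n. \<Sum>j<n. A i k * B k j * x j)"
      by (rule sum.swap)
    finally show ?thesis by (simp add: sum_distrib_left mult.assoc)
  qed
  then show ?thesis by (simp add: mvf_def)
qed

lemma mvf_cong:
  assumes "\<And>i j. i < n \<Longrightarrow> j < n \<Longrightarrow> A i j = B i j"
  shows "mvf n A x = mvf n B x"
  using assms by (auto simp: mvf_def restrict_def)

lemma mvf_idf: "x \<in> Rn n \<Longrightarrow> mvf n idf x = x"
  by (auto simp: mvf_def sum_idf_mult restrict_def fun_eq_iff PiE_def extensional_def)

lemma measurable_mvf [measurable]: "mvf n A \<in> measurable (lbn n) (lbn n)"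
  unfolding mvf_def by measurable

lemma measurable_addf [measurable]: "addf n b \<in> measurable (lbn n) (lbn n)"
  unfolding addf_def by measurable

lemma measurable_addf_pair [measurable]:
  "(\<lambda>(x, y). addf n x y) \<in> measurable (lbn n \<Otimes>\<^sub>M lbn n) (lbn n)"
  unfolding addf_def by measurable

interpretation lbn: product_sigma_finite "\<lambda>_::nat. lborel :: real measure"
  by standard

text \<open>Quantified over all integrands, the change of variables formula is closed under matrix
  products, so that it only has to be checked on elementary factors.\<close>

definition nn_transform :: "nat \<Rightarrow> (nat \<Rightarrow> nat \<Rightarrow> real) \<Rightarrow> bool" where
  "nn_transform n A \<longleftrightarrow> (\<forall>f \<in> borel_measurable (lbn n).
     (\<integral>\<^sup>+x. f x \<partial>lbn n) = ennreal \<bar>detn n A\<bar> * (\<integral>\<^sup>+x. f (mvf n A x) \<partial>lbn n))"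

lemma nn_transformD:
  assumes "nn_transform n A" "f \<in> borel_measurable (lbn n)"
  shows "(\<integral>\<^sup>+x. f x \<partial>lbn n) = ennreal \<bar>detn n A\<bar> * (\<integral>\<^sup>+x. f (mvf n A x) \<partial>lbn n)"
  using assms(1)[unfolded nn_transform_def] assms(2) by (rule bspec)

lemma nn_transform_cong:
  assumes "nn_transform n A" "\<And>i j. i < n \<Longrightarrow> j < n \<Longrightarrow> A i j = B i j"
  shows "nn_transform n B"
proof -
  have *: "detn n A = detn n B" "mvf n A = mvf n B"
    using detn_cong[of n A B] mvf_cong[of n A B] assms(2) by auto
  show ?thesis
    using assms(1) unfolding nn_transform_def * .
qed

lemma nn_transform_mulf:
  assumes "nn_transform n A" "nn_transform n B"
  shows "nn_transform n (mulf n A B)"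
  unfolding nn_transform_def
proof
  fix f :: "_ \<Rightarrow> ennreal" assume f [measurable]: "f \<in> borel_measurable (lbn n)"
  have "(\<integral>\<^sup>+x. f x \<partial>lbn n) = ennreal \<bar>detn n A\<bar> * (\<integral>\<^sup>+x. f (mvf n A x) \<partial>lbn n)"
    by (rule nn_transformD[OF assms(1) f])
  also have "(\<integral>\<^sup>+x. f (mvf n A x) \<partial>lbn n) = ennreal \<bar>detn n B\<bar> * (\<integral>\<^sup>+x. f (mvf n A (mvf n B x)) \<partial>lbn n)"
    by (rule nn_transformD[OF assms(2)]) measurable
  finally show "(\<integral>\<^sup>+x. f x \<partial>lbn n) =
      ennreal \<bar>detn n (mulf n A B)\<bar> * (\<integral>\<^sup>+x. f (mvf n (mulf n A B) x) \<partial>lbn n)"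
    by (simp add: mvf_mulf detn_mulf abs_mult ennreal_mult mult.assoc)
qed

text \<open>Only coordinate \<open>k\<close> moves: Fubini isolates it, and the inner integral is an
  affine substitution on the real line with slope \<open>c k\<close>.\<close>

lemma nn_transform_row_replace:
  assumes k: "k < n" and ck: "c k \<noteq> 0"
  shows "nn_transform n (\<lambda>i j. if i = k then c j else idf i j)" (is "nn_transform n ?R")
  unfolding nn_transform_def
proof
  fix f :: "_ \<Rightarrow> ennreal" assume f [measurable]: "f \<in> borel_measurable (lbn n)"
  define I where "I = {..<n} - {k}"
  have I: "finite I" "k \<notin> I" and n: "{..<n} = insert k I"
    using k by (auto simp: I_def)
  have fI: "f \<in> borel_measurable (Pi\<^sub>M (insert k I) (\<lambda>_. lborel))"
    using f by (simp add: n)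
  have gI: "(\<lambda>x. f (mvf n ?R x)) \<in> borel_measurable (Pi\<^sub>M (insert k I) (\<lambda>_. lborel))"
    using measurable_compose[OF measurable_mvf f] by (simp add: n)
  have "(\<integral>\<^sup>+x. f (mvf n ?R x) \<partial>lbn n) =
      (\<integral>\<^sup>+x. \<integral>\<^sup>+y. f (mvf n ?R (x(k := y))) \<partial>lborel \<partial>Pi\<^sub>M I (\<lambda>_. lborel))"
    unfolding n by (rule lbn.product_nn_integral_insert[OF I gI[unfolded n]])
  also have "\<dots> * ennreal \<bar>c k\<bar> = (\<integral>\<^sup>+x. (\<integral>\<^sup>+y. f (mvf n ?R (x(k := y))) \<partial>lborel) * ennreal \<bar>c k\<bar> \<partial>Pi\<^sub>M I (\<lambda>_. lborel))"
  proof (rule nn_integral_multc[symmetric])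
    have "(\<lambda>(x, y). f (mvf n ?R (x(k := y)))) \<in> borel_measurable (Pi\<^sub>M I (\<lambda>_. lborel) \<Otimes>\<^sub>M lborel)"
      using measurable_compose[OF measurable_add_dim gI] by (simp add: case_prod_beta')
    then show "(\<lambda>x. \<integral>\<^sup>+y. f (mvf n ?R (x(k := y))) \<partial>lborel) \<in> borel_measurable (Pi\<^sub>M I (\<lambda>_. lborel))"
      by (intro lborel.borel_measurable_nn_integral) simp
  qed
  also have "\<dots> = (\<integral>\<^sup>+x. \<integral>\<^sup>+y. f (x(k := y)) \<partial>lborel \<partial>Pi\<^sub>M I (\<lambda>_. lborel))"
  proof (rule nn_integral_cong)
    fix x :: "nat \<Rightarrow> real" assume x: "x \<in> space (Pi\<^sub>M I (\<lambda>_. lborel))"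
    have "(\<lambda>y. x(k := y)) \<in> measurable lborel (Pi\<^sub>M (insert k I) (\<lambda>_. lborel))"
      using measurable_component_update[OF x I(2)] by simp
    from measurable_compose[OF this fI] have m: "(\<lambda>y. f (x(k := y))) \<in> borel_measurable borel"
      by simp
    have "mvf n ?R (x(k := y)) = x(k := (\<Sum>j\<in>I. c j * x j) + c k * y)" for y
    proof
      fix i
      have s: "(\<Sum>j<n. g j) = g k + (\<Sum>j\<in>I. g j)" for g :: "nat \<Rightarrow> real"
        using I by (simp add: n)
      have "(\<Sum>j\<in>I. c j * (if j = k then y else x j)) = (\<Sum>j\<in>I. c j * x j)"
        using I by (intro sum.cong) auto
      moreover have "(\<Sum>j\<in>I. idf i j * (if j = k then y else x j)) = (if i \<in> I then x i else 0)" 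
      proof -
        have "(\<Sum>j\<in>I. idf i j * (if j = k then y else x j)) = (\<Sum>j\<in>I. if j = i then x j else 0)"
          using I by (intro sum.cong) (auto simp: idf_def)
        then show ?thesis using I by simp
      qed
      moreover have "i < n \<longleftrightarrow> i = k \<or> i \<in> I" using n by blast
      moreover have "x i = undefined" if "i \<notin> I"
        using x that by (auto simp: space_PiM PiE_def extensional_def)
      ultimately show "mvf n ?R (x(k := y)) i = (x(k := (\<Sum>j\<in>I. c j * x j) + c k * y)) i"
        using I by (simp add: mvf_def s fun_upd_def idf_def)
    qed
    then show "(\<integral>\<^sup>+y. f (mvf n ?R (x(k := y))) \<partial>lborel) * ennreal \<bar>c k\<bar> = (\<integral>\<^sup>+y. f (x(k := y)) \<partial>lborel)"
      using nn_integral_real_affine[OF m ck, of "\<Sum>j\<in>I. c j * x j"] by (simp add: mult.commute)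
  qed
  also have "\<dots> = (\<integral>\<^sup>+x. f x \<partial>lbn n)"
    unfolding n by (rule lbn.product_nn_integral_insert[OF I fI[unfolded n], symmetric])
  finally show "(\<integral>\<^sup>+x. f x \<partial>lbn n) = ennreal \<bar>detn n ?R\<bar> * (\<integral>\<^sup>+x. f (mvf n ?R x) \<partial>lbn n)"
    by (simp add: detn_row_replace[OF k] mult.commute)
qed

text \<open>Gaussian elimination with one-row replacements only: a matrix whose first \<open>k\<close> rows are
  those of the identity is reduced to one whose first \<open>k + 1\<close> rows are.\<close>

lemma nn_transform:
  assumes "detn n A \<noteq> 0"
  shows "nn_transform n A"
proof -
  have "nn_transform n A" if "k \<le> n" "\<And>j l. j < k \<Longrightarrow> l < n \<Longrightarrow> A j l = idf j l" "detn n A \<noteq> 0" for k A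
    using that
  proof (induction k arbitrary: A rule: inc_induct)
    case base
    have "nn_transform n idf"
      by (auto simp: nn_transform_def detn_idf mvf_idf space_PiM intro!: nn_integral_cong)
    then show ?case using base by (rule_tac nn_transform_cong) auto
  next
    case (step k)
    have case1: "nn_transform n A" if A: "\<And>j l. j < k \<Longrightarrow> l < n \<Longrightarrow> A j l = idf j l" "detn n A \<noteq> 0"
        and nz: "A k k \<noteq> 0" for A
    proof -
      \<comment> \<open>\<open>R\<close> carries row \<open>k\<close> of \<open>A\<close> and
        \<open>R'\<close> is its inverse: A R' agrees with the identity in one more row, and A = (A
        R') R.\<close>
      define R where "R = (\<lambda>i j. if i = k then A k j else idf i j)"
      define R' where "R' = (\<lambda>i j. if i = k then (if j = k then 1 / A k k else - A k j / A k k) else idf i j)"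
      have sp: "(\<Sum>i<n. g i) = g k + (\<Sum>i\<in>{..<n}-{k}. g i)" for g :: "nat \<Rightarrow> real"
        using step by (intro sum.remove) auto
      have sR: "(\<Sum>i\<in>{..<n}-{k}. a i * idf i l) = (if l = k then 0 else a l)" if "l < n" for a l
      proof -
        have "(\<Sum>i\<in>{..<n}-{k}. a i * idf i l) = (\<Sum>i\<in>{..<n}-{k}. if i = l then a i else 0)"
          by (intro sum.cong) (auto simp: idf_def)
        then show ?thesis using that by simp
      qed
      have AR': "mulf n B R' i l = B i k * R' k l + (if l = k then 0 else B i l)" if "l < n" for B i l
      proof -
        have "mulf n B R' i l = B i k * R' k l + (\<Sum>m\<in>{..<n}-{k}. B i m * idf m l)"
          unfolding mulf_def by (subst sp) (auto simp: R'_def intro!: sum.cong)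
        then show ?thesis using sR[OF that] by simp
      qed
      have AR: "mulf n B R i l = B i k * R k l + (if l = k then 0 else B i l)" if "l < n" for B i l
      proof -
        have "mulf n B R i l = B i k * R k l + (\<Sum>m\<in>{..<n}-{k}. B i m * idf m l)"
          unfolding mulf_def by (subst sp) (auto simp: R_def intro!: sum.cong)
        then show ?thesis using sR[OF that] by simp
      qed
      have eq: "mulf n (mulf n A R') R i l = A i l" if "i < n" "l < n" for i l
        using that step.hyps nz by (simp add: AR AR') (simp add: R_def R'_def)
      have det: "detn n (mulf n A R') * detn n R = detn n A"
        using detn_mulf[of n "mulf n A R'" R] detn_cong[of n "mulf n (mulf n A R') R" A] eq by simp
      have "nn_transform n (mulf n A R')"
      proof (rule step.IH)
        fix j l assume "j < Suc k" "l < n"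
        then show "mulf n A R' j l = idf j l"
          using A(1)[of j l] A(1)[of j k] step.hyps nz
          by (cases "j = k") (auto simp: AR', auto simp: R'_def idf_def)
      qed (use A det in auto)
      moreover have "nn_transform n R"
        unfolding R_def using nz step.hyps by (intro nn_transform_row_replace) auto
      ultimately show ?thesis
        by (rule nn_transform_cong[OF nn_transform_mulf]) (rule eq)
    qed
    show ?case
    proof (cases "A k k = 0")
      case False
      then show ?thesis
        using step.prems by (intro case1) auto
    next
      case True
      obtain B where B: "\<And>i j. i < n \<Longrightarrow> j < n \<Longrightarrow> mulf n A B i j = idf i j"
        using detn_inverse[OF step.prems(2)] by metis
      \<comment> \<open>The first \<open>k\<close> rows of \<open>A\<close> are identity rows, so
        column \<open>k\<close> of \<open>B\<close> vanishes above the diagonal; if row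
        \<open>k\<close> of \<open>A\<close> vanished from column \<open>k\<close> on, entry (k, k)
        of A B would be 0.\<close>
      have "\<exists>l. k < l \<and> l < n \<and> A k l \<noteq> 0"
      proof (rule ccontr)
        assume contra: "\<not> ?thesis"
        have "A k l * B l k = 0" if "l < n" for l
        proof (cases "l < k")
          case True
          have "mulf n A B l k = mulf n idf B l k"
            unfolding mulf_def using True step.prems(1) by (intro sum.cong) auto
          then have "B l k = idf l k"
            using B[of l k] that True step.hyps by (simp add: mulf_idf_left)
          then show ?thesis using True by (simp add: idf_def)
        next
          case False
          then have "A k l = 0" using contra True that by (cases "l = k") auto
          then show ?thesis by simp
        qed
        then have "mulf n A B k k = 0"
          unfolding mulf_def by (intro sum.neutral) auto
        then show False using B[of k k] step.hyps by (simp add: idf_def)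
      qed
      then obtain l where l: "k < l" "l < n" "A k l \<noteq> 0" by blast
      \<comment> \<open>Right multiplication by \<open>S s\<close> adds \<open>s\<close> times
        column \<open>l\<close> to column \<open>k\<close>. \<open>S 1\<close> makes the pivot
        non-zero, \<open>S (-1)\<close> undoes this, and both differ from the identity in row
        \<open>l\<close> only.\<close>
      define S where "S s = (\<lambda>i j. if i = l then (if j = k then s else idf l j) else idf i j)" for s :: real
      have sp: "(\<Sum>i<n. g i) = g l + (\<Sum>i\<in>{..<n}-{l}. g i)" for g :: "nat \<Rightarrow> real"
        using l by (intro sum.remove) auto
      have AS: "mulf n C (S s) i m = C i m + (if m = k then C i l * s else 0)" if "m < n" for C s i m
      proof -
        have "mulf n C (S s) i m = C i l * S s l m + (\<Sum>j\<in>{..<n}-{l}. C i j * idf j m)"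
          unfolding mulf_def by (subst sp) (auto simp: S_def intro!: sum.cong)
        also have "(\<Sum>j\<in>{..<n}-{l}. C i j * idf j m) = (\<Sum>j\<in>{..<n}-{l}. if j = m then C i j else 0)"
          by (intro sum.cong) (auto simp: idf_def)
        also have "C i l * S s l m + \<dots> = C i m + (if m = k then C i l * s else 0)"
          using that l by (auto simp: S_def idf_def)
        finally show ?thesis .
      qed
      have gS: "nn_transform n (S s)" for s
        unfolding S_def using l by (intro nn_transform_row_replace[of l n "\<lambda>j. if j = k then s else idf l j"]) (auto simp: idf_def)
      have dS: "detn n (S s) = 1" for s
        unfolding S_def using l
        by (subst detn_row_replace[of l n "\<lambda>j. if j = k then s else idf l j"]) (auto simp: idf_def)
      have "nn_transform n (mulf n A (S 1))"
      proof (rule case1)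
        show "mulf n A (S 1) j m = idf j m" if "j < k" "m < n" for j m
          using that step.prems(1)[of j m] step.prems(1)[of j l] l by (auto simp: AS idf_def)
        show "detn n (mulf n A (S 1)) \<noteq> 0"
          using step.prems(2) by (simp add: detn_mulf dS)
        show "mulf n A (S 1) k k \<noteq> 0"
          using l True by (simp add: AS)
      qed
      then have "nn_transform n (mulf n (mulf n A (S 1)) (S (-1)))"
        using gS by (rule nn_transform_mulf)
      then show ?thesis
        by (rule nn_transform_cong) (use l in \<open>auto simp: AS\<close>)
    qed
  qed
  from this[of 0 A] assms show ?thesis by simp
qed

section \<open>Translations and measures of affine images\<close>

lemma distr_addf: "distr (lbn n) (lbn n) (addf n b) = lbn n"
proof (rule lbn.PiM_eqI)
  fix A :: "nat \<Rightarrow> real set" assume A: "\<And>i. i \<in> {..<n} \<Longrightarrow> A i \<in> sets lborel"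
  have "emeasure (distr (lbn n) (lbn n) (addf n b)) (Pi\<^sub>E {..<n} A) =
      emeasure (lbn n) (addf n b -` Pi\<^sub>E {..<n} A \<inter> space (lbn n))"
    using A by (intro emeasure_distr) (auto intro!: sets_PiM_I_finite)
  also have "addf n b -` Pi\<^sub>E {..<n} A \<inter> space (lbn n) = (\<Pi>\<^sub>E i\<in>{..<n}. {t. b i + t \<in> A i})"
  proof -
    have "x \<in> addf n b -` Pi\<^sub>E {..<n} A \<inter> space (lbn n) \<longleftrightarrow> x \<in> (\<Pi>\<^sub>E i\<in>{..<n}. {t. b i + t \<in> A i})" for x
      by (simp add: addf_def space_PiM PiE_iff)
    then show ?thesis by blast
  qed
  also have "emeasure (lbn n) \<dots> = (\<Prod>i<n. emeasure lborel {t. b i + t \<in> A i})"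
    using A by (intro lbn.emeasure_PiM) (auto simp: vimage_def)
  also have "\<dots> = (\<Prod>i<n. emeasure lborel (A i))"
  proof (rule prod.cong[OF refl])
    fix i assume "i \<in> {..<n}"
    then have [measurable]: "A i \<in> sets borel" using A by simp
    have "emeasure lborel (A i) = emeasure (distr lborel borel ((+) (b i))) (A i)"
      by (subst lborel_distr_plus) (rule refl)
    also have "\<dots> = emeasure lborel {t. b i + t \<in> A i}"
      by (subst emeasure_distr) (auto simp: vimage_def)
    finally show "emeasure lborel {t. b i + t \<in> A i} = emeasure lborel (A i)" ..
  qed
  finally show "emeasure (distr (lbn n) (lbn n) (addf n b)) (Pi\<^sub>E {..<n} A) = (\<Prod>i<n. emeasure lborel (A i))" .
qed auto

lemma nn_integral_addf:
  assumes [measurable]: "f \<in> borel_measurable (lbn n)"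
  shows "(\<integral>\<^sup>+x. f (addf n b x) \<partial>lbn n) = (\<integral>\<^sup>+x. f x \<partial>lbn n)"
proof -
  have "(\<integral>\<^sup>+x. f x \<partial>lbn n) = (\<integral>\<^sup>+x. f x \<partial>distr (lbn n) (lbn n) (addf n b))"
    by (simp only: distr_addf)
  then show ?thesis by (simp add: nn_integral_distr)
qed

lemma emeasure_affine_image:
  assumes A: "detn n A \<noteq> 0" and X: "X \<in> sets (lbn n)"
  shows "(\<lambda>x. addf n b (mvf n A x)) ` X \<in> sets (lbn n)" (is "?Y \<in> _")
    and "emeasure (lbn n) ((\<lambda>x. addf n b (mvf n A x)) ` X) = ennreal \<bar>detn n A\<bar> * emeasure (lbn n) X"
proof -
  obtain B where B: "\<And>i j. i < n \<Longrightarrow> j < n \<Longrightarrow> mulf n A B i j = idf i j"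
      "\<And>i j. i < n \<Longrightarrow> j < n \<Longrightarrow> mulf n B A i j = idf i j"
    using detn_inverse[OF A] by metis
  have AB: "mvf n A (mvf n B x) = x" "mvf n B (mvf n A x) = x" if "x \<in> Rn n" for x
    using that mvf_mulf[of n A B x] mvf_mulf[of n B A x] mvf_cong[OF B(1)] mvf_cong[OF B(2)] mvf_idf by auto
  have bb: "addf n b (addf n (\<lambda>i. - b i) x) = x" "addf n (\<lambda>i. - b i) (addf n b x) = x" if "x \<in> Rn n" for x
    using that by (auto simp: addf_def fun_eq_iff PiE_def extensional_def)
  have XR: "X \<subseteq> Rn n" using sets.sets_into_space[OF X] by (simp add: space_lbn)
  have Y: "?Y = (\<lambda>y. mvf n B (addf n (\<lambda>i. - b i) y)) -` X \<inter> space (lbn n)"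
  proof (rule antisym; rule subsetI)
    fix y assume "y \<in> ?Y"
    then obtain x where "x \<in> X" "y = addf n b (mvf n A x)" by blast
    then show "y \<in> (\<lambda>y. mvf n B (addf n (\<lambda>i. - b i) y)) -` X \<inter> space (lbn n)"
      using XR by (simp only: vimage_def mem_Collect_eq Int_iff space_lbn addf_in_Rn mvf_in_Rn AB bb subsetD)
  next
    fix y assume y: "y \<in> (\<lambda>y. mvf n B (addf n (\<lambda>i. - b i) y)) -` X \<inter> space (lbn n)"
    then have "y = addf n b (mvf n A (mvf n B (addf n (\<lambda>i. - b i) y)))"
      by (simp add: AB bb space_lbn)
    then show "y \<in> ?Y" using y by blast
  qed
  show Ym: "?Y \<in> sets (lbn n)"
    unfolding Y using X by (intro measurable_sets[OF _ X]) measurable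
  have "emeasure (lbn n) ?Y = (\<integral>\<^sup>+y. indicator ?Y y \<partial>lbn n)"
    using Ym by simp
  also have "\<dots> = (\<integral>\<^sup>+y. indicator ?Y (addf n b y) \<partial>lbn n)"
    using Ym by (intro nn_integral_addf[symmetric]) simp
  also have "\<dots> = ennreal \<bar>detn n A\<bar> * (\<integral>\<^sup>+x. indicator ?Y (addf n b (mvf n A x)) \<partial>lbn n)"
    by (rule nn_transformD[OF nn_transform[OF A]])
       (rule measurable_compose[OF measurable_addf borel_measurable_indicator[OF Ym]])
  also have "(\<integral>\<^sup>+x. indicator ?Y (addf n b (mvf n A x)) \<partial>lbn n) = (\<integral>\<^sup>+x. indicator X x \<partial>lbn n)"
    by (intro nn_integral_cong) (auto simp: Y AB bb space_lbn indicator_def)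
  finally show "emeasure (lbn n) ?Y = ennreal \<bar>detn n A\<bar> * emeasure (lbn n) X"
    using X by simp
qed

text \<open>A weak form of the Rogers--Shephard inequality. For \<open>x = (a - b) / 2\<close> the set
  \<open>L \<inter> (L - x)\<close> contains \<open>(L + b) / 2\<close>; integrate its measure over \<open>x \<in> Q\<close>.\<close>

lemma emeasure_half_difference_body:
  assumes L: "L \<in> sets (lbn n)" "convex_Rn n L" "emeasure (lbn n) L \<noteq> 0" "emeasure (lbn n) L \<noteq> \<infinity>"
    and Q: "Q \<in> sets (lbn n)" "\<And>x. x \<in> Q \<Longrightarrow> \<exists>a\<in>L. \<exists>b\<in>L. \<forall>i<n. x i = (a i - b i) / 2"
  shows "emeasure (lbn n) Q \<le> 2 ^ n * emeasure (lbn n) L"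
proof -
  let ?\<mu> = "emeasure (lbn n)"
  interpret sigma_finite_measure "lbn n" by (rule lbn.sigma_finite) simp
  interpret P: pair_sigma_finite "lbn n" "lbn n" ..
  note [measurable] = L(1) Q(1)
  have "?\<mu> Q * (ennreal ((1/2)^n) * ?\<mu> L) = (\<integral>\<^sup>+x. ennreal ((1/2)^n) * ?\<mu> L * indicator Q x \<partial>lbn n)"
    by (subst nn_integral_cmult_indicator[OF Q(1)]) (rule mult.commute)
  also have "\<dots> \<le> (\<integral>\<^sup>+x. \<integral>\<^sup>+y. indicator L y * indicator L (addf n x y) \<partial>lbn n \<partial>lbn n)"
  proof (rule nn_integral_mono)
    fix x assume x: "x \<in> space (lbn n)"
    show "ennreal ((1/2)^n) * ?\<mu> L * indicator Q x \<le> (\<integral>\<^sup>+y. indicator L y * indicator L (addf n x y) \<partial>lbn n)"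
    proof (cases "x \<in> Q")
      case True
      then obtain a b where ab: "a \<in> L" "b \<in> L" "\<And>i. i < n \<Longrightarrow> x i = (a i - b i) / 2"
        using Q(2) by blast
      define D where "D = (\<lambda>i j::nat. if i = j then 1/2 else (0::real))"
      have D: "detn n D = (1/2)^n" by (simp add: D_def detn_diagonal)
      define Y where "Y = (\<lambda>z. addf n (\<lambda>i. b i / 2) (mvf n D z)) ` L"
      have D1: "mvf n D z i = z i / 2" if "i < n" for z i
      proof -
        have "(\<Sum>j<n. D i j * z j) = (\<Sum>j<n. if j = i then z j / 2 else 0)"
          by (intro sum.cong) (auto simp: D_def)
        then show ?thesis using that by (simp add: mvf_def)
      qed
      have Y: "Y \<in> sets (lbn n)" "?\<mu> Y = ennreal ((1/2)^n) * ?\<mu> L"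
        using emeasure_affine_image[of n D L "\<lambda>i. b i / 2"] D L by (auto simp: Y_def)
      have "indicator Y y \<le> (indicator L y * indicator L (addf n x y) :: ennreal)" for y
      proof (cases "y \<in> Y")
        case y: True
        then obtain z where z: "z \<in> L" "y = addf n (\<lambda>i. b i / 2) (mvf n D z)" by (auto simp: Y_def)
        \<comment> \<open>As x = (a - b) / 2, both y = (z + b) / 2 and x + y = (z + a) / 2 are
          midpoints of points of \<open>L\<close>.\<close>
        have "y = (\<lambda>i\<in>{..<n}. 1/2 * z i + 1/2 * b i)"
          by (rule ext, rename_tac i, case_tac "i < n") (simp_all add: z(2) addf_def D1)
        moreover have "addf n x y = (\<lambda>i\<in>{..<n}. 1/2 * z i + 1/2 * a i)"
          by (rule ext, rename_tac i, case_tac "i < n") (simp_all add: z(2) addf_def D1 ab(3) field_simps)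
        moreover have "(\<lambda>i\<in>{..<n}. 1/2 * z i + 1/2 * w i) \<in> L" if "w \<in> L" for w
          using L(2)[unfolded convex_Rn_def, rule_format, OF z(1) that, of "1/2" "1/2"] by simp
        ultimately show ?thesis using ab by (simp add: indicator_def)
      qed simp
      then have "(\<integral>\<^sup>+y. indicator Y y \<partial>lbn n) \<le> (\<integral>\<^sup>+y. indicator L y * indicator L (addf n x y) \<partial>lbn n)"
        by (intro nn_integral_mono)
      then show ?thesis using True Y by simp
    qed simp
  qed
  also have "\<dots> = (\<integral>\<^sup>+y. \<integral>\<^sup>+x. indicator L y * indicator L (addf n x y) \<partial>lbn n \<partial>lbn n)"
    by (rule P.Fubini'[symmetric]) measurable
  also have "\<dots> = (\<integral>\<^sup>+y. indicator L y * ?\<mu> L \<partial>lbn n)"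
  proof (rule nn_integral_cong)
    fix y assume y: "y \<in> space (lbn n)"
    have c: "addf n x y = addf n y x" for x by (auto simp: addf_def add.commute)
    have "(\<integral>\<^sup>+x. indicator L y * indicator L (addf n x y) \<partial>lbn n) = indicator L y * (\<integral>\<^sup>+x. indicator L (addf n y x) \<partial>lbn n)"
      unfolding c by (rule nn_integral_cmult) measurable
    also have "(\<integral>\<^sup>+x. indicator L (addf n y x) \<partial>lbn n) = (\<integral>\<^sup>+x. indicator L x \<partial>lbn n)"
      by (rule nn_integral_addf) measurable
    finally show "(\<integral>\<^sup>+x. indicator L y * indicator L (addf n x y) \<partial>lbn n) = indicator L y * ?\<mu> L"
      by simp
  qed
  also have "\<dots> = ?\<mu> L * ?\<mu> L"
    by (simp add: nn_integral_multc)
  finally have "?\<mu> L * (?\<mu> Q * ennreal ((1/2)^n)) \<le> ?\<mu> L * ?\<mu> L"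
    by (simp only: mult_ac)
  then have "?\<mu> Q * ennreal ((1/2)^n) \<le> ?\<mu> L"
    using L(3,4) by (subst (asm) ennreal_mult_le_mult_iff) auto
  then have "2 ^ n * (?\<mu> Q * ennreal ((1/2)^n)) \<le> 2 ^ n * ?\<mu> L"
    by (rule mult_left_mono) simp
  moreover have "2 ^ n * (?\<mu> Q * ennreal ((1/2)^n)) = ?\<mu> Q * (ennreal (2 ^ n) * ennreal ((1/2)^n))"
    by (simp add: mult_ac ennreal_power[symmetric])
  moreover have "ennreal (2 ^ n) * ennreal ((1/2)^n) = 1"
    by (simp add: ennreal_mult[symmetric] power_mult_distrib[symmetric])
  ultimately show ?thesis by simp
qed

section \<open>Rounding and random signs\<close>

text \<open>A truncated two-sided geometric series; its limit 3 becomes the factor per coordinate in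
  the lattice point count.\<close>

lemma sum_half_power_abs_int:
  "(\<Sum>k\<in>{- int R..int R}. (1/2::real) ^ nat \<bar>k\<bar>) = 3 - 2 * (1/2) ^ R"
proof (induction R)
  case (Suc R)
  have "{- int (Suc R)..int (Suc R)} = insert (int (Suc R)) (insert (- int (Suc R)) {- int R..int R})"
    by auto
  then show ?case using Suc by (simp add: nat_add_distrib)
qed simp

text \<open>The weight 2^R * 2^(-|z|), with the l1 norm of z in the exponent, is at least 1 on
  \<open>Z\<close>, and its sum over a whole box factorises into one geometric series per
  coordinate.\<close>

lemma card_lattice_points_l1:
  fixes R :: nat
  assumes "finite I"
  defines "Z \<equiv> {z \<in> I \<rightarrow>\<^sub>E (UNIV :: int set). (\<Sum>i\<in>I. \<bar>z i\<bar>) \<le> int R}"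
  shows "finite Z" and "card Z \<le> 2 ^ R * 3 ^ card I"
proof -
  let ?B = "I \<rightarrow>\<^sub>E {- int R..int R}"
  have fB: "finite ?B" using assms(1) by (intro finite_PiE) auto
  have sub: "Z \<subseteq> ?B"
  proof
    fix z assume z: "z \<in> Z"
    have "z i \<in> {- int R..int R}" if "i \<in> I" for i
    proof -
      have "\<bar>z i\<bar> \<le> (\<Sum>i\<in>I. \<bar>z i\<bar>)"
        using that assms(1) by (intro member_le_sum) auto
      then show ?thesis using z by (auto simp: Z_def)
    qed
    then show "z \<in> ?B" using z by (simp add: Z_def PiE_iff)
  qed
  show "finite Z" by (rule finite_subset[OF sub fB])
  have one: "1 \<le> 2 ^ R * (\<Prod>i\<in>I. (1/2::real) ^ nat \<bar>z i\<bar>)" if "z \<in> Z" for z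
  proof -
    have "int (\<Sum>i\<in>I. nat \<bar>z i\<bar>) \<le> int R" using that by (simp add: Z_def)
    then have "(\<Sum>i\<in>I. nat \<bar>z i\<bar>) \<le> R" by (simp only: of_nat_le_iff)
    then have "(1/2::real) ^ R \<le> (1/2) ^ (\<Sum>i\<in>I. nat \<bar>z i\<bar>)"
      by (intro power_decreasing) auto
    then have "2 ^ R * (1/2::real) ^ R \<le> 2 ^ R * (1/2) ^ (\<Sum>i\<in>I. nat \<bar>z i\<bar>)"
      by (rule mult_left_mono) simp
    then show ?thesis by (simp add: power_sum power_mult_distrib[symmetric])
  qed
  have "real (card Z) = (\<Sum>z\<in>Z. 1)" by simp
  also have "\<dots> \<le> (\<Sum>z\<in>Z. 2 ^ R * (\<Prod>i\<in>I. (1/2::real) ^ nat \<bar>z i\<bar>))"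
    by (intro sum_mono one)
  also have "\<dots> \<le> (\<Sum>z\<in>?B. 2 ^ R * (\<Prod>i\<in>I. (1/2::real) ^ nat \<bar>z i\<bar>))"
    using fB sub by (intro sum_mono2) (auto intro!: mult_nonneg_nonneg prod_nonneg)
  also have "\<dots> = 2 ^ R * (\<Prod>i\<in>I. \<Sum>k\<in>{- int R..int R}. (1/2::real) ^ nat \<bar>k\<bar>)"
    by (subst prod_sum_PiE) (simp_all add: assms(1) sum_distrib_left)
  also have "\<dots> \<le> 2 ^ R * (\<Prod>i\<in>I. 3)"
    unfolding sum_half_power_abs_int
    using power_le_one[of "1/2::real" R] by (intro mult_left_mono prod_mono) auto
  also have "\<dots> = real (2 ^ R * 3 ^ card I)" by simp
  finally show "card Z \<le> 2 ^ R * 3 ^ card I" by linarith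
qed

text \<open>Rounding up with probability equal to the fractional part makes the errors independent and
  centred, so the expected squared norm of the total error is \<open>\<Sum>\<^sub>j t\<^sub>j (1 - t\<^sub>j) |v\<^sub>j|\<^sup>2\<close>;
  the induction makes one good choice at a time.\<close>

lemma integer_rounding:
  fixes v :: "'j \<Rightarrow> 'i \<Rightarrow> real" and s :: "'j \<Rightarrow> real"
  assumes "finite J" "finite I"
  shows "\<exists>z :: 'j \<Rightarrow> int. (\<forall>j. \<bar>of_int (z j) - s j\<bar> \<le> 1) \<and>
    (\<Sum>i\<in>I. (\<Sum>j\<in>J. (of_int (z j) - s j) * v j i)\<^sup>2) \<le> (\<Sum>j\<in>J. \<Sum>i\<in>I. (v j i)\<^sup>2) / 4"
  using assms(1)
proof (induction J)
  case empty
  have "\<bar>of_int \<lfloor>s j\<rfloor> - s j\<bar> \<le> 1" for j by linarith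
  then show ?case by (auto intro!: exI[of _ "\<lambda>j. \<lfloor>s j\<rfloor>"])
next
  case (insert a J)
  then obtain z :: "'j \<Rightarrow> int" where z: "\<And>j. \<bar>of_int (z j) - s j\<bar> \<le> 1"
    "(\<Sum>i\<in>I. (\<Sum>j\<in>J. (of_int (z j) - s j) * v j i)\<^sup>2) \<le> (\<Sum>j\<in>J. \<Sum>i\<in>I. (v j i)\<^sup>2) / 4"
    by auto
  define w where "w i = (\<Sum>j\<in>J. (of_int (z j) - s j) * v j i)" for i
  define W where "W = (\<Sum>i\<in>I. (w i)\<^sup>2)"
  define V where "V = (\<Sum>i\<in>I. (v a i)\<^sup>2)"
  define B where "B = (\<Sum>i\<in>I. w i * v a i)"
  define t where "t = frac (s a)"
  have t: "0 \<le> t" "t \<le> 1" by (auto simp: t_def frac_lt_1 less_imp_le)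
  have Q: "(\<Sum>i\<in>I. (\<delta> * v a i + w i)\<^sup>2) = W + 2 * \<delta> * B + \<delta>\<^sup>2 * V" for \<delta>
    unfolding W_def V_def B_def
    by (simp add: power2_sum power_mult_distrib sum.distrib sum_distrib_left algebra_simps)
  have V0: "0 \<le> V" unfolding V_def by (intro sum_nonneg) auto
  \<comment> \<open>The expectation for rounding up with probability \<open>t\<close>: the linear
    terms cancel, and t (1 - t) = 1/4 - (t - 1/2)^2.\<close>
  have key: "(1 - t) * (W + 2 * (- t) * B + (- t)\<^sup>2 * V) + t * (W + 2 * (1 - t) * B + (1 - t)\<^sup>2 * V)
      = W + V / 4 - (t - 1/2)\<^sup>2 * V"
    by (simp add: power2_eq_square field_simps)
  have "\<exists>e\<in>{0, 1::int}. W + 2 * (of_int e - t) * B + (of_int e - t)\<^sup>2 * V \<le> W + V / 4"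
  proof (rule ccontr)
    assume "\<not> ?thesis"
    then have "W + V / 4 < W + 2 * (- t) * B + (- t)\<^sup>2 * V" "W + V / 4 < W + 2 * (1 - t) * B + (1 - t)\<^sup>2 * V"
      by auto
    then have "W + V / 4 < (1 - t) * (W + 2 * (- t) * B + (- t)\<^sup>2 * V) + t * (W + 2 * (1 - t) * B + (1 - t)\<^sup>2 * V)"
      using convex_bound_lt[of "- (W + 2 * (- t) * B + (- t)\<^sup>2 * V)" "- (W + V / 4)"
          "- (W + 2 * (1 - t) * B + (1 - t)\<^sup>2 * V)" "1 - t" t] t by linarith
    then show False using key V0 by (smt (verit) mult_nonneg_nonneg zero_le_power2)
  qed
  then obtain e :: int where e: "e \<in> {0, 1}" "W + 2 * (of_int e - t) * B + (of_int e - t)\<^sup>2 * V \<le> W + V / 4"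
    by blast
  define z' where "z' = z(a := \<lfloor>s a\<rfloor> + e)"
  have za: "of_int (z' a) - s a = of_int e - t"
    by (simp add: z'_def t_def frac_def)
  have zJ: "(\<Sum>j\<in>J. (of_int (z' j) - s j) * v j i) = w i" for i
    unfolding w_def z'_def using insert.hyps by (intro sum.cong) auto
  have "(\<Sum>i\<in>I. (\<Sum>j\<in>insert a J. (of_int (z' j) - s j) * v j i)\<^sup>2) \<le> W + V / 4"
    using insert.hyps e(2) by (simp add: za zJ Q)
  also have "\<dots> \<le> (\<Sum>j\<in>insert a J. \<Sum>i\<in>I. (v j i)\<^sup>2) / 4"
    using insert.hyps z(2) by (simp add: W_def V_def w_def add_divide_distrib)
  finally have "(\<Sum>i\<in>I. (\<Sum>j\<in>insert a J. (of_int (z' j) - s j) * v j i)\<^sup>2)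
      \<le> (\<Sum>j\<in>insert a J. \<Sum>i\<in>I. (v j i)\<^sup>2) / 4" .
  moreover have "\<bar>of_int (z' j) - s j\<bar> \<le> 1" for j
  proof (cases "j = a")
    case True
    then show ?thesis using za e(1) t by auto
  next
    case False
    then show ?thesis using z(1)[of j] by (simp add: z'_def)
  qed
  ultimately show ?case by blast
qed

section \<open>Moments and exponential moments of random sign sums\<close>

lemma sum_signs_insert:
  assumes "a \<notin> I"
  shows "(\<Sum>x \<in> insert a I \<rightarrow>\<^sub>E {-1, 1::real}. f x) = (\<Sum>x \<in> I \<rightarrow>\<^sub>E {-1, 1}. f (x(a := 1)) + f (x(a := -1)))"
proof -
  have "(\<Sum>x \<in> insert a I \<rightarrow>\<^sub>E {-1, 1::real}. f x) = (\<Sum>(y, x) \<in> {-1, 1} \<times> (I \<rightarrow>\<^sub>E {-1, 1}). f (x(a := y)))"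
    using inj_combinator[OF assms, of "\<lambda>_. {-1, 1::real}"]
    by (simp add: PiE_insert_eq sum.reindex case_prod_unfold comp_def)
  also have "\<dots> = (\<Sum>x \<in> I \<rightarrow>\<^sub>E {-1, 1}. f (x(a := 1))) + (\<Sum>x \<in> I \<rightarrow>\<^sub>E {-1, 1}. f (x(a := -1)))"
    by (simp add: sum.cartesian_product[symmetric] add.commute)
  finally show ?thesis by (simp add: sum.distrib)
qed

text \<open>Induction on the coordinates: pairing the two signs of the new one cancels all odd
  terms. The constant 3 is the fourth moment of a standard Gaussian.\<close>

lemma sum_signs_moments:
  fixes t :: "'a \<Rightarrow> real"
  assumes "finite I"
  shows "(\<Sum>x \<in> I \<rightarrow>\<^sub>E {-1, 1}. (\<Sum>i\<in>I. t i * x i)\<^sup>2) = 2 ^ card I * (\<Sum>i\<in>I. (t i)\<^sup>2)"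
    and "(\<Sum>x \<in> I \<rightarrow>\<^sub>E {-1, 1}. (\<Sum>i\<in>I. t i * x i) ^ 4) \<le> 3 * 2 ^ card I * (\<Sum>i\<in>I. (t i)\<^sup>2)\<^sup>2"
proof -
  let ?S = "\<lambda>I. I \<rightarrow>\<^sub>E {-1, 1::real}"
  have "(\<Sum>x \<in> ?S I. (\<Sum>i\<in>I. t i * x i)\<^sup>2) = 2 ^ card I * (\<Sum>i\<in>I. (t i)\<^sup>2) \<and>
    (\<Sum>x \<in> ?S I. (\<Sum>i\<in>I. t i * x i) ^ 4) \<le> 3 * 2 ^ card I * (\<Sum>i\<in>I. (t i)\<^sup>2)\<^sup>2"
    using assms
  proof (induction I)
    case empty
    show ?case by simp
  next
    case (insert a I)
    define y where "y x = (\<Sum>i\<in>I. t i * x i)" for x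
    define N where "N = (2::real) ^ card I"
    define s where "s = (\<Sum>i\<in>I. (t i)\<^sup>2)"
    have IH: "(\<Sum>x \<in> ?S I. (y x)\<^sup>2) = N * s" "(\<Sum>x \<in> ?S I. (y x) ^ 4) \<le> 3 * N * s\<^sup>2"
      using insert.IH by (auto simp: y_def N_def s_def)
    have card: "real (card (?S I)) = N"
      using insert.hyps by (simp add: card_PiE N_def)
    have upd: "(\<Sum>i\<in>insert a I. t i * (x(a := c)) i) = y x + c * t a" for x c
    proof -
      have "(\<Sum>i\<in>I. t i * (x(a := c)) i) = y x"
        unfolding y_def using insert.hyps by (intro sum.cong) auto
      then show ?thesis using insert.hyps by simp
    qed
    have N0: "0 \<le> N" and s0: "0 \<le> s" by (auto simp: N_def s_def sum_nonneg)
    have "(\<Sum>x \<in> ?S (insert a I). (\<Sum>i\<in>insert a I. t i * x i)\<^sup>2)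
        = (\<Sum>x \<in> ?S I. (y x + t a)\<^sup>2 + (y x - t a)\<^sup>2)"
      unfolding sum_signs_insert[OF insert.hyps(2)] upd by simp
    also have "\<dots> = (\<Sum>x \<in> ?S I. 2 * (y x)\<^sup>2 + 2 * (t a)\<^sup>2)"
      by (intro sum.cong) (auto simp: power2_eq_square algebra_simps)
    also have "\<dots> = 2 * N * (s + (t a)\<^sup>2)"
      by (simp add: sum.distrib sum_distrib_left[symmetric] IH card algebra_simps)
    finally have m2: "(\<Sum>x \<in> ?S (insert a I). (\<Sum>i\<in>insert a I. t i * x i)\<^sup>2) = 2 * N * (s + (t a)\<^sup>2)" .
    have "(\<Sum>x \<in> ?S (insert a I). (\<Sum>i\<in>insert a I. t i * x i) ^ 4)
        = (\<Sum>x \<in> ?S I. (y x + t a) ^ 4 + (y x - t a) ^ 4)"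
      unfolding sum_signs_insert[OF insert.hyps(2)] upd by simp
    also have "\<dots> = (\<Sum>x \<in> ?S I. 2 * (y x) ^ 4 + 12 * (t a)\<^sup>2 * (y x)\<^sup>2 + 2 * (t a) ^ 4)"
      by (intro sum.cong) (auto simp: power2_eq_square power4_eq_xxxx algebra_simps)
    also have "\<dots> = 2 * (\<Sum>x \<in> ?S I. (y x) ^ 4) + 12 * (t a)\<^sup>2 * (N * s) + 2 * N * (t a) ^ 4"
      by (simp add: sum.distrib sum_distrib_left[symmetric] IH card algebra_simps)
    \<comment> \<open>Raising the coefficient of the fourth power of \<open>t a\<close> from 2 to 6
      completes the square.\<close>
    also have "\<dots> \<le> 2 * (3 * N * s\<^sup>2) + 12 * (t a)\<^sup>2 * (N * s) + 6 * N * (t a) ^ 4"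
      using IH(2) N0 by (intro add_mono mult_left_mono mult_right_mono) auto
    also have "\<dots> = 3 * (2 * N) * (s + (t a)\<^sup>2)\<^sup>2"
      by (simp add: power2_eq_square power4_eq_xxxx algebra_simps)
    finally have "(\<Sum>x \<in> ?S (insert a I). (\<Sum>i\<in>insert a I. t i * x i) ^ 4) \<le> 3 * (2 * N) * (s + (t a)\<^sup>2)\<^sup>2" .
    then show ?case
      using m2 insert.hyps by (simp add: N_def s_def add.commute mult.assoc)
  qed
  then show "(\<Sum>x \<in> ?S I. (\<Sum>i\<in>I. t i * x i)\<^sup>2) = 2 ^ card I * (\<Sum>i\<in>I. (t i)\<^sup>2)"
    "(\<Sum>x \<in> ?S I. (\<Sum>i\<in>I. t i * x i) ^ 4) \<le> 3 * 2 ^ card I * (\<Sum>i\<in>I. (t i)\<^sup>2)\<^sup>2" by auto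
qed

text \<open>A majorant without odd powers, so that its mean over signs follows from the second and
  fourth moments.\<close>

lemma exp_minus_half_abs_le: "exp (- \<bar>y\<bar> / 2) \<le> 1 - 3 / 8 * y\<^sup>2 + 2 / 27 * y ^ 4" for y :: real
proof -
  define s where "s = \<bar>y\<bar>"
  have s: "0 \<le> s" by (simp add: s_def)
  define u where "u = s / 2"
  have u: "0 \<le> u" using s by (simp add: u_def)
  have "1 + u + u\<^sup>2 / 2 \<le> exp u" by (rule exp_lower_Taylor_quadratic[OF u])
  moreover have p: "0 < 1 + u + u\<^sup>2 / 2" using u by (simp add: add_pos_nonneg)
  ultimately have "exp (- u) \<le> 1 / (1 + u + u\<^sup>2 / 2)"
    by (simp add: exp_minus field_simps)
  also have "\<dots> \<le> 1 - u + u\<^sup>2 / 2"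
  proof -
    have "(1 - u + u\<^sup>2 / 2) * (1 + u + u\<^sup>2 / 2) = 1 + u ^ 4 / 4"
      by (simp add: power2_eq_square power4_eq_xxxx field_simps)
    then have "1 \<le> (1 - u + u\<^sup>2 / 2) * (1 + u + u\<^sup>2 / 2)" by simp
    then show ?thesis using p by (simp add: pos_divide_le_eq)
  qed
  finally have 1: "exp (- \<bar>y\<bar> / 2) \<le> 1 - s / 2 + s\<^sup>2 / 8"
    by (simp add: u_def s_def power2_eq_square)
  \<comment> \<open>The quartic touches the quadratic at s = 3/2, which fixes the coefficients 3/8
    and 2/27.\<close>
  have "s - s\<^sup>2 + 4 / 27 * s ^ 4 = 4 / 27 * (s * (s + 3) * (s - 3 / 2)\<^sup>2)"
    by (simp add: power2_eq_square power4_eq_xxxx field_simps)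
  also have "\<dots> \<ge> 0" using s by simp
  finally have "1 - s / 2 + s\<^sup>2 / 8 \<le> 1 - 3 / 8 * s\<^sup>2 + 2 / 27 * s ^ 4" by simp
  moreover have "s\<^sup>2 = y\<^sup>2" "s ^ 4 = y ^ 4" by (auto simp: s_def power_even_abs)
  ultimately show ?thesis using 1 by simp
qed

lemma sum_signs_exp_le:
  fixes t :: "'a \<Rightarrow> real"
  assumes "finite I" "(\<Sum>i\<in>I. (t i)\<^sup>2) = 1"
  shows "(\<Sum>x \<in> I \<rightarrow>\<^sub>E {-1, 1}. exp (- \<bar>\<Sum>i\<in>I. t i * x i\<bar> / 2)) \<le> 61 / 72 * 2 ^ card I"
proof -
  let ?S = "I \<rightarrow>\<^sub>E {-1, 1::real}"
  let ?y = "\<lambda>x. \<Sum>i\<in>I. t i * x i"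
  have "(\<Sum>x \<in> ?S. exp (- \<bar>?y x\<bar> / 2)) \<le> (\<Sum>x \<in> ?S. 1 - 3 / 8 * (?y x)\<^sup>2 + 2 / 27 * (?y x) ^ 4)"
    by (intro sum_mono exp_minus_half_abs_le)
  also have "\<dots> = real (card ?S) - 3 / 8 * (\<Sum>x \<in> ?S. (?y x)\<^sup>2) + 2 / 27 * (\<Sum>x \<in> ?S. (?y x) ^ 4)"
    by (simp only: sum.distrib sum_subtractf sum_distrib_left) simp
  \<comment> \<open>1 - 3/8 + 2/9 = 61/72 is the saving that drives the union bound over lattice
    vectors.\<close>
  also have "\<dots> \<le> 2 ^ card I - 3 / 8 * 2 ^ card I + 2 / 27 * (3 * 2 ^ card I)"
    using sum_signs_moments[OF assms(1), of t] assms by (simp add: card_PiE)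
  finally show ?thesis by simp
qed


text \<open>A random sign matrix is bounded below from \<open>\<ell>\<^sub>2\<close> to \<open>\<ell>\<^sub>1\<close> on all integer vectors of
  \<open>\<ell>\<^sub>1\<close> norm at most \<open>17 n\<close>, by a union bound. Every direction \<open>t\<close> is then reached by
  rounding its multiple of length \<open>16 \<surd>n\<close> to such a vector.\<close>

lemma ex_sign_matrix_lattice:
  assumes "n \<ge> 1"
  shows "\<exists>X :: nat \<Rightarrow> nat \<Rightarrow> real. (\<forall>i<133 * n. \<forall>k<n. X i k \<in> {-1, 1}) \<and>
    (\<forall>z :: nat \<Rightarrow> int. (\<Sum>k<n. \<bar>z k\<bar>) \<le> 17 * int n \<longrightarrow>
       real (133 * n) / 10 * L2_set (\<lambda>k. of_int (z k)) {..<n} \<le> (\<Sum>i<133 * n. \<bar>\<Sum>k<n. of_int (z k) * X i k\<bar>))"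
proof -
  \<comment> \<open>With 133 n rows, (9/10)^133 outweighs 2^17 * 3, the n-th power of which bounds
    the number of lattice vectors.\<close>
  define m where "m = 133 * n"
  define S where "S = {..<n} \<rightarrow>\<^sub>E {-1, 1::real}"
  define Z where "Z = {z \<in> {..<n} \<rightarrow>\<^sub>E (UNIV :: int set). (\<Sum>i<n. \<bar>z i\<bar>) \<le> int (17 * n)}"
  define r where "r z = L2_set (\<lambda>k. of_int (z k)) {..<n}" for z :: "nat \<Rightarrow> int"
  define bad where "bad z = {X \<in> {..<m} \<rightarrow>\<^sub>E S. (\<Sum>i<m. \<bar>\<Sum>k<n. of_int (z k) * X i k\<bar>) < real m / 10 * r z}" for z :: "nat \<Rightarrow> int"
  have fS: "finite S" unfolding S_def by (intro finite_PiE) auto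
  have cS: "card S = 2 ^ n" unfolding S_def by (simp add: card_PiE numeral_2_eq_2)
  have fF: "finite ({..<m} \<rightarrow>\<^sub>E S)" using fS by (intro finite_PiE) auto
  have cF: "card ({..<m} \<rightarrow>\<^sub>E S) = (2 ^ n) ^ m" using fS cS by (simp add: card_PiE)
  have Z: "finite Z" "card Z \<le> 2 ^ (17 * n) * 3 ^ n"
    using card_lattice_points_l1[of "{..<n}" "17 * n"] by (auto simp: Z_def)
  have fb: "finite (bad z)" for z using fF by (auto simp: bad_def)
  have cbad: "real (card (bad z)) \<le> (2 ^ n * (9 / 10)) ^ m" for z
  proof (cases "r z = 0")
    case True
    then have "bad z = {}" by (auto simp: bad_def not_less sum_nonneg)
    then show ?thesis by simp
  next
    case False
    then have r: "r z > 0" by (simp add: r_def less_le)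
    define t where "t k = of_int (z k) / r z" for k
    have t1: "(\<Sum>k<n. (t k)\<^sup>2) = 1"
    proof -
      have "(\<Sum>k<n. (t k)\<^sup>2) = (\<Sum>k<n. (of_int (z k))\<^sup>2) / (r z)\<^sup>2"
        by (simp add: t_def power_divide sum_divide_distrib)
      also have "(\<Sum>k<n. (of_int (z k) :: real)\<^sup>2) = (r z)\<^sup>2"
        by (simp add: r_def L2_set_def sum_nonneg)
      finally show ?thesis using r by simp
    qed
    have ty: "(\<Sum>k<n. t k * x k) = (\<Sum>k<n. of_int (z k) * x k) / r z" for x
      by (simp add: t_def sum_divide_distrib)
    \<comment> \<open>Since 20/19 * 61/72 < 9/10, the mean of \<open>g\<close> stays below 9/10 in
      spite of the factor exp (1/20).\<close>
    have "exp (1 / 20 :: real) \<le> 20 / 19"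
      using exp_ge_add_one_self[of "- 1 / 20 :: real"] by (simp add: exp_minus field_simps)
    then have e20: "exp (1 / 20) * (61 / 72 * 2 ^ n) \<le> (20 / 19) * (61 / 72 * 2 ^ n :: real)"
      by (intro mult_right_mono) auto
    \<comment> \<open>Exponential Markov inequality: on \<open>bad z\<close> the exponents of the
      \<open>g (X i)\<close> add up to at least m/20 - (m/10)/2 = 0.\<close>
    define g where "g x = exp (1 / 20) * exp (- \<bar>\<Sum>k<n. t k * x k\<bar> / 2)" for x
    have g0: "0 \<le> g x" for x by (simp add: g_def)
    have "(\<Sum>x\<in>S. g x) = exp (1 / 20) * (\<Sum>x\<in>S. exp (- \<bar>\<Sum>k<n. t k * x k\<bar> / 2))"
      unfolding g_def by (rule sum_distrib_left[symmetric])
    also have "\<dots> \<le> exp (1 / 20) * (61 / 72 * 2 ^ n)"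
      using sum_signs_exp_le[of "{..<n}" t] t1 by (intro mult_left_mono) (simp_all add: S_def)
    also note e20
    also have "20 / 19 * (61 / 72 * 2 ^ n) \<le> 2 ^ n * (9 / 10 :: real)"
    proof -
      have "20 / 19 * (61 / 72 * N) \<le> N * (9 / 10)" if "0 \<le> N" for N :: real
        using that by linarith
      then show ?thesis by simp
    qed
    finally have gS: "(\<Sum>x\<in>S. g x) \<le> 2 ^ n * (9 / 10)" .
    have "real (card (bad z)) = (\<Sum>X\<in>bad z. 1)" by simp
    also have "\<dots> \<le> (\<Sum>X\<in>bad z. \<Prod>i<m. g (X i))"
    proof (rule sum_mono)
      fix X assume X: "X \<in> bad z"
      have "(\<Sum>i<m. \<bar>\<Sum>k<n. t k * X i k\<bar>) = (\<Sum>i<m. \<bar>\<Sum>k<n. of_int (z k) * X i k\<bar>) / r z"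
        unfolding ty abs_divide sum_divide_distrib[symmetric] using r by simp
      also have "\<dots> \<le> real m / 10"
        using X r by (simp add: bad_def field_simps)
      finally have "0 \<le> (\<Sum>i<m. 1 / 20 + - \<bar>\<Sum>k<n. t k * X i k\<bar> / 2)"
        by (simp add: sum_subtractf sum_divide_distrib[symmetric] sum.distrib sum_negf)
      then have "1 \<le> exp (\<Sum>i<m. 1 / 20 + - \<bar>\<Sum>k<n. t k * X i k\<bar> / 2)"
        by simp
      then show "1 \<le> (\<Prod>i<m. g (X i))"
        by (simp only: exp_sum finite_lessThan exp_add g_def)
    qed
    also have "\<dots> \<le> (\<Sum>X\<in>{..<m} \<rightarrow>\<^sub>E S. \<Prod>i<m. g (X i))"
      using fF by (intro sum_mono2) (auto simp: bad_def intro!: prod_nonneg g0)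
    also have "\<dots> = (\<Prod>i<m. \<Sum>x\<in>S. g x)"
      using prod_sum_PiE[of "{..<m}" "\<lambda>_. S" "\<lambda>_. g"] fS by simp
    also have "\<dots> = (\<Sum>x\<in>S. g x) ^ m"
      by (simp only: prod_constant card_lessThan)
    also have "\<dots> \<le> (2 ^ n * (9 / 10)) ^ m"
      using gS g0 by (intro power_mono sum_nonneg)
    finally show ?thesis .
  qed
  have "real (card (\<Union>z\<in>Z. bad z)) \<le> (\<Sum>z\<in>Z. real (card (bad z)))"
    using card_UN_le[OF Z(1), of bad] by (simp flip: of_nat_sum)
  also have "\<dots> \<le> real (card Z) * (2 ^ n * (9 / 10)) ^ m"
    using sum_bounded_above[of Z "\<lambda>z. real (card (bad z))"] cbad by simp
  also have "\<dots> \<le> (2 ^ (17 * n) * 3 ^ n) * (2 ^ n * (9 / 10)) ^ m"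
    using of_nat_mono[OF Z(2), where 'a = real] by (intro mult_right_mono) auto
  also have "\<dots> = (2 ^ n) ^ m * (2 ^ 17 * 3 * (9 / 10) ^ 133) ^ n"
  proof -
    have "(9 / 10 :: real) ^ m = ((9 / 10) ^ 133) ^ n" "(2 :: real) ^ (17 * n) = (2 ^ 17) ^ n"
      by (simp_all only: m_def power_mult)
    then show ?thesis by (simp only: power_mult_distrib mult_ac)
  qed
  also have "\<dots> < (2 ^ n) ^ m"
  proof -
    have "(2 ^ 17 * 3 * (9 / 10) ^ 133 :: real) < 1"
      by (simp add: power_divide)
    then have "(2 ^ 17 * 3 * (9 / 10) ^ 133 :: real) ^ n < 1"
      using assms by (intro power_less_one_iff[THEN iffD2]) auto
    then show ?thesis by simp
  qed
  finally have "real (card (\<Union>z\<in>Z. bad z)) < real (card ({..<m} \<rightarrow>\<^sub>E S))"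
    by (simp add: cF)
  then have "card (\<Union>z\<in>Z. bad z) < card ({..<m} \<rightarrow>\<^sub>E S)"
    by (simp only: of_nat_less_iff)
  then have "\<not> ({..<m} \<rightarrow>\<^sub>E S) \<subseteq> (\<Union>z\<in>Z. bad z)"
    using card_mono[of "\<Union>z\<in>Z. bad z" "{..<m} \<rightarrow>\<^sub>E S"] Z(1) fb by force
  then obtain X where X: "X \<in> {..<m} \<rightarrow>\<^sub>E S" "\<And>z. z \<in> Z \<Longrightarrow> X \<notin> bad z" by blast
  have "real m / 10 * r z \<le> (\<Sum>i<m. \<bar>\<Sum>k<n. of_int (z k) * X i k\<bar>)"
    if "(\<Sum>k<n. \<bar>z k\<bar>) \<le> 17 * int n" for z
  proof -
    have "restrict z {..<n} \<in> Z" using that by (simp add: Z_def)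
    then have "X \<notin> bad (restrict z {..<n})" by (rule X(2))
    moreover have "r (restrict z {..<n}) = r z" by (simp add: r_def L2_set_def)
    ultimately show ?thesis using X(1) by (simp add: bad_def not_less)
  qed
  moreover have "X i k \<in> {-1, 1}" if "i < m" "k < n" for i k
    using X(1) that by (auto simp: S_def PiE_iff)
  ultimately show ?thesis
    unfolding r_def m_def by blast
qed

lemma ex_sign_matrix:
  assumes "n \<ge> 1"
  shows "\<exists>X :: nat \<Rightarrow> nat \<Rightarrow> real. (\<forall>i<133 * n. \<forall>k<n. \<bar>X i k\<bar> \<le> 1) \<and>
    (\<forall>t. 8 * real n * L2_set t {..<n} \<le> (\<Sum>i<133 * n. \<bar>\<Sum>k<n. t k * X i k\<bar>))"
proof -
  define m where "m = 133 * n"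
  obtain X :: "nat \<Rightarrow> nat \<Rightarrow> real" where X: "\<And>i k. i < m \<Longrightarrow> k < n \<Longrightarrow> X i k \<in> {-1, 1}"
    and low: "\<And>z :: nat \<Rightarrow> int. (\<Sum>k<n. \<bar>z k\<bar>) \<le> 17 * int n \<Longrightarrow>
      real m / 10 * L2_set (\<lambda>k. of_int (z k)) {..<n} \<le> (\<Sum>i<m. \<bar>\<Sum>k<n. of_int (z k) * X i k\<bar>)"
    using ex_sign_matrix_lattice[OF assms] unfolding m_def by blast
  have X2: "(X i k)\<^sup>2 = 1" "\<bar>X i k\<bar> \<le> 1" if "i < m" "k < n" for i k
    using X[OF that] by auto
  have "8 * real n * L2_set t {..<n} \<le> (\<Sum>i<m. \<bar>\<Sum>k<n. t k * X i k\<bar>)" for t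
  proof (cases "L2_set t {..<n} = 0")
    case True
    then show ?thesis by (simp add: sum_nonneg)
  next
    case False
    define T where "T = L2_set t {..<n}"
    have T: "T > 0" using False by (simp add: T_def less_le)
    define q where "q = sqrt (real n)"
    have q: "q > 0" "q * q = real n" using assms by (auto simp: q_def)
    \<comment> \<open>Rounding a vector of length 16 sqrt n changes its length by at most sqrt n and
      its image by at most m sqrt n / 2 in l1 norm. So the lattice bound leaves 15/10 m sqrt n - m
      sqrt n / 2 = m sqrt n, and the rounded vector has l1 norm at most 16 n + n.\<close>
    define c where "c = 16 * q / T"
    have c: "c > 0" using q T by (simp add: c_def)
    define \<tau> where "\<tau> k = c * t k" for k
    have L2\<tau>: "L2_set \<tau> {..<n} = 16 * q"
      using L2_set_right_distrib[of c t "{..<n}"] c T by (simp add: \<tau>_def[abs_def] T_def[symmetric] c_def)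
    have L1: "(\<Sum>k<n. \<bar>f k\<bar>) \<le> q * L2_set f {..<n}" for f
      using L2_set_mult_ineq[of "\<lambda>_. 1" f "{..<n}"] by (simp add: L2_set_constant q_def)
    obtain z :: "nat \<Rightarrow> int" where z1: "\<And>k. \<bar>of_int (z k) - \<tau> k\<bar> \<le> 1"
      and z2: "(\<Sum>i<m. (\<Sum>k<n. (of_int (z k) - \<tau> k) * X i k)\<^sup>2) \<le> (\<Sum>k<n. \<Sum>i<m. (X i k)\<^sup>2) / 4"
      using integer_rounding[of "{..<n}" "{..<m}" \<tau> "\<lambda>k i. X i k"] by auto
    have "(\<Sum>k<n. \<Sum>i<m. (X i k)\<^sup>2) = (\<Sum>k<n. \<Sum>i<m. 1)"
      by (intro sum.cong refl) (simp add: X2)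
    then have z2': "(\<Sum>i<m. (\<Sum>k<n. (of_int (z k) - \<tau> k) * X i k)\<^sup>2) \<le> real n * real m / 4"
      using z2 by simp
    have err: "(\<Sum>i<m. \<bar>\<Sum>k<n. (of_int (z k) - \<tau> k) * X i k\<bar>) \<le> real m * q / 2"
    proof -
      have "(\<Sum>i<m. \<bar>\<Sum>k<n. (of_int (z k) - \<tau> k) * X i k\<bar>)
          \<le> sqrt (real m) * L2_set (\<lambda>i. \<Sum>k<n. (of_int (z k) - \<tau> k) * X i k) {..<m}"
        using L2_set_mult_ineq[of "\<lambda>_. 1" "\<lambda>i. \<Sum>k<n. (of_int (z k) - \<tau> k) * X i k" "{..<m}"]
        by (simp add: L2_set_constant)
      also have "\<dots> \<le> sqrt (real m) * sqrt (real n * real m / 4)"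
        unfolding L2_set_def using z2' by (intro mult_left_mono real_sqrt_le_mono) auto
      also have "\<dots> = real m * q / 2"
        by (simp add: q_def real_sqrt_mult real_sqrt_divide)
      finally show ?thesis .
    qed
    have "real_of_int (\<Sum>k<n. \<bar>z k\<bar>) \<le> (\<Sum>k<n. \<bar>\<tau> k\<bar> + 1)"
      unfolding of_int_sum of_int_abs using z1 by (intro sum_mono) (smt (verit))
    also have "\<dots> \<le> q * (16 * q) + n"
      using L1[of \<tau>] by (simp add: sum.distrib L2\<tau>)
    also have "\<dots> = of_int (17 * int n)" using q(2) by simp
    finally have zs: "(\<Sum>k<n. \<bar>z k\<bar>) \<le> 17 * int n" by (simp only: of_int_le_iff)
    have "L2_set \<tau> {..<n} \<le> L2_set (\<lambda>k. of_int (z k)) {..<n} + L2_set (\<lambda>k. \<tau> k - of_int (z k)) {..<n}"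
      using L2_set_triangle_ineq[of "\<lambda>k. of_int (z k)" "\<lambda>k. \<tau> k - of_int (z k)" "{..<n}"] by simp
    also have "L2_set (\<lambda>k. \<tau> k - of_int (z k)) {..<n} \<le> q"
    proof -
      have "(\<Sum>k<n. (\<tau> k - of_int (z k))\<^sup>2) \<le> (\<Sum>k<n. 1)"
        using z1 by (intro sum_mono) (simp add: abs_square_le_1 abs_minus_commute)
      then show ?thesis by (simp add: L2_set_def q_def)
    qed
    finally have Lz: "15 * q \<le> L2_set (\<lambda>k. of_int (z k)) {..<n}"
      using L2\<tau> by simp
    have "real m / 10 * (15 * q) \<le> (\<Sum>i<m. \<bar>\<Sum>k<n. of_int (z k) * X i k\<bar>)"
      using low[OF zs] mult_left_mono[OF Lz, of "real m / 10"] by simp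
    also have "\<dots> \<le> (\<Sum>i<m. \<bar>\<Sum>k<n. \<tau> k * X i k\<bar> + \<bar>\<Sum>k<n. (of_int (z k) - \<tau> k) * X i k\<bar>)"
    proof (rule sum_mono)
      fix i
      have "(\<Sum>k<n. of_int (z k) * X i k) = (\<Sum>k<n. \<tau> k * X i k) + (\<Sum>k<n. (of_int (z k) - \<tau> k) * X i k)"
        by (simp add: sum.distrib[symmetric] algebra_simps)
      then show "\<bar>\<Sum>k<n. of_int (z k) * X i k\<bar> \<le> \<bar>\<Sum>k<n. \<tau> k * X i k\<bar> + \<bar>\<Sum>k<n. (of_int (z k) - \<tau> k) * X i k\<bar>"
        by linarith
    qed
    also have "\<dots> \<le> (\<Sum>i<m. \<bar>\<Sum>k<n. \<tau> k * X i k\<bar>) + real m * q / 2"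
      using err by (simp add: sum.distrib)
    also have "(\<Sum>i<m. \<bar>\<Sum>k<n. \<tau> k * X i k\<bar>) = c * (\<Sum>i<m. \<bar>\<Sum>k<n. t k * X i k\<bar>)"
    proof -
      have "\<bar>\<Sum>k<n. \<tau> k * X i k\<bar> = c * \<bar>\<Sum>k<n. t k * X i k\<bar>" for i
      proof -
        have "(\<Sum>k<n. \<tau> k * X i k) = c * (\<Sum>k<n. t k * X i k)"
          by (simp add: \<tau>_def sum_distrib_left mult.assoc)
        then show ?thesis using c by (simp add: abs_mult)
      qed
      then show ?thesis by (simp add: sum_distrib_left)
    qed
    finally have "real m * q \<le> c * (\<Sum>i<m. \<bar>\<Sum>k<n. t k * X i k\<bar>)" by (simp add: mult.commute)
    then have "real m * T \<le> 16 * (\<Sum>i<m. \<bar>\<Sum>k<n. t k * X i k\<bar>)"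
      using q(1) T by (simp add: c_def field_simps)
    moreover have "8 * real n * T * 16 \<le> real m * T"
      using T by (simp add: m_def)
    ultimately show ?thesis by (simp add: T_def)
  qed
  then show ?thesis using X2(2) unfolding m_def by blast
qed

text \<open>The unit vectors are put in front so that the hull of the points has non-empty interior;
  additional points only increase the l1 sum.\<close>

lemma ex_kashin_points:
  assumes "n \<ge> 1"
  shows "\<exists>x :: nat \<Rightarrow> nat \<Rightarrow> real. (\<forall>i<134 * n. \<forall>k<n. \<bar>x i k\<bar> \<le> 1) \<and>
    (\<forall>i<n. \<forall>k<n. x i k = idf i k) \<and>
    (\<forall>t. 8 * real n * L2_set t {..<n} \<le> (\<Sum>i<134 * n. \<bar>\<Sum>k<n. t k * x i k\<bar>))"
proof -
  obtain X :: "nat \<Rightarrow> nat \<Rightarrow> real" where X: "\<And>i k. i < 133 * n \<Longrightarrow> k < n \<Longrightarrow> \<bar>X i k\<bar> \<le> 1"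
    "\<And>t. 8 * real n * L2_set t {..<n} \<le> (\<Sum>i<133 * n. \<bar>\<Sum>k<n. t k * X i k\<bar>)"
    using ex_sign_matrix[OF assms] by blast
  define x where "x i = (if i < n then idf i else X (i - n))" for i
  have "8 * real n * L2_set t {..<n} \<le> (\<Sum>i<134 * n. \<bar>\<Sum>k<n. t k * x i k\<bar>)" for t
  proof -
    have "(\<Sum>i<133 * n. \<bar>\<Sum>k<n. t k * X i k\<bar>) = (\<Sum>i\<in>(\<lambda>i. i + n) ` {..<133 * n}. \<bar>\<Sum>k<n. t k * x i k\<bar>)"
      by (subst sum.reindex) (auto simp: inj_on_def x_def)
    also have "\<dots> \<le> (\<Sum>i<134 * n. \<bar>\<Sum>k<n. t k * x i k\<bar>)"
      by (intro sum_mono2) auto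
    finally show ?thesis using X(2)[of t] by linarith
  qed
  moreover have "\<bar>x i k\<bar> \<le> 1" if "i < 134 * n" "k < n" for i k
    using that X(1)[of "i - n" k] by (auto simp: x_def idf_def)
  moreover have "x i k = idf i k" if "i < n" for i k
    using that by (simp add: x_def)
  ultimately show ?thesis by blast
qed

section \<open>Convex bodies in coordinates\<close>

text \<open>Outside \<open>{..<n}\<close> the value \<open>undefined\<close> is replaced by 0: the
  padded set is compact in the full function space, hence closed and Borel, and padding is injective
  on \<open>Rn n\<close>.\<close>

lemma compactin_powertop_sets:
  assumes "compactin (powertop_real {..<n}) K"
  shows "K \<in> sets (lbn n)"
proof -
  define \<phi> :: "(nat \<Rightarrow> real) \<Rightarrow> nat \<Rightarrow> real" where "\<phi> x = (\<lambda>i. if i < n then x i else 0)" for x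
  have K: "K \<subseteq> Rn n" using compactin_subset_topspace[OF assms] by simp
  have "continuous_map (powertop_real {..<n}) (powertop_real UNIV) \<phi>"
    unfolding continuous_map_componentwise_UNIV
  proof
    fix k show "continuous_map (powertop_real {..<n}) euclideanreal (\<lambda>x. \<phi> x k)"
      by (cases "k < n") (auto simp: \<phi>_def intro: continuous_map_product_projection)
  qed
  then have "compactin (powertop_real UNIV) (\<phi> ` K)"
    using assms by (rule image_compactin[rotated])
  then have "compact (\<phi> ` K)"
    by (simp add: euclidean_product_topology)
  then have "\<phi> ` K \<in> sets (\<Pi>\<^sub>M i\<in>UNIV. borel)"
    unfolding sets_PiM_equal_borel by (intro borel_closed compact_imp_closed)
  moreover have "\<phi> \<in> measurable (lbn n) (\<Pi>\<^sub>M i\<in>UNIV. borel)"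
  proof (rule measurable_PiM_single')
    fix i show "(\<lambda>x. \<phi> x i) \<in> borel_measurable (lbn n)"
      by (cases "i < n") (auto simp: \<phi>_def)
  qed auto
  ultimately have "\<phi> -` (\<phi> ` K) \<inter> space (lbn n) \<in> sets (lbn n)"
    by (rule measurable_sets[rotated])
  also have "\<phi> -` (\<phi> ` K) \<inter> space (lbn n) = K"
  proof -
    have "x = y" if "x \<in> Rn n" "y \<in> Rn n" "\<phi> x = \<phi> y" for x y
    proof
      fix i show "x i = y i"
        using fun_cong[OF that(3), of i] that(1,2)
        by (cases "i < n") (auto simp: \<phi>_def PiE_def extensional_def)
    qed
    then show ?thesis using K by (auto simp: space_lbn subset_iff)
  qed
  finally show ?thesis .
qed

lemma compactin_powertop_bounded:
  fixes n :: nat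
  assumes "compactin (powertop_real {..<n}) K"
  shows "\<exists>B. \<forall>x\<in>K. \<forall>i<n. \<bar>x i\<bar> \<le> B"
proof -
  have "\<exists>B. \<forall>x\<in>K. \<bar>x i\<bar> \<le> B" if "i < n" for i
  proof -
    have "compact ((\<lambda>x. x i) ` K)"
      using image_compactin[OF assms continuous_map_product_projection[of i "{..<n}"]] that by simp
    then show ?thesis
      by (auto dest!: compact_imp_bounded simp: bounded_iff)
  qed
  then obtain B where B: "\<And>i x. i < n \<Longrightarrow> x \<in> K \<Longrightarrow> \<bar>x i\<bar> \<le> B i" by metis
  have "\<bar>x i\<bar> \<le> (\<Sum>i<n. \<bar>B i\<bar>)" if "x \<in> K" "i < n" for x i
  proof -
    have "\<bar>x i\<bar> \<le> \<bar>B i\<bar>" using B[OF that(2,1)] by linarith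
    also have "\<dots> \<le> (\<Sum>i<n. \<bar>B i\<bar>)" using that(2) by (intro member_le_sum) auto
    finally show ?thesis .
  qed
  then show ?thesis by blast
qed

section \<open>Volumes of cuboids, covers and convex bodies\<close>

lemma emeasure_cuboid:
  assumes "\<And>i. i < n \<Longrightarrow> 0 \<le> s i"
  shows "emeasure (lbn n) (\<Pi>\<^sub>E i\<in>{..<n}. {c i..c i + s i}) = ennreal (\<Prod>i<n. s i)"
proof -
  have "emeasure (lbn n) (\<Pi>\<^sub>E i\<in>{..<n}. {c i..c i + s i}) = (\<Prod>i<n. emeasure lborel {c i..c i + s i})"
    by (intro lbn.emeasure_PiM) auto
  also have "\<dots> = (\<Prod>i<n. ennreal (s i))"
    using assms by (intro prod.cong) auto
  also have "\<dots> = ennreal (\<Prod>i<n. s i)"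
    using assms by (intro prod_ennreal) auto
  finally show ?thesis .
qed

lemma vol_le_cover:
  assumes "finite F" "\<And>i. i < n \<Longrightarrow> 0 \<le> s i"
    and "X \<subseteq> (\<Union>a\<in>F. \<Pi>\<^sub>E i\<in>{..<n}. {c a i..c a i + s i})"
  shows "vol n X \<le> real (card F) * (\<Prod>i<n. s i)"
proof -
  let ?Q = "\<lambda>a. \<Pi>\<^sub>E i\<in>{..<n}. {c a i..c a i + s i}"
  have Q: "?Q a \<in> sets (lbn n)" for a by (intro sets_PiM_I_finite) auto
  have s0: "0 \<le> (\<Prod>i<n. s i)" using assms(2) by (intro prod_nonneg) auto
  have "emeasure (lbn n) X \<le> emeasure (lbn n) (\<Union>a\<in>F. ?Q a)"
    using assms Q by (intro emeasure_mono) auto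
  also have "\<dots> \<le> (\<Sum>a\<in>F. emeasure (lbn n) (?Q a))"
    using assms(1) Q by (intro emeasure_subadditive_finite) auto
  also have "\<dots> = (\<Sum>a\<in>F. ennreal (\<Prod>i<n. s i))"
    using assms(2) by (intro sum.cong emeasure_cuboid) auto
  also have "\<dots> = ennreal (real (card F) * (\<Prod>i<n. s i))"
    using s0 by (simp add: ennreal_mult ennreal_of_nat_eq_real_of_nat)
  finally show ?thesis
    unfolding vol_def measure_def
    using s0 by (intro enn2real_leI) auto
qed

lemma emeasure_compactin_finite:
  assumes "compactin (powertop_real {..<n}) K"
  shows "emeasure (lbn n) K < \<infinity>"
proof -
  obtain B where B: "\<And>x i. x \<in> K \<Longrightarrow> i < n \<Longrightarrow> \<bar>x i\<bar> \<le> B"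
    using compactin_powertop_bounded[OF assms] by blast
  have K: "K \<subseteq> Rn n"
    using compactin_subset_topspace[OF assms] by simp
  have sub: "K \<subseteq> (\<Pi>\<^sub>E i\<in>{..<n}. {- \<bar>B\<bar>..- \<bar>B\<bar> + 2 * \<bar>B\<bar>})"
  proof (intro subsetI PiE_I)
    fix x i assume "x \<in> K" "i \<in> {..<n}"
    then show "x i \<in> {- \<bar>B\<bar>..- \<bar>B\<bar> + 2 * \<bar>B\<bar>}"
      using B[of x i] by auto
  next
    fix x i assume "x \<in> K" "i \<notin> {..<n}"
    then show "x i = undefined" using K PiE_arb[of x] by blast
  qed
  have "emeasure (lbn n) K \<le> emeasure (lbn n) (\<Pi>\<^sub>E i\<in>{..<n}. {- \<bar>B\<bar>..- \<bar>B\<bar> + 2 * \<bar>B\<bar>})"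
    by (rule emeasure_mono[OF sub]) (rule sets_PiM_I_finite; simp)
  also have "\<dots> = ennreal (\<Prod>i<n. 2 * \<bar>B\<bar>)"
    by (rule emeasure_cuboid) simp
  finally show ?thesis by (simp add: le_less_trans)
qed

lemma vol_mono:
  assumes "compactin (powertop_real {..<n}) K" "X \<in> sets (lbn n)" "X \<subseteq> K"
  shows "vol n X \<le> vol n K"
  unfolding vol_def
  by (rule measure_mono_fmeasurable[OF assms(3,2)],
      rule fmeasurableI[OF compactin_powertop_sets[OF assms(1)] emeasure_compactin_finite[OF assms(1)]])

lemma convex_body_cube:
  assumes "convex_body n K"
  shows "\<exists>p\<in>K. \<exists>r>0. \<forall>x\<in>Rn n. (\<forall>i<n. \<bar>x i - p i\<bar> \<le> r) \<longrightarrow> x \<in> K"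
proof -
  obtain p where p: "p \<in> powertop_real {..<n} interior_of K"
    using assms by (auto simp: convex_body_def)
  obtain V where V: "openin (powertop_real {..<n}) V" "p \<in> V" "V \<subseteq> K"
    using p by (auto simp: interior_of_def)
  obtain U where U: "\<And>i. i \<in> {..<n} \<Longrightarrow> openin euclideanreal (U i)" "p \<in> Pi\<^sub>E {..<n} U" "Pi\<^sub>E {..<n} U \<subseteq> V"
    using bspec[OF V(1)[unfolded openin_product_topology_alt] V(2)] by (elim exE conjE) (rule that, auto)
  have "\<exists>r. i < n \<longrightarrow> r > 0 \<and> (\<forall>y. \<bar>y - p i\<bar> \<le> r \<longrightarrow> y \<in> U i)" for i
  proof (cases "i < n")
    case True
    then have "open (U i)" "p i \<in> U i" using U(1)[of i] PiE_mem[OF U(2), of i] by auto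
    then obtain e where "e > 0" "cball (p i) e \<subseteq> U i" by (auto simp: open_contains_cball)
    then have e: "e > 0" "\<And>y. y \<in> cball (p i) e \<Longrightarrow> y \<in> U i" by auto
    have "y \<in> U i" if "\<bar>y - p i\<bar> \<le> e" for y
      using that by (intro e(2)) (simp add: dist_real_def abs_minus_commute)
    then show ?thesis using e(1) by blast
  qed simp
  then have "\<exists>r. \<forall>i. i < n \<longrightarrow> r i > 0 \<and> (\<forall>y. \<bar>y - p i\<bar> \<le> r i \<longrightarrow> y \<in> U i)"
    by (intro choice allI)
  then obtain r where r: "\<And>i. i < n \<Longrightarrow> r i > 0" "\<And>i y. i < n \<Longrightarrow> \<bar>y - p i\<bar> \<le> r i \<Longrightarrow> y \<in> U i"
    by blast
  \<comment> \<open>\<open>insert 1\<close> keeps the minimum defined for n = 0.\<close>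
  define R where "R = Min (insert 1 (r ` {..<n}))"
  have R: "R > 0" "\<And>i. i < n \<Longrightarrow> R \<le> r i" using r(1) by (auto simp: R_def)
  have "x \<in> K" if "x \<in> Rn n" "\<forall>i<n. \<bar>x i - p i\<bar> \<le> R" for x
  proof -
    have "x i \<in> U i" if "i < n" for i
      using r(2)[OF that, of "x i"] R(2)[OF that] \<open>\<forall>i<n. \<bar>x i - p i\<bar> \<le> R\<close> that by fastforce
    then have "x \<in> Pi\<^sub>E {..<n} U"
      using that(1) by (simp add: PiE_iff)
    then show ?thesis using U(3) V(3) by blast
  qed
  then show ?thesis using R(1) V(2,3) by blast
qed

lemma convex_body_emeasure_pos:
  assumes "convex_body n K"
  shows "emeasure (lbn n) K > 0"
proof -
  obtain p r where p: "p \<in> K" "r > 0" "\<And>x. x \<in> Rn n \<Longrightarrow> (\<forall>i<n. \<bar>x i - p i\<bar> \<le> r) \<Longrightarrow> x \<in> K"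
    using convex_body_cube[OF assms] by blast
  have c: "compactin (powertop_real {..<n}) K" using assms by (simp add: convex_body_def)
  have "ennreal (\<Prod>i<n. r) = emeasure (lbn n) (\<Pi>\<^sub>E i\<in>{..<n}. {p i..p i + r})"
    using p(2) by (intro emeasure_cuboid[symmetric]) auto
  also have "\<dots> \<le> emeasure (lbn n) K"
  proof (rule emeasure_mono)
    show "(\<Pi>\<^sub>E i\<in>{..<n}. {p i..p i + r}) \<subseteq> K"
    proof
      fix x assume "x \<in> (\<Pi>\<^sub>E i\<in>{..<n}. {p i..p i + r})"
      then have "x \<in> Rn n" "\<And>i. i < n \<Longrightarrow> p i \<le> x i \<and> x i \<le> p i + r"
        by (auto simp: PiE_iff)
      then show "x \<in> K" by (intro p(3)) (auto simp: abs_le_iff algebra_simps)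
    qed
  qed (rule compactin_powertop_sets[OF c])
  finally show ?thesis using p(2) by (simp add: order.strict_trans2[rotated])
qed

lemma convex_body_vol_pos:
  assumes "convex_body n K"
  shows "vol n K > 0"
proof -
  have "emeasure (lbn n) K < \<infinity>"
    using emeasure_compactin_finite[of n K] assms by (simp add: convex_body_def)
  then show ?thesis
    unfolding vol_def measure_def
    using convex_body_emeasure_pos[OF assms] by (simp add: enn2real_positive_iff)
qed

lemma vol_image:
  assumes "compactin (powertop_real {..<n}) K" "detn n A \<noteq> 0"
  shows "vol n ((\<lambda>x. addf n b (mvf n A x)) ` K) = \<bar>detn n A\<bar> * vol n K"
  using emeasure_affine_image(2)[OF assms(2) compactin_powertop_sets[OF assms(1)], of b]
  by (simp add: vol_def measure_def enn2real_mult)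

text \<open>Bijectivity provides preimages of the points e_j + b; they form the columns of a right
  inverse of \<open>A\<close>, so its determinant is non-zero.\<close>

lemma invertible_affine_detn:
  assumes "invertible_affine n T"
  obtains A b where "detn n A \<noteq> 0" "\<And>x. x \<in> Rn n \<Longrightarrow> T x = addf n b (mvf n A x)"
proof -
  obtain A b where T: "\<And>x. x \<in> Rn n \<Longrightarrow> T x = (\<lambda>i\<in>{..<n}. (\<Sum>j<n. A i j * x j) + b i)"
    and bij: "bij_betw T (Rn n) (Rn n)"
    using assms by (auto simp: invertible_affine_def)
  have T': "T x = addf n b (mvf n A x)" if "x \<in> Rn n" for x
    using T[OF that] by (auto simp: addf_def mvf_def restrict_def)
  have "\<exists>x\<in>Rn n. T x = (\<lambda>i\<in>{..<n}. idf i j + b i)" for j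
  proof -
    have "(\<lambda>i\<in>{..<n}. idf i j + b i) \<in> T ` Rn n"
      using bij by (simp add: bij_betw_def)
    then show ?thesis by (elim imageE) metis
  qed
  then obtain X where X: "\<And>j. X j \<in> Rn n" "\<And>j. T (X j) = (\<lambda>i\<in>{..<n}. idf i j + b i)" by metis
  have "mulf n A (\<lambda>k j. X j k) i j = idf i j" if "i < n" for i j
    using fun_cong[OF trans[OF X(2)[of j, symmetric] T[OF X(1)[of j]]], of i] that
    by (simp add: mulf_def)
  then have "detn n A * detn n (\<lambda>k j. X j k) = 1"
    using detn_mulf[of n A "\<lambda>k j. X j k"] detn_cong[of n "mulf n A (\<lambda>k j. X j k)" idf] detn_idf[of n] by simp
  then have "detn n A \<noteq> 0" by auto
  then show thesis using T' that by blast
qed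

lemma invertible_affineI:
  assumes "detn n A \<noteq> 0"
  shows "invertible_affine n (\<lambda>x. addf n b (mvf n A x))"
proof -
  let ?T = "\<lambda>x. addf n b (mvf n A x)"
  obtain B where B: "\<And>i j. i < n \<Longrightarrow> j < n \<Longrightarrow> mulf n A B i j = idf i j"
      "\<And>i j. i < n \<Longrightarrow> j < n \<Longrightarrow> mulf n B A i j = idf i j"
    using detn_inverse[OF assms] by metis
  have AB: "mvf n A (mvf n B x) = x" "mvf n B (mvf n A x) = x" if "x \<in> Rn n" for x
    using that mvf_mulf[of n A B x] mvf_mulf[of n B A x] mvf_cong[OF B(1)] mvf_cong[OF B(2)] mvf_idf by auto
  have bb: "addf n b (addf n (\<lambda>i. - b i) x) = x" "addf n (\<lambda>i. - b i) (addf n b x) = x" if "x \<in> Rn n" for x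
    using that by (auto simp: addf_def fun_eq_iff PiE_def extensional_def)
  have "bij_betw ?T (Rn n) (Rn n)"
    by (rule bij_betw_byWitness[where f' = "\<lambda>y. mvf n B (addf n (\<lambda>i. - b i) y)"])
       (simp_all add: AB bb image_subset_iff)
  moreover have "?T x = (\<lambda>i\<in>{..<n}. (\<Sum>j<n. A i j * x j) + b i)" for x
    by (auto simp: addf_def mvf_def restrict_def)
  ultimately show ?thesis unfolding invertible_affine_def by blast
qed

section \<open>Unconditional bodies\<close>

lemma convex_RnD:
  assumes "convex_Rn n K" "x \<in> K" "y \<in> K" "0 \<le> u" "u \<le> 1"
  shows "(\<lambda>i\<in>{..<n}. (1 - u) * x i + u * y i) \<in> K"
  using assms(1)[unfolded convex_Rn_def, rule_format, OF assms(2,3), of "1 - u" u] assms(4,5) by simp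

text \<open>The coordinates are released from the vertex \<open>d\<close> one at a time: a point
  lies on the segment between the point with coordinate j reset to \<open>d j\<close> and the mirror
  image of that point.\<close>

lemma unconditional_cuboid:
  assumes K: "convex_Rn n K" "unconditional n K" and d: "(\<lambda>k\<in>{..<n}. d k) \<in> K" "\<And>k. k < n \<Longrightarrow> 0 < d k"
    and y: "y \<in> Rn n" "\<And>k. k < n \<Longrightarrow> \<bar>y k\<bar> \<le> d k"
  shows "y \<in> K"
proof -
  have "y \<in> K" if "j \<le> n" "y \<in> Rn n" "\<And>k. k < j \<Longrightarrow> \<bar>y k\<bar> \<le> d k" "\<And>k. j \<le> k \<Longrightarrow> k < n \<Longrightarrow> y k = d k" for j y
    using that
  proof (induction j arbitrary: y)
    case 0
    have "y = (\<lambda>k\<in>{..<n}. d k)"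
    proof
      fix k show "y k = (\<lambda>k\<in>{..<n}. d k) k"
        using 0(3)[of k] 0(4)[of k] PiE_arb[OF 0(2), of k] by (cases "k < n") auto
    qed
    then show ?case using d(1) by (rule ssubst[of _ _ "\<lambda>v. v \<in> K"])
  next
    case (Suc j)
    define p where "p = y(j := d j)"
    define q where "q = y(j := - d j)"
    have yn: "y k = undefined" if "\<not> k < n" for k
      using PiE_arb[OF Suc.prems(2), of k] that by simp
    have j: "j < n" "0 < d j" using Suc.prems(1) d(2) by auto
    have pR: "p \<in> Rn n" using yn j by (auto simp: p_def PiE_iff extensional_def)
    have pK: "p \<in> K"
    proof (rule Suc.IH)
      show "\<bar>p k\<bar> \<le> d k" if "k < j" for k
        using Suc.prems(3)[of k] that by (simp add: p_def)
      show "p k = d k" if "j \<le> k" "k < n" for k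
        using Suc.prems(4)[of k] that by (cases "k = j") (auto simp: p_def)
    qed (use pR j in auto)
    have "(\<lambda>k\<in>{..<n}. (if k = j then -1 else 1) * p k) \<in> K \<longleftrightarrow> p \<in> K"
      using K(2)[unfolded unconditional_def, rule_format, of "\<lambda>k. if k = j then -1 else 1" p] pR by auto
    moreover have "(\<lambda>k\<in>{..<n}. (if k = j then -1 else 1) * p k) = q"
      using yn j by (auto simp: p_def q_def restrict_def)
    ultimately have qK: "q \<in> K" using pK by simp
    define u where "u = (1 - y j / d j) / 2"
    have yj: "\<bar>y j\<bar> \<le> d j" using Suc.prems(3)[of j] by simp
    then have u: "0 \<le> u" "u \<le> 1" using j by (auto simp: u_def field_simps)
    have "(\<lambda>i\<in>{..<n}. (1 - u) * p i + u * q i) = y"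
    proof
      fix i
      have "(1 - u) * d j - u * d j = y j" using j by (simp add: u_def field_simps)
      then show "(\<lambda>i\<in>{..<n}. (1 - u) * p i + u * q i) i = y i"
        using yn[of i] j by (cases "i = j") (auto simp: p_def q_def algebra_simps)
    qed
    then show ?case using convex_RnD[OF K(1) pK qK u] by (rule subst[of _ _ "\<lambda>v. v \<in> K"])
  qed
  from this[of n y] y show ?thesis by auto
qed

text \<open>The sum of the z_k - 1 is the derivative of the product at t = 0; were it positive, the
  product would exceed 1 for small t. This is made quantitative by ln (1 + x) \<ge> x - 2 x^2 for
  |x| \<le> 1/2.\<close>

lemma prod_le_imp_sum_le:
  fixes z :: "nat \<Rightarrow> real"
  assumes "\<And>t. 0 \<le> t \<Longrightarrow> t \<le> 1 \<Longrightarrow> (\<Prod>k<n. 1 + t * (z k - 1)) \<le> 1"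
  shows "(\<Sum>k<n. z k) \<le> real n"
proof (rule ccontr)
  assume neg: "\<not> ?thesis"
  define a where "a k = z k - 1" for k
  define S where "S = (\<Sum>k<n. a k)"
  define Q where "Q = (\<Sum>k<n. (a k)\<^sup>2)"
  define M where "M = 1 + (\<Sum>k<n. \<bar>a k\<bar>)"
  have S: "S > 0" using neg by (simp add: S_def a_def sum_subtractf)
  have Q: "Q \<ge> 0" by (simp add: Q_def sum_nonneg)
  have M: "M \<ge> 1" by (simp add: M_def sum_nonneg)
  \<comment> \<open>The first bound keeps |t a_k| at most 1/2, the second makes the quadratic error
    2 t^2 Q smaller than the linear gain t S.\<close>
  define t where "t = min (1 / (2 * M)) (S / (4 * (Q + 1)))"
  have "t * M \<le> 1 / (2 * M) * M" using M by (intro mult_right_mono) (auto simp: t_def)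
  then have tM: "t * M \<le> 1 / 2" using M by simp
  have t0: "t > 0" using S Q M by (simp add: t_def)
  have le: "t * 1 \<le> t * M" using M t0 by (intro mult_left_mono) auto
  have t: "t > 0" "t \<le> 1" "t * M \<le> 1 / 2" using t0 tM le by linarith+
  have "t * (4 * (Q + 1)) \<le> S / (4 * (Q + 1)) * (4 * (Q + 1))"
    using Q by (intro mult_right_mono) (auto simp: t_def)
  also have "\<dots> = S" using Q by simp
  finally have "t * (4 * (Q + 1)) \<le> S" .
  moreover have "t * (4 * (Q + 1)) = 4 * t + 4 * (t * Q)" by (simp add: algebra_simps)
  ultimately have tQ: "2 * (t * Q) < S"
    using t(1) mult_nonneg_nonneg[of t Q] Q by linarith
  have small: "\<bar>t * a k\<bar> \<le> 1 / 2" if "k < n" for k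
  proof -
    have "\<bar>a k\<bar> \<le> (\<Sum>k<n. \<bar>a k\<bar>)" using that by (intro member_le_sum) auto
    then have "\<bar>a k\<bar> \<le> M" by (simp add: M_def)
    then have "t * \<bar>a k\<bar> \<le> t * M" using t by (intro mult_left_mono) auto
    moreover have "\<bar>t * a k\<bar> = t * \<bar>a k\<bar>" using t by (simp add: abs_mult)
    ultimately show ?thesis using t(3) by linarith
  qed
  have pos: "0 < 1 + t * a k" if "k < n" for k using small[OF that] by linarith
  have "t * (S - 2 * (t * Q)) = (\<Sum>k<n. t * a k - 2 * (t * a k)\<^sup>2)"
    by (simp add: S_def Q_def sum_subtractf sum_distrib_left power_mult_distrib right_diff_distrib power2_eq_square mult_ac)
  also have "\<dots> \<le> (\<Sum>k<n. ln (1 + t * a k))"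
  proof (rule sum_mono)
    fix k assume "k \<in> {..<n}"
    then show "t * a k - 2 * (t * a k)\<^sup>2 \<le> ln (1 + t * a k)"
      using abs_ln_one_plus_x_minus_x_bound[of "t * a k"] small[of k] by (simp add: abs_le_iff)
  qed
  also have "\<dots> = ln (\<Prod>k<n. 1 + t * a k)"
  proof (rule ln_prod[symmetric])
    fix k assume "k \<in> {..<n}"
    then show "1 + t * a k \<noteq> 0" using pos[of k] by simp
  qed simp
  also have "\<dots> \<le> 0"
    using assms[of t] t pos by (intro ln_le_zero_iff[THEN iffD2] prod_pos) (auto simp: a_def)
  finally show False using t(1) tQ by (simp add: mult_le_0_iff)
qed

text \<open>Maximising \<open>\<Prod>\<^sub>k |x\<^sub>k|\<close> over \<open>K\<close>: the maximiser is a vertex of an inscribed cuboid,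
  and the tangent plane of the product there is a supporting hyperplane of \<open>K\<close>.\<close>

lemma unconditional_position:
  assumes "convex_body n K" "unconditional n K"
  shows "\<exists>d. (\<forall>k<n. 0 < d k) \<and> (\<forall>y\<in>Rn n. (\<forall>k<n. \<bar>y k\<bar> \<le> d k) \<longrightarrow> y \<in> K) \<and>
    (\<forall>y\<in>K. (\<Sum>k<n. \<bar>y k\<bar> / d k) \<le> real n)"
proof -
  have comp: "compactin (powertop_real {..<n}) K" and conv: "convex_Rn n K"
    using assms(1) by (auto simp: convex_body_def)
  have KR: "K \<subseteq> Rn n" using compactin_subset_topspace[OF comp] by simp
  obtain p r where p: "p \<in> K" "r > 0" "\<And>x. x \<in> Rn n \<Longrightarrow> (\<forall>i<n. \<bar>x i - p i\<bar> \<le> r) \<Longrightarrow> x \<in> K"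
    using convex_body_cube[OF assms(1)] by blast
  define f :: "(nat \<Rightarrow> real) \<Rightarrow> real" where "f x = (\<Prod>k<n. \<bar>x k\<bar>)" for x
  have "continuous_map (powertop_real {..<n}) euclideanreal f"
    unfolding f_def
    by (intro continuous_map_prod continuous_map_real_abs continuous_map_product_projection) auto
  then have "compactin euclideanreal (f ` K)"
    by (rule image_compactin[OF comp])
  then have "compact (f ` K)" by simp
  then obtain m where m: "m \<in> K" "\<And>x. x \<in> K \<Longrightarrow> f x \<le> f m"
    using compact_attains_sup[of "f ` K"] p(1) by blast
  \<comment> \<open>Pushing \<open>p\<close> away from all coordinate hyperplanes within its cube
    shows that the maximal product is positive, so no coordinate of the maximiser vanishes.\<close>
  define x0 where "x0 = (\<lambda>i\<in>{..<n}. if p i \<ge> 0 then p i + r else p i - r)"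
  have "x0 \<in> K" using p(2) by (intro p(3)) (auto simp: x0_def)
  moreover have "f x0 \<ge> (\<Prod>k<n. r)"
    unfolding f_def using p(2) by (intro prod_mono) (auto simp: x0_def)
  moreover have "(\<Prod>k<n. r) > 0" using p(2) by (intro prod_pos) auto
  ultimately have fm: "f m > 0" using m(2)[of x0] by linarith
  define d where "d k = \<bar>m k\<bar>" for k
  have d0: "0 < d k" if "k < n" for k
  proof -
    have "\<bar>m k\<bar> \<noteq> 0"
      using fm that unfolding f_def by (metis finite_lessThan lessThan_iff less_irrefl prod_zero)
    then show ?thesis by (simp add: d_def)
  qed
  have absK: "(\<lambda>k\<in>{..<n}. \<bar>x k\<bar>) \<in> K" if "x \<in> K" for x
  proof -
    have "(\<lambda>k\<in>{..<n}. (if x k < 0 then -1 else 1) * x k) \<in> K \<longleftrightarrow> x \<in> K"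
      using assms(2)[unfolded unconditional_def, rule_format, of "\<lambda>k. if x k < 0 then -1 else 1" x] KR that by auto
    moreover have "(\<lambda>k\<in>{..<n}. (if x k < 0 then -1 else 1) * x k) = (\<lambda>k\<in>{..<n}. \<bar>x k\<bar>)"
      by (auto simp: restrict_def)
    ultimately show ?thesis using that by simp
  qed
  have dK: "(\<lambda>k\<in>{..<n}. d k) \<in> K" using absK[OF m(1)] by (simp add: d_def)
  have "(\<Sum>k<n. \<bar>y k\<bar> / d k) \<le> real n" if "y \<in> K" for y
  proof (rule prod_le_imp_sum_le)
    fix t :: real assume t: "0 \<le> t" "t \<le> 1"
    \<comment> \<open>A point of the segment from \<open>d\<close> to the vector of the |y_k|; along
      it the product stays at most that of \<open>d\<close>.\<close>
    define w where "w = (\<lambda>i\<in>{..<n}. (1 - t) * (\<lambda>k\<in>{..<n}. d k) i + t * (\<lambda>k\<in>{..<n}. \<bar>y k\<bar>) i)"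
    have "w \<in> K" unfolding w_def by (rule convex_RnD[OF conv dK absK[OF that] t])
    then have "f w \<le> f m" by (rule m(2))
    moreover have "f w = (\<Prod>k<n. d k * (1 + t * (\<bar>y k\<bar> / d k - 1)))"
      unfolding f_def
    proof (rule prod.cong[OF refl])
      fix k assume k: "k \<in> {..<n}"
      have "w k = (1 - t) * d k + t * \<bar>y k\<bar>" using k by (simp add: w_def)
      moreover have "\<dots> = d k * (1 + t * (\<bar>y k\<bar> / d k - 1))"
        using d0[of k] k by (simp add: field_simps)
      moreover have "0 \<le> (1 - t) * d k + t * \<bar>y k\<bar>"
        using d0[of k] k t by (intro add_nonneg_nonneg mult_nonneg_nonneg) auto
      ultimately show "\<bar>w k\<bar> = d k * (1 + t * (\<bar>y k\<bar> / d k - 1))" by simp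
    qed
    moreover have "f m = (\<Prod>k<n. d k)" by (simp add: f_def d_def)
    ultimately show "(\<Prod>k<n. 1 + t * (\<bar>y k\<bar> / d k - 1)) \<le> 1"
      using fm by (simp add: prod.distrib)
  qed
  moreover have "y \<in> K" if "y \<in> Rn n" "\<forall>k<n. \<bar>y k\<bar> \<le> d k" for y
    using unconditional_cuboid[OF conv assms(2) dK d0 that(1)] that(2) by blast
  ultimately show ?thesis using d0 by blast
qed

section \<open>Volume of a body between its cuboid and its cross-polytope\<close>

lemma vol_ge_cuboid:
  assumes "compactin (powertop_real {..<n}) K" "\<And>k. k < n \<Longrightarrow> 0 < d k"
    and "\<And>y. y \<in> Rn n \<Longrightarrow> (\<forall>k<n. \<bar>y k\<bar> \<le> d k) \<Longrightarrow> y \<in> K"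
  shows "2 ^ n * (\<Prod>k<n. d k) \<le> vol n K"
proof -
  let ?Q = "\<Pi>\<^sub>E k\<in>{..<n}. {- d k..- d k + 2 * d k}"
  have Qm: "?Q \<in> sets (lbn n)" by (intro sets_PiM_I_finite) auto
  have sub: "?Q \<subseteq> K"
  proof
    fix y assume y: "y \<in> ?Q"
    show "y \<in> K"
    proof (rule assms(3))
      show "y \<in> Rn n" using y by (auto simp: PiE_iff)
      show "\<forall>k<n. \<bar>y k\<bar> \<le> d k"
      proof (intro allI impI)
        fix k assume "k < n"
        then show "\<bar>y k\<bar> \<le> d k" using PiE_mem[OF y, of k] by auto
      qed
    qed
  qed
  have "0 \<le> (\<Prod>k<n. 2 * d k)" using assms(2) by (intro prod_nonneg) (auto intro: less_imp_le)
  then have "vol n ?Q = (\<Prod>k<n. 2 * d k)"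
    unfolding vol_def measure_def
    using assms(2) by (subst emeasure_cuboid) (auto intro: less_imp_le)
  then show ?thesis
    using vol_mono[OF assms(1) Qm sub] by (simp add: prod.distrib)
qed

lemma floor_in_lattice:
  assumes "(\<Sum>k<n. \<bar>e k\<bar>) \<le> real R"
  shows "(\<lambda>k\<in>{..<n}. \<lfloor>e k\<rfloor>) \<in> {z \<in> {..<n} \<rightarrow>\<^sub>E (UNIV :: int set). (\<Sum>i<n. \<bar>z i\<bar>) \<le> int (R + n)}"
proof -
  have "real_of_int (\<Sum>k<n. \<bar>\<lfloor>e k\<rfloor>\<bar>) \<le> (\<Sum>k<n. \<bar>e k\<bar> + 1)"
    unfolding of_int_sum of_int_abs by (intro sum_mono) linarith
  also have "\<dots> \<le> real_of_int (int (R + n))"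
    using assms by (simp add: sum.distrib)
  finally have "(\<Sum>k<n. \<bar>\<lfloor>e k\<rfloor>\<bar>) \<le> int (R + n)"
    by (simp only: of_int_le_iff)
  then show ?thesis by simp
qed

text \<open>Cells of a grid with steps d_k are counted instead of evaluating the volume (2 n)^n / n!
  times the product of the d_k. Taking floors adds at most n to the l1 norm, so at most 2^(2 n) *
  3^n = 12^n cells occur.\<close>

lemma vol_le_l1_ball:
  assumes "\<And>k. k < n \<Longrightarrow> 0 < d k" "K \<subseteq> Rn n" "\<And>y. y \<in> K \<Longrightarrow> (\<Sum>k<n. \<bar>y k\<bar> / d k) \<le> real n"
  shows "vol n K \<le> 12 ^ n * (\<Prod>k<n. d k)"
proof -
  define Z where "Z = {z \<in> {..<n} \<rightarrow>\<^sub>E (UNIV :: int set). (\<Sum>i<n. \<bar>z i\<bar>) \<le> int (n + n)}"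
  have Z: "finite Z" "card Z \<le> 2 ^ (n + n) * 3 ^ n"
    using card_lattice_points_l1[of "{..<n}" "n + n"] by (auto simp: Z_def)
  have "K \<subseteq> (\<Union>z\<in>Z. \<Pi>\<^sub>E k\<in>{..<n}. {d k * of_int (z k)..d k * of_int (z k) + d k})"
  proof
    fix y assume y: "y \<in> K"
    define z where "z = (\<lambda>k\<in>{..<n}. \<lfloor>y k / d k\<rfloor>)"
    have "(\<Sum>k<n. \<bar>y k / d k\<bar>) = (\<Sum>k<n. \<bar>y k\<bar> / d k)"
      using assms(1) by (intro sum.cong) (auto simp: abs_divide less_imp_le)
    then have "z \<in> Z"
      unfolding z_def Z_def using assms(3)[OF y] by (intro floor_in_lattice) simp
    moreover have "y \<in> (\<Pi>\<^sub>E k\<in>{..<n}. {d k * of_int (z k)..d k * of_int (z k) + d k})"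
    proof (rule PiE_I)
      fix k assume k: "k \<in> {..<n}"
      then have dk: "0 < d k" using assms(1) by simp
      define q where "q = y k / d k"
      have "d k * of_int \<lfloor>q\<rfloor> \<le> d k * q" "d k * q \<le> d k * (of_int \<lfloor>q\<rfloor> + 1)"
        using dk by (intro mult_left_mono; linarith)+
      moreover have "d k * q = y k" using dk by (simp add: q_def)
      moreover have "z k = \<lfloor>q\<rfloor>" using k by (simp add: z_def q_def)
      ultimately show "y k \<in> {d k * of_int (z k)..d k * of_int (z k) + d k}"
        by (simp add: distrib_left)
    next
      fix k assume "k \<notin> {..<n}"
      then show "y k = undefined" using PiE_arb[of y] assms(2) y by blast
    qed
    ultimately show "y \<in> (\<Union>z\<in>Z. \<Pi>\<^sub>E k\<in>{..<n}. {d k * of_int (z k)..d k * of_int (z k) + d k})"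
      by blast
  qed
  then have "vol n K \<le> real (card Z) * (\<Prod>k<n. d k)"
    using assms(1) Z(1) by (intro vol_le_cover) (auto intro: less_imp_le)
  also have "\<dots> \<le> (2 ^ (n + n) * 3 ^ n) * (\<Prod>k<n. d k)"
    using of_nat_mono[OF Z(2), where 'a = real] assms(1)
    by (intro mult_right_mono prod_nonneg) (auto intro: less_imp_le)
  also have "(2 ^ (n + n) * 3 ^ n :: real) = 12 ^ n"
    by (simp add: power_add power_mult_distrib[symmetric])
  finally show ?thesis .
qed

section \<open>The lower estimate\<close>

text \<open>The hull is parametrised by the cross-polytope of the coefficient space, so that
  compactness follows from continuity of a linear map.\<close>

definition abs_hull :: "nat \<Rightarrow> nat \<Rightarrow> (nat \<Rightarrow> nat \<Rightarrow> real) \<Rightarrow> (nat \<Rightarrow> real) set" where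
  "abs_hull n p x = (\<lambda>a. \<lambda>k\<in>{..<n}. \<Sum>i<p. a i * x i k) ` {a \<in> Rn p. (\<Sum>i<p. \<bar>a i\<bar>) \<le> 1}"

lemma abs_hullI:
  assumes "(\<Sum>i<p. \<bar>a i\<bar>) \<le> 1"
  shows "(\<lambda>k\<in>{..<n}. \<Sum>i<p. a i * x i k) \<in> abs_hull n p x"
proof -
  have "(\<lambda>k\<in>{..<n}. \<Sum>i<p. a i * x i k) = (\<lambda>k\<in>{..<n}. \<Sum>i<p. restrict a {..<p} i * x i k)"
    by simp
  moreover have "restrict a {..<p} \<in> {a \<in> Rn p. (\<Sum>i<p. \<bar>a i\<bar>) \<le> 1}"
    using assms by simp
  ultimately show ?thesis unfolding abs_hull_def by (rule image_eqI)
qed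

lemma compactin_abs_hull: "compactin (powertop_real {..<n}) (abs_hull n p x)"
  unfolding abs_hull_def
proof (rule image_compactin)
  let ?X = "powertop_real {..<p}"
  let ?A = "{a \<in> Rn p. (\<Sum>i<p. \<bar>a i\<bar>) \<le> 1}"
  have "continuous_map ?X euclideanreal (\<lambda>a. \<Sum>i<p. \<bar>a i\<bar>)"
    by (intro continuous_map_sum continuous_map_real_abs continuous_map_product_projection) auto
  then have "closedin ?X {a \<in> topspace ?X. (\<Sum>i<p. \<bar>a i\<bar>) \<in> {..1}}"
    by (rule closedin_continuous_map_preimage) simp
  then have cl: "closedin ?X ?A" by simp
  have "compactin ?X (\<Pi>\<^sub>E i\<in>{..<p}. {-1..1})"
    by (simp add: compactin_PiE)
  moreover have "?A \<subseteq> (\<Pi>\<^sub>E i\<in>{..<p}. {-1..1})"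
  proof
    fix a assume a: "a \<in> ?A"
    have "a i \<in> {-1..1}" if "i < p" for i
    proof -
      have "\<bar>a i\<bar> \<le> (\<Sum>i<p. \<bar>a i\<bar>)" using that by (intro member_le_sum) auto
      also have "\<dots> \<le> 1" using a by simp
      finally show ?thesis by (simp add: abs_le_iff)
    qed
    then show "a \<in> (\<Pi>\<^sub>E i\<in>{..<p}. {-1..1})" using a by (simp add: PiE_iff)
  qed
  ultimately show "compactin ?X ?A" using cl by (rule closed_compactin)
  show "continuous_map ?X (powertop_real {..<n}) (\<lambda>a. \<lambda>k\<in>{..<n}. \<Sum>i<p. a i * x i k)"
    unfolding continuous_map_componentwise
  proof (intro conjI ballI)
    fix k assume k: "k \<in> {..<n}"
    have "continuous_map ?X euclideanreal (\<lambda>a. \<Sum>i<p. a i * x i k)"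
      by (intro continuous_map_sum continuous_map_real_mult continuous_map_product_projection) auto
    then show "continuous_map ?X euclideanreal (\<lambda>a. (\<lambda>k\<in>{..<n}. \<Sum>i<p. a i * x i k) k)"
      using k by simp
  qed auto
qed

lemma convex_body_abs_hull:
  assumes "1 \<le> n" "n \<le> p" "\<And>i k. i < n \<Longrightarrow> k < n \<Longrightarrow> x i k = idf i k"
  shows "convex_body n (abs_hull n p x)"
  unfolding convex_body_def
proof (intro conjI)
  show "compactin (powertop_real {..<n}) (abs_hull n p x)" by (rule compactin_abs_hull)
  show "convex_Rn n (abs_hull n p x)"
    unfolding convex_Rn_def
  proof (intro ballI allI impI)
    fix y z :: "nat \<Rightarrow> real" and u v :: real
    assume yz: "y \<in> abs_hull n p x" "z \<in> abs_hull n p x" and uv: "0 \<le> u" "0 \<le> v" "u + v = 1"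
    obtain a where a: "(\<Sum>i<p. \<bar>a i\<bar>) \<le> 1" "y = (\<lambda>k\<in>{..<n}. \<Sum>i<p. a i * x i k)"
      using yz(1) by (auto simp: abs_hull_def)
    obtain b where b: "(\<Sum>i<p. \<bar>b i\<bar>) \<le> 1" "z = (\<lambda>k\<in>{..<n}. \<Sum>i<p. b i * x i k)"
      using yz(2) by (auto simp: abs_hull_def)
    have "(\<Sum>i<p. \<bar>u * a i + v * b i\<bar>) \<le> (\<Sum>i<p. u * \<bar>a i\<bar> + v * \<bar>b i\<bar>)"
      using uv by (intro sum_mono) (metis abs_mult abs_of_nonneg abs_triangle_ineq)
    also have "\<dots> = u * (\<Sum>i<p. \<bar>a i\<bar>) + v * (\<Sum>i<p. \<bar>b i\<bar>)"
      by (simp add: sum.distrib sum_distrib_left)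
    also have "\<dots> \<le> 1"
      using convex_bound_le[OF a(1) b(1) uv] by simp
    finally have "(\<lambda>k\<in>{..<n}. \<Sum>i<p. (u * a i + v * b i) * x i k) \<in> abs_hull n p x"
      by (rule abs_hullI)
    also have "(\<lambda>k\<in>{..<n}. \<Sum>i<p. (u * a i + v * b i) * x i k) = (\<lambda>k\<in>{..<n}. u * y k + v * z k)"
      by (rule restrict_ext) (simp add: a(2) b(2) distrib_right sum.distrib sum_distrib_left mult.assoc)
    finally show "(\<lambda>k\<in>{..<n}. u * y k + v * z k) \<in> abs_hull n p x" .
  qed
  \<comment> \<open>The first \<open>n\<close> points are the unit vectors, and the l1 norm is at
    most 1 on a cube of half-side 1/n.\<close>
  let ?U = "\<Pi>\<^sub>E k\<in>{..<n}. {- (1 / real n)<..<1 / real n}"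
  have "openin (powertop_real {..<n}) ?U"
    by (simp add: openin_PiE)
  moreover have "?U \<subseteq> abs_hull n p x"
  proof
    fix y assume y: "y \<in> ?U"
    define a where "a i = (if i < n then y i else 0)" for i
    have split: "(\<Sum>i<p. f i) = (\<Sum>i<n. f i)" if "\<And>i. \<not> i < n \<Longrightarrow> f i = 0" for f :: "nat \<Rightarrow> real"
      using assms(2) that by (intro sum.mono_neutral_right) auto
    have "(\<Sum>i<p. \<bar>a i\<bar>) = (\<Sum>i<n. \<bar>y i\<bar>)"
      by (subst split) (auto simp: a_def)
    also have "\<dots> \<le> (\<Sum>i<n. 1 / real n)"
    proof (rule sum_mono)
      fix i assume "i \<in> {..<n}"
      then have "y i \<in> {- (1 / real n)<..<1 / real n}" by (rule PiE_mem[OF y])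
      then show "\<bar>y i\<bar> \<le> 1 / real n" by auto
    qed
    also have "\<dots> = 1" using assms(1) by simp
    finally have "(\<lambda>k\<in>{..<n}. \<Sum>i<p. a i * x i k) \<in> abs_hull n p x" by (rule abs_hullI)
    also have "(\<lambda>k\<in>{..<n}. \<Sum>i<p. a i * x i k) = y"
    proof
      fix k
      show "(\<lambda>k\<in>{..<n}. \<Sum>i<p. a i * x i k) k = y k"
      proof (cases "k < n")
        case True
        have "(\<Sum>i<p. a i * x i k) = (\<Sum>i<n. y i * idf i k)"
          using True assms(3) by (subst split) (auto simp: a_def intro!: sum.cong)
        then show ?thesis using True by (simp add: sum_idf_mult)
      next
        case False
        then show ?thesis using PiE_arb[OF y, of k] by simp
      qed
    qed
    finally show "y \<in> abs_hull n p x" .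
  qed
  ultimately have "?U \<subseteq> powertop_real {..<n} interior_of abs_hull n p x"
    by (rule interior_of_maximal[rotated])
  moreover have "(\<lambda>k\<in>{..<n}. 0) \<in> ?U" using assms(1) by auto
  ultimately show "powertop_real {..<n} interior_of abs_hull n p x \<noteq> {}" by blast
qed

text \<open>Each \<open>y = b + A (\<Sum>\<^sub>i a\<^sub>i x\<^sub>i)\<close> is rounded in three stages: \<open>n a\<close> to an integer vector \<open>z\<close>,
  the scaled error \<open>w = \<surd>n (\<Sum>\<^sub>i (a\<^sub>i - z\<^sub>i / n) x\<^sub>i)\<close> to an integer vector \<open>\<zeta>\<close>, and the
  image of \<open>w - \<zeta>\<close>, measured in units of \<open>\<sigma>\<^sub>k\<close>, to its floor \<open>\<eta>\<close>. All three integer vectors have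
  \<open>\<ell>\<^sub>1\<close> norm \<open>O(n)\<close>, so there are exponentially many cuboids, of side lengths \<open>\<sigma>\<^sub>k / \<surd>n\<close>.\<close>

lemma vol_affine_abs_hull_le:
  fixes x :: "nat \<Rightarrow> nat \<Rightarrow> real"
  assumes n: "1 \<le> n" and x: "\<And>i k. i < 134 * n \<Longrightarrow> k < n \<Longrightarrow> \<bar>x i k\<bar> \<le> 1"
    and \<sigma>: "\<And>k. k < n \<Longrightarrow> 0 < \<sigma> k" and A: "\<And>k. k < n \<Longrightarrow> L2_set (A k) {..<n} \<le> \<sigma> k"
  shows "vol n ((\<lambda>y. addf n b (mvf n A y)) ` abs_hull n (134 * n) x)
    \<le> (2 ^ 144 * 3 ^ 136) ^ n * (\<Prod>k<n. \<sigma> k / sqrt (real n))"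
proof -
  define p where "p = 134 * n"
  define q where "q = sqrt (real n)"
  have q: "q > 0" "q * q = real n" using n by (auto simp: q_def)
  define lat where "lat m R = {z \<in> {..<m} \<rightarrow>\<^sub>E (UNIV :: int set). (\<Sum>i<m. \<bar>z i\<bar>) \<le> int R}" for m R :: nat
  have lat: "finite (lat m R)" "card (lat m R) \<le> 2 ^ R * 3 ^ m" for m R
    using card_lattice_points_l1[of "{..<m}" R] by (auto simp: lat_def)
  have latI: "restrict z {..<m} \<in> lat m (R + m)"
    if "\<And>i. \<bar>of_int (z i) - e i\<bar> \<le> 1" "(\<Sum>i<m. \<bar>e i\<bar>) \<le> real R" for z e m R
  proof -
    have "real_of_int (\<Sum>k<m. \<bar>z k\<bar>) \<le> (\<Sum>k<m. \<bar>e k\<bar> + 1)"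
      unfolding of_int_sum of_int_abs
    proof (rule sum_mono)
      fix k show "\<bar>real_of_int (z k)\<bar> \<le> \<bar>e k\<bar> + 1" using that(1)[of k] by linarith
    qed
    also have "\<dots> \<le> real_of_int (int (R + m))" using that(2) by (simp add: sum.distrib)
    finally have "(\<Sum>k<m. \<bar>z k\<bar>) \<le> int (R + m)" by (simp only: of_int_le_iff)
    then show ?thesis by (simp add: lat_def)
  qed
  have L1: "(\<Sum>k<n. \<bar>f k\<bar>) \<le> q * L2_set f {..<n}" for f
    using L2_set_mult_ineq[of "\<lambda>_. 1" f "{..<n}"] by (simp add: L2_set_constant q_def)
  \<comment> \<open>Before rounding, the three vectors have l1 norms at most n, 6 n and n; rounding
    adds at most 1 for each of their p, n and n coordinates.\<close>
  define F where "F = lat p (n + p) \<times> lat n (6 * n + n) \<times> lat n (n + n)"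
  define c where "c = (\<lambda>(z, \<zeta>, \<eta>) k. b k + (\<Sum>j<n. A k j * ((\<Sum>i<p. of_int (z i) * x i j) / n + of_int (\<zeta> j) / q))
    + \<sigma> k / q * of_int (\<eta> k :: int))" for z :: "(nat \<Rightarrow> int) \<times> (nat \<Rightarrow> int) \<times> (nat \<Rightarrow> int)"
  have finF: "finite F" by (simp add: F_def lat)
  have "(\<lambda>y. addf n b (mvf n A y)) ` abs_hull n p x
      \<subseteq> (\<Union>f\<in>F. \<Pi>\<^sub>E k\<in>{..<n}. {c f k..c f k + \<sigma> k / q})"
  proof
    fix y assume "y \<in> (\<lambda>y. addf n b (mvf n A y)) ` abs_hull n p x"
    then obtain a where a: "(\<Sum>i<p. \<bar>a i\<bar>) \<le> 1"
      and y: "y = addf n b (mvf n A (\<lambda>k\<in>{..<n}. \<Sum>i<p. a i * x i k))"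
      by (auto simp: abs_hull_def)
    obtain z :: "nat \<Rightarrow> int" where z1: "\<And>i. \<bar>of_int (z i) - real n * a i\<bar> \<le> 1"
      and z2: "(\<Sum>k<n. (\<Sum>i<p. (of_int (z i) - real n * a i) * x i k)\<^sup>2) \<le> (\<Sum>i<p. \<Sum>k<n. (x i k)\<^sup>2) / 4"
      using integer_rounding[of "{..<p}" "{..<n}" "\<lambda>i. real n * a i" x] by auto
    have "(\<Sum>i<p. \<Sum>k<n. (x i k)\<^sup>2) \<le> (\<Sum>i<p. \<Sum>k<n. 1)"
      using x by (intro sum_mono) (simp add: abs_square_le_1 p_def)
    also have "\<dots> = 134 * (real n * real n)" by (simp add: p_def)
    \<comment> \<open>Here 134/4 is relaxed to 36 = 6^2.\<close>
    finally have z2': "(\<Sum>k<n. (\<Sum>i<p. (of_int (z i) - real n * a i) * x i k)\<^sup>2) \<le> 36 * (real n * real n)"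
      using z2 mult_nonneg_nonneg[of "real n" "real n"] by linarith
    \<comment> \<open>The error of the first stage is w / q with w of length at most 6 sqrt n; the
      factor 1 / q is carried along and becomes the divisor sqrt n of the side lengths.\<close>
    define w where "w k = (\<Sum>i<p. (real n * a i - of_int (z i)) * x i k) / q" for k
    have wz: "w k = - (\<Sum>i<p. (of_int (z i) - real n * a i) * x i k) / q" for k
      by (simp add: w_def sum_negf[symmetric] algebra_simps)
    have "(\<Sum>k<n. (w k)\<^sup>2) = (\<Sum>k<n. (\<Sum>i<p. (of_int (z i) - real n * a i) * x i k)\<^sup>2) / (q * q)"
    proof -
      have "(w k)\<^sup>2 = (\<Sum>i<p. (of_int (z i) - real n * a i) * x i k)\<^sup>2 / (q * q)" for k
        by (simp only: wz power_divide power2_minus power2_eq_square[of q])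
      then show ?thesis by (simp only: sum_divide_distrib)
    qed
    also have "\<dots> \<le> 36 * (real n * real n) / (q * q)"
      using z2' q by (intro divide_right_mono) auto
    also have "\<dots> = (6 * q)\<^sup>2" using n q by (simp add: power2_eq_square)
    finally have "L2_set w {..<n} \<le> 6 * q"
      unfolding L2_set_def using q by (intro real_le_lsqrt) (auto intro: sum_nonneg)
    then have "q * L2_set w {..<n} \<le> q * (6 * q)"
      using q by (intro mult_left_mono) auto
    moreover have "q * (6 * q) = real (6 * n)" using q(2) by simp
    ultimately have w1: "(\<Sum>k<n. \<bar>w k\<bar>) \<le> real (6 * n)"
      using L1[of w] by linarith
    \<comment> \<open>The vectors used for rounding are the columns of \<open>A\<close> after
      division of row k by \<open>\<sigma> k\<close>: the divided rows have length at most 1, so the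
      squared lengths add up to at most n.\<close>
    obtain \<zeta> :: "nat \<Rightarrow> int" where \<zeta>1: "\<And>j. \<bar>of_int (\<zeta> j) - w j\<bar> \<le> 1"
      and \<zeta>2: "(\<Sum>k<n. (\<Sum>j<n. (of_int (\<zeta> j) - w j) * (A k j / \<sigma> k))\<^sup>2) \<le> (\<Sum>j<n. \<Sum>k<n. (A k j / \<sigma> k)\<^sup>2) / 4"
      using integer_rounding[of "{..<n}" "{..<n}" w "\<lambda>j k. A k j / \<sigma> k"] by auto
    define e where "e k = (\<Sum>j<n. (w j - of_int (\<zeta> j)) * (A k j / \<sigma> k))" for k
    have e\<zeta>: "e k = - (\<Sum>j<n. (of_int (\<zeta> j) - w j) * (A k j / \<sigma> k))" for k
      by (simp only: e_def sum_negf[symmetric] mult_minus_left[symmetric] minus_diff_eq)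
    have "(\<Sum>j<n. \<Sum>k<n. (A k j / \<sigma> k)\<^sup>2) = (\<Sum>k<n. \<Sum>j<n. (A k j / \<sigma> k)\<^sup>2)"
      by (rule sum.swap)
    also have "\<dots> \<le> (\<Sum>k<n. 1)"
    proof (rule sum_mono)
      fix k assume k: "k \<in> {..<n}"
      have "(\<Sum>j<n. (A k j)\<^sup>2) = (L2_set (A k) {..<n})\<^sup>2"
        by (simp add: L2_set_def sum_nonneg)
      also have "\<dots> \<le> (\<sigma> k)\<^sup>2" using A k by (intro power_mono) auto
      finally show "(\<Sum>j<n. (A k j / \<sigma> k)\<^sup>2) \<le> 1"
        using \<sigma>[of k] k by (simp add: power_divide sum_divide_distrib[symmetric])
    qed
    finally have "(\<Sum>k<n. (e k)\<^sup>2) \<le> real n"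
      using \<zeta>2 by (simp add: e\<zeta>)
    then have "L2_set e {..<n} \<le> q"
      unfolding L2_set_def q_def by (rule real_sqrt_le_mono)
    then have "q * L2_set e {..<n} \<le> q * q"
      using q by (intro mult_left_mono) auto
    then have e1: "(\<Sum>k<n. \<bar>e k\<bar>) \<le> real n"
      using L1[of e] q(2) by linarith
    define f where "f = (restrict z {..<p}, restrict \<zeta> {..<n}, \<lambda>k\<in>{..<n}. \<lfloor>e k\<rfloor>)"
    have "(\<Sum>i<p. \<bar>real n * a i\<bar>) \<le> real n"
      using mult_left_mono[OF a, of "real n"] by (simp add: abs_mult sum_distrib_left)
    then have "restrict z {..<p} \<in> lat p (n + p)" by (intro latI[OF z1])
    moreover have "restrict \<zeta> {..<n} \<in> lat n (6 * n + n)" by (intro latI[OF \<zeta>1 w1])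
    moreover have "(\<lambda>k\<in>{..<n}. \<lfloor>e k\<rfloor>) \<in> lat n (n + n)"
    proof (rule latI[OF _ e1])
      fix i show "\<bar>real_of_int \<lfloor>e i\<rfloor> - e i\<bar> \<le> 1" by linarith
    qed
    ultimately have fF: "f \<in> F" by (simp add: F_def f_def)
    have "y k \<in> {c f k..c f k + \<sigma> k / q}" if k: "k < n" for k
    proof -
      have ax: "(\<Sum>i<p. a i * x i j) = (\<Sum>i<p. of_int (z i) * x i j) / n + w j / q" for j
      proof -
        have "w j / q = (\<Sum>i<p. (real n * a i - of_int (z i)) * x i j) / n"
          using q by (simp add: w_def)
        also have "\<dots> = (real n * (\<Sum>i<p. a i * x i j) - (\<Sum>i<p. of_int (z i) * x i j)) / n"
          by (simp add: left_diff_distrib sum_subtractf sum_distrib_left mult.assoc)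
        finally show ?thesis using n by (simp add: diff_divide_distrib)
      qed
      have ck: "c f k = b k + (\<Sum>j<n. A k j * ((\<Sum>i<p. of_int (z i) * x i j) / n + of_int (\<zeta> j) / q))
          + \<sigma> k / q * of_int \<lfloor>e k\<rfloor>"
        using k by (simp add: c_def f_def)
      have "\<sigma> k * e k = (\<Sum>j<n. A k j * (w j - of_int (\<zeta> j)))"
        using \<sigma>[OF k] by (simp add: e_def sum_distrib_left mult_ac)
      then have "\<sigma> k / q * e k = (\<Sum>j<n. A k j * (w j - of_int (\<zeta> j))) / q" by simp
      also have "\<dots> = (\<Sum>j<n. A k j * (w j / q - of_int (\<zeta> j) / q))"
        by (simp only: sum_divide_distrib diff_divide_distrib[symmetric] times_divide_eq_right)
      finally have se: "\<sigma> k / q * e k = (\<Sum>j<n. A k j * (w j / q - of_int (\<zeta> j) / q))" .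
      have "y k = b k + (\<Sum>j<n. A k j * (\<Sum>i<p. a i * x i j))"
        using k by (simp add: y addf_def mvf_def)
      also have "(\<Sum>j<n. A k j * (\<Sum>i<p. a i * x i j))
          = (\<Sum>j<n. A k j * ((\<Sum>i<p. of_int (z i) * x i j) / n + of_int (\<zeta> j) / q))
            + (\<Sum>j<n. A k j * (w j / q - of_int (\<zeta> j) / q))"
        unfolding ax sum.distrib[symmetric] by (intro sum.cong refl) (simp add: algebra_simps)
      finally have yk: "y k = c f k + \<sigma> k / q * (e k - of_int \<lfloor>e k\<rfloor>)"
        unfolding se[symmetric] ck by (simp add: right_diff_distrib)
      have pos: "0 < \<sigma> k / q" using \<sigma>[OF k] q by simp
      have "\<sigma> k / q * 0 \<le> \<sigma> k / q * (e k - of_int \<lfloor>e k\<rfloor>)"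
        using pos by (intro mult_left_mono) auto
      moreover have "\<sigma> k / q * (e k - of_int \<lfloor>e k\<rfloor>) \<le> \<sigma> k / q * 1"
        using pos by (intro mult_left_mono less_imp_le) (linarith, simp)
      ultimately show ?thesis unfolding yk by simp
    qed
    moreover have "y k = undefined" if "\<not> k < n" for k
      using that by (simp add: y addf_def)
    ultimately have "y \<in> (\<Pi>\<^sub>E k\<in>{..<n}. {c f k..c f k + \<sigma> k / q})"
      by (intro PiE_I) auto
    then show "y \<in> (\<Union>f\<in>F. \<Pi>\<^sub>E k\<in>{..<n}. {c f k..c f k + \<sigma> k / q})"
      using fF by blast
  qed
  then have "vol n ((\<lambda>y. addf n b (mvf n A y)) ` abs_hull n p x) \<le> real (card F) * (\<Prod>k<n. \<sigma> k / q)"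
    using \<sigma> q finF by (intro vol_le_cover) (auto intro: less_imp_le)
  also have "\<dots> \<le> (2 ^ 144 * 3 ^ 136) ^ n * (\<Prod>k<n. \<sigma> k / q)"
  proof (rule mult_right_mono)
    \<comment> \<open>Per dimension, the radii contribute 135 + 7 + 2 = 144 and the numbers of
      coordinates 134 + 1 + 1 = 136.\<close>
    have "card F \<le> (2 ^ (n + p) * 3 ^ p) * ((2 ^ (6 * n + n) * 3 ^ n) * (2 ^ (n + n) * 3 ^ n))"
      unfolding F_def card_cartesian_product by (intro mult_mono lat) auto
    also have "\<dots> = 2 ^ (144 * n) * 3 ^ (136 * n)"
    proof -
      have "2 ^ (144 * n) = (2 ^ (n + p) * (2 ^ (6 * n + n) * 2 ^ (n + n)) :: nat)"
        unfolding power_add[symmetric] by (rule arg_cong[where f = "power 2"]) (simp add: p_def)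
      moreover have "3 ^ (136 * n) = (3 ^ p * (3 ^ n * 3 ^ n) :: nat)"
        unfolding power_add[symmetric] by (rule arg_cong[where f = "power 3"]) (simp add: p_def)
      ultimately show ?thesis by (simp only: mult_ac)
    qed
    also have "\<dots> = (2 ^ 144 * 3 ^ 136) ^ n"
      by (simp only: power_mult power_mult_distrib)
    finally have "real (card F) \<le> real ((2 ^ 144 * 3 ^ 136) ^ n)"
      by (rule of_nat_mono)
    then show "real (card F) \<le> (2 ^ 144 * 3 ^ 136) ^ n"
      by (simp only: of_nat_power of_nat_mult of_nat_numeral)
    show "0 \<le> (\<Prod>k<n. \<sigma> k / q)" using \<sigma> q by (intro prod_nonneg) (auto intro: less_imp_le)
  qed
  finally show ?thesis by (simp only: p_def q_def)
qed

text \<open>The arithmetic-geometric mean inequality, from y \<le> exp (y - 1) at y = s_k /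
  a.\<close>

lemma prod_le_power_of_sum_le:
  fixes s :: "nat \<Rightarrow> real"
  assumes "0 < a" "\<And>k. k < n \<Longrightarrow> 0 \<le> s k" "(\<Sum>k<n. s k) \<le> a * real n"
  shows "(\<Prod>k<n. s k) \<le> a ^ n"
proof -
  have "(\<Prod>k<n. s k) \<le> (\<Prod>k<n. a * exp (s k / a - 1))"
  proof (rule prod_mono)
    fix k assume k: "k \<in> {..<n}"
    have "a * (s k / a) \<le> a * exp (s k / a - 1)"
      using exp_ge_add_one_self[of "s k / a - 1"] assms(1) by (intro mult_left_mono) auto
    then show "0 \<le> s k \<and> s k \<le> a * exp (s k / a - 1)"
      using assms(1,2) k by simp
  qed
  also have "\<dots> = a ^ n * exp ((\<Sum>k<n. s k) / a - real n)"
    by (simp add: prod.distrib exp_sum[symmetric] sum_subtractf sum_divide_distrib)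
  also have "\<dots> \<le> a ^ n * 1"
    using assms by (intro mult_left_mono) (auto simp: pos_divide_le_eq mult.commute)
  finally show ?thesis by simp
qed

lemma power_powr_inverse: "0 < x \<Longrightarrow> 1 \<le> n \<Longrightarrow> (x ^ n) powr (1 / real n) = x"
  by (simp add: powr_realpow[symmetric] powr_powr)

text \<open>\<open>A\<close> enters only through the \<open>\<ell>\<^sub>2\<close> norms of its rows: each point
  \<open>\<plusminus>x\<^sub>i\<close> is mapped into \<open>K\<close>, and summing over \<open>i\<close> turns the lower \<open>\<ell>\<^sub>1\<close> estimate for the
  points into a bound for the sum of these norms.\<close>

lemma vol_affine_kashin_hull_le:
  assumes n: "1 \<le> n" and x: "\<And>i k. i < 134 * n \<Longrightarrow> k < n \<Longrightarrow> \<bar>x i k\<bar> \<le> 1"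
    and low: "\<And>t. 8 * real n * L2_set t {..<n} \<le> (\<Sum>i<134 * n. \<bar>\<Sum>k<n. t k * x i k\<bar>)"
    and d: "\<And>k. k < n \<Longrightarrow> 0 < d k"
    and K: "\<And>y. y \<in> abs_hull n (134 * n) x \<Longrightarrow> (\<Sum>k<n. \<bar>addf n b (mvf n A y) k\<bar> / d k) \<le> real n"
  shows "vol n ((\<lambda>y. addf n b (mvf n A y)) ` abs_hull n (134 * n) x)
    \<le> (18 * (2 ^ 144 * 3 ^ 136) / sqrt (real n)) ^ n * (\<Prod>k<n. d k)"
proof -
  define p where "p = 134 * n"
  define t where "t k = (\<lambda>j. A k j / d k)" for k
  \<comment> \<open>Adding 1 keeps \<open>s k\<close> positive. The row norms will add up to at most
    134/8 n, so the \<open>s k\<close> add up to at most 18 n.\<close>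
  define s where "s k = L2_set (t k) {..<n} + 1" for k
  have pt: "(\<lambda>k\<in>{..<n}. \<epsilon> * x i k) \<in> abs_hull n p x" if "i < p" "\<bar>\<epsilon>\<bar> \<le> 1" for i \<epsilon>
  proof -
    define a where "a j = (if j = i then \<epsilon> else 0)" for j
    have aj: "a j * v = (if j = i then \<epsilon> * v else 0)" for j v by (simp add: a_def)
    have "(\<Sum>j<p. \<bar>a j\<bar>) = (\<Sum>j<p. if j = i then \<bar>\<epsilon>\<bar> else 0)"
      by (intro sum.cong) (auto simp: a_def)
    then have "(\<Sum>j<p. \<bar>a j\<bar>) \<le> 1" using that by simp
    then have "(\<lambda>k\<in>{..<n}. \<Sum>j<p. a j * x j k) \<in> abs_hull n p x" by (rule abs_hullI)
    also have "(\<lambda>k\<in>{..<n}. \<Sum>j<p. a j * x j k) = (\<lambda>k\<in>{..<n}. \<epsilon> * x i k)"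
      using that(1) by (intro restrict_ext) (simp add: aj)
    finally show ?thesis .
  qed
  have row: "(\<Sum>k<n. \<bar>\<Sum>j<n. t k j * x i j\<bar>) \<le> real n" if i: "i < p" for i
  proof -
    define g where "g k = (\<Sum>j<n. A k j * x i j)" for k
    have val: "addf n b (mvf n A (\<lambda>k\<in>{..<n}. \<epsilon> * x i k)) k = b k + \<epsilon> * g k" if "k < n" for k \<epsilon>
      using that by (simp add: addf_def mvf_def g_def sum_distrib_left mult_ac)
    have "(\<Sum>k<n. \<bar>b k + g k\<bar> / d k) \<le> real n"
    proof -
      have "(\<Sum>k<n. \<bar>b k + g k\<bar> / d k) = (\<Sum>k<n. \<bar>addf n b (mvf n A (\<lambda>k\<in>{..<n}. 1 * x i k)) k\<bar> / d k)"
        by (intro sum.cong refl) (simp only: val lessThan_iff, simp)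
      also have "\<dots> \<le> real n" using pt[OF i, of 1] by (intro K) (simp add: p_def)
      finally show ?thesis .
    qed
    moreover have "(\<Sum>k<n. \<bar>b k - g k\<bar> / d k) \<le> real n"
    proof -
      have "(\<Sum>k<n. \<bar>b k - g k\<bar> / d k) = (\<Sum>k<n. \<bar>addf n b (mvf n A (\<lambda>k\<in>{..<n}. (-1) * x i k)) k\<bar> / d k)"
        by (intro sum.cong refl) (simp only: val lessThan_iff, simp)
      also have "\<dots> \<le> real n" using pt[OF i, of "-1"] by (intro K) (simp add: p_def)
      finally show ?thesis .
    qed
    \<comment> \<open>Using both x_i and its negative eliminates the translation: 2 |g| \<le> |b +
      g| + |b - g|.\<close>
    moreover have "2 * (\<Sum>k<n. \<bar>g k\<bar> / d k) \<le> (\<Sum>k<n. \<bar>b k + g k\<bar> / d k) + (\<Sum>k<n. \<bar>b k - g k\<bar> / d k)"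
      unfolding sum_distrib_left sum.distrib[symmetric]
    proof (rule sum_mono)
      fix k assume k: "k \<in> {..<n}"
      have "(2 * \<bar>g k\<bar>) / d k \<le> (\<bar>b k + g k\<bar> + \<bar>b k - g k\<bar>) / d k"
        using d[of k] k by (intro divide_right_mono) auto
      then show "2 * (\<bar>g k\<bar> / d k) \<le> \<bar>b k + g k\<bar> / d k + \<bar>b k - g k\<bar> / d k"
        by (simp add: add_divide_distrib)
    qed
    moreover have "(\<Sum>k<n. \<bar>\<Sum>j<n. t k j * x i j\<bar>) = (\<Sum>k<n. \<bar>g k\<bar> / d k)"
    proof (intro sum.cong refl)
      fix k assume k: "k \<in> {..<n}"
      have "(\<Sum>j<n. t k j * x i j) = g k / d k" by (simp add: t_def g_def sum_divide_distrib)
      then show "\<bar>\<Sum>j<n. t k j * x i j\<bar> = \<bar>g k\<bar> / d k" using d[of k] k by (simp add: abs_divide)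
    qed
    ultimately show ?thesis by linarith
  qed
  have "8 * real n * (\<Sum>k<n. L2_set (t k) {..<n}) \<le> (\<Sum>k<n. \<Sum>i<p. \<bar>\<Sum>j<n. t k j * x i j\<bar>)"
    unfolding sum_distrib_left p_def by (intro sum_mono low)
  also have "\<dots> = (\<Sum>i<p. \<Sum>k<n. \<bar>\<Sum>j<n. t k j * x i j\<bar>)" by (rule sum.swap)
  also have "\<dots> \<le> (\<Sum>i<p. real n)" using row by (intro sum_mono) auto
  also have "\<dots> = 8 * real n * (134 / 8 * real n)" by (simp add: p_def)
  finally have "(\<Sum>k<n. L2_set (t k) {..<n}) \<le> 134 / 8 * real n"
    using n by (subst (asm) mult_le_cancel_left_pos) auto
  then have "(\<Sum>k<n. s k) \<le> 18 * real n" by (simp add: s_def sum.distrib)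
  then have s18: "(\<Prod>k<n. s k) \<le> 18 ^ n"
    by (intro prod_le_power_of_sum_le) (auto simp: s_def intro: add_nonneg_nonneg)
  have s1: "0 < s k" for k by (simp add: s_def add_nonneg_pos)
  have "vol n ((\<lambda>y. addf n b (mvf n A y)) ` abs_hull n (134 * n) x)
      \<le> (2 ^ 144 * 3 ^ 136) ^ n * (\<Prod>k<n. (d k * s k) / sqrt (real n))"
  proof (rule vol_affine_abs_hull_le[OF n x])
    show "0 < d k * s k" if "k < n" for k using d[OF that] s1 by simp
    show "L2_set (A k) {..<n} \<le> d k * s k" if "k < n" for k
    proof -
      have "L2_set (A k) {..<n} = L2_set (\<lambda>j. d k * t k j) {..<n}"
        using d[OF that] by (intro L2_set_cong) (auto simp: t_def)
      also have "\<dots> = d k * L2_set (t k) {..<n}"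
        using d[OF that] by (intro L2_set_right_distrib[symmetric]) auto
      also have "\<dots> \<le> d k * s k"
        using d[OF that] by (intro mult_left_mono) (auto simp: s_def)
      finally show ?thesis .
    qed
  qed
  also have "(\<Prod>k<n. (d k * s k) / sqrt (real n)) = (\<Prod>k<n. d k) * (\<Prod>k<n. s k) / sqrt (real n) ^ n"
    by (simp add: prod_dividef prod.distrib)
  also have "(2 ^ 144 * 3 ^ 136) ^ n * ((\<Prod>k<n. d k) * (\<Prod>k<n. s k) / sqrt (real n) ^ n)
      \<le> (2 ^ 144 * 3 ^ 136) ^ n * ((\<Prod>k<n. d k) * 18 ^ n / sqrt (real n) ^ n)"
    using s18 d by (intro divide_right_mono mult_left_mono prod_nonneg) (auto intro: less_imp_le)
  finally show ?thesis
    by (simp only: power_divide power_mult_distrib times_divide_eq_right times_divide_eq_left mult_ac)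
qed

lemma lvr_ge_sqrt:
  "\<exists>c>0. \<forall>n\<ge>1. \<forall>K. convex_body n K \<and> unconditional n K \<longrightarrow> ereal (c * sqrt (real n)) \<le> lvr n K"
proof -
  \<comment> \<open>\<open>K\<close> has volume at least 2^n times the product of the d_k, an image
    of the hull at most (C / sqrt n)^n times that product; hence the constant 2 / C.\<close>
  define C :: real where "C = 18 * (2 ^ 144 * 3 ^ 136)"
  have C: "C > 0" by (simp add: C_def)
  have "ereal (2 / C * sqrt (real n)) \<le> lvr n K" if n: "1 \<le> n" and K: "convex_body n K" "unconditional n K" for n K
  proof -
    obtain d where d: "\<And>k. k < n \<Longrightarrow> 0 < d k"
      and box: "\<And>y. y \<in> Rn n \<Longrightarrow> (\<forall>k<n. \<bar>y k\<bar> \<le> d k) \<Longrightarrow> y \<in> K"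
      and l1: "\<And>y. y \<in> K \<Longrightarrow> (\<Sum>k<n. \<bar>y k\<bar> / d k) \<le> real n"
      using unconditional_position[OF K] by blast
    have comp: "compactin (powertop_real {..<n}) K" using K(1) by (simp add: convex_body_def)
    have D: "(\<Prod>k<n. d k) > 0" using d by (intro prod_pos) auto
    have volK: "2 ^ n * (\<Prod>k<n. d k) \<le> vol n K" by (rule vol_ge_cuboid[OF comp d box])
    obtain x :: "nat \<Rightarrow> nat \<Rightarrow> real" where x: "\<And>i k. i < 134 * n \<Longrightarrow> k < n \<Longrightarrow> \<bar>x i k\<bar> \<le> 1"
      "\<And>i k. i < n \<Longrightarrow> k < n \<Longrightarrow> x i k = idf i k"
      "\<And>t. 8 * real n * L2_set t {..<n} \<le> (\<Sum>i<134 * n. \<bar>\<Sum>k<n. t k * x i k\<bar>)"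
      using ex_kashin_points[OF n] by blast
    define L where "L = abs_hull n (134 * n) x"
    have L: "convex_body n L" unfolding L_def using n x(2) by (intro convex_body_abs_hull) auto
    then have compL: "compactin (powertop_real {..<n}) L" by (simp add: convex_body_def)
    have LR: "L \<subseteq> Rn n" using compactin_subset_topspace[OF compL] by simp
    have "ereal (2 / C * sqrt (real n)) \<le> vr n K L"
      unfolding vr_def
    proof (rule INF_greatest)
      fix T assume "T \<in> {T. invertible_affine n T \<and> T ` L \<subseteq> K}"
      then have T: "invertible_affine n T" "T ` L \<subseteq> K" by auto
      obtain A b where A: "detn n A \<noteq> 0" and TA: "\<And>y. y \<in> Rn n \<Longrightarrow> T y = addf n b (mvf n A y)"
        using invertible_affine_detn[OF T(1)] by metis
      have TL: "T ` L = (\<lambda>y. addf n b (mvf n A y)) ` L"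
        using LR TA by (intro image_cong) auto
      have pos: "vol n (T ` L) > 0"
        unfolding TL vol_image[OF compL A] using A convex_body_vol_pos[OF L] by simp
      have "vol n ((\<lambda>y. addf n b (mvf n A y)) ` abs_hull n (134 * n) x)
          \<le> (18 * (2 ^ 144 * 3 ^ 136) / sqrt (real n)) ^ n * (\<Prod>k<n. d k)"
      proof (rule vol_affine_kashin_hull_le[OF n x(1) x(3) d])
        fix y assume "y \<in> abs_hull n (134 * n) x"
        then have "y \<in> L" by (simp add: L_def)
        then have "addf n b (mvf n A y) \<in> K" using T(2) TL by blast
        then show "(\<Sum>k<n. \<bar>addf n b (mvf n A y) k\<bar> / d k) \<le> real n" by (rule l1)
      qed
      then have le: "vol n (T ` L) \<le> (C / sqrt (real n)) ^ n * (\<Prod>k<n. d k)"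
        unfolding TL by (simp only: C_def L_def)
      have q: "sqrt (real n) > 0" using n by simp
      have "(2 / C * sqrt (real n)) ^ n * vol n (T ` L)
          \<le> (2 / C * sqrt (real n)) ^ n * ((C / sqrt (real n)) ^ n * (\<Prod>k<n. d k))"
        using le C by (intro mult_left_mono) auto
      also have "\<dots> = ((2 / C * sqrt (real n)) * (C / sqrt (real n))) ^ n * (\<Prod>k<n. d k)"
        by (simp only: power_mult_distrib mult.assoc)
      also have "(2 / C * sqrt (real n)) * (C / sqrt (real n)) = 2" using C q by simp
      also note volK
      finally have "(2 / C * sqrt (real n)) ^ n \<le> vol n K / vol n (T ` L)"
        using pos by (simp add: pos_le_divide_eq)
      then have "((2 / C * sqrt (real n)) ^ n) powr (1 / real n) \<le> (vol n K / vol n (T ` L)) powr (1 / real n)"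
        using C q by (intro powr_mono2) auto
      then show "ereal (2 / C * sqrt (real n)) \<le> ereal ((vol n K / vol n (T ` L)) powr (1 / real n))"
        using power_powr_inverse[of "2 / C * sqrt (real n)" n] C q n by simp
    qed
    also have "vr n K L \<le> lvr n K"
      unfolding lvr_def using L by (intro SUP_upper) auto
    finally show ?thesis .
  qed
  moreover have "2 / C > 0" using C by simp
  ultimately show ?thesis by blast
qed

section \<open>Almost maximal Gram determinants\<close>

text \<open>This is the n x n matrix M, the sum of the u_j u_j^T, whose quadratic form is the sum of
  the (u_j . x)^2; it is not the N x N matrix of inner products.\<close>

definition gram :: "nat \<Rightarrow> (nat \<Rightarrow> nat \<Rightarrow> real) \<Rightarrow> nat \<Rightarrow> nat \<Rightarrow> real" where
  "gram N u = (\<lambda>i k. \<Sum>j<N. u j i * u j k)"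

definition dotn :: "nat \<Rightarrow> (nat \<Rightarrow> real) \<Rightarrow> (nat \<Rightarrow> real) \<Rightarrow> real" where
  "dotn n x y = (\<Sum>i<n. x i * y i)"

lemma sum_dotn_mult:
  "(\<Sum>j<N. dotn n (u j) x * dotn n (u j) y) = dotn n x (\<lambda>i. \<Sum>k<n. gram N u i k * y k)"
proof -
  have "(\<Sum>j<N. dotn n (u j) x * dotn n (u j) y) = (\<Sum>j<N. \<Sum>i<n. \<Sum>k<n. x i * (u j i * u j k * y k))"
    by (simp add: dotn_def sum_product mult_ac)
  also have "\<dots> = (\<Sum>i<n. \<Sum>j<N. \<Sum>k<n. x i * (u j i * u j k * y k))"
    by (rule sum.swap)
  also have "\<dots> = (\<Sum>i<n. \<Sum>k<n. \<Sum>j<N. x i * (u j i * u j k * y k))"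
    by (rule sum.cong[OF refl], rule sum.swap)
  also have "\<dots> = dotn n x (\<lambda>i. \<Sum>k<n. gram N u i k * y k)"
    unfolding dotn_def gram_def by (simp only: sum_distrib_left sum_distrib_right)
  finally show ?thesis .
qed

text \<open>A crude bound that serves to make a supremum of determinants finite.\<close>

lemma abs_detn_le:
  assumes "\<And>i k. i < n \<Longrightarrow> k < n \<Longrightarrow> \<bar>A i k\<bar> \<le> B"
  shows "\<bar>detn n A\<bar> \<le> fact n * B ^ n"
proof -
  have "\<bar>detn n A\<bar> \<le> (\<Sum>p | p permutes {..<n}. \<bar>of_int (sign p) * (\<Prod>i<n. A i (p i))\<bar>)"
    unfolding detn_leibniz by (rule sum_abs)
  also have "\<dots> \<le> (\<Sum>p | p permutes {..<n}. B ^ n)"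
  proof (rule sum_mono)
    fix p assume "p \<in> {p. p permutes {..<n}}"
    then have p: "p i < n" if "i < n" for i
      using permutes_in_image[of p "{..<n}" i] that by simp
    have "\<bar>of_int (sign p) * (\<Prod>i<n. A i (p i))\<bar> = (\<Prod>i<n. \<bar>A i (p i)\<bar>)"
      by (simp add: abs_mult abs_prod sign_def)
    also have "\<dots> \<le> (\<Prod>i<n. B)"
      using assms p by (intro prod_mono) auto
    finally show "\<bar>of_int (sign p) * (\<Prod>i<n. A i (p i))\<bar> \<le> B ^ n" by simp
  qed
  also have "\<dots> = fact n * B ^ n" by (simp add: card_permutations[OF refl])
  finally show ?thesis .
qed

text \<open>The supremum of the determinants is finite because \<open>P\<close> is bounded and
  positive because of \<open>w\<close>, so some value exceeds half of it.\<close>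

lemma ex_almost_max_gram:
  assumes P: "\<And>u i. u \<in> P \<Longrightarrow> i < n \<Longrightarrow> \<bar>u i\<bar> \<le> R"
    and w: "\<And>j. j < N \<Longrightarrow> w j \<in> P" "detn n (gram N w) > 0"
  shows "\<exists>u. (\<forall>j<N. u j \<in> P) \<and> detn n (gram N u) > 0 \<and>
    (\<forall>u'. (\<forall>j<N. u' j \<in> P) \<longrightarrow> detn n (gram N u') \<le> 2 * detn n (gram N u))"
proof -
  define S where "S = (\<lambda>u. detn n (gram N u)) ` {u. \<forall>j<N. u j \<in> P}"
  have wS: "detn n (gram N w) \<in> S" using w(1) by (auto simp: S_def)
  have "detn n (gram N u) \<le> fact n * (real N * (R * R)) ^ n" if u: "\<forall>j<N. u j \<in> P" for u
  proof -
    have "\<bar>gram N u i k\<bar> \<le> real N * (R * R)" if ik: "i < n" "k < n" for i k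
    proof -
      have "\<bar>gram N u i k\<bar> \<le> (\<Sum>j<N. \<bar>u j i * u j k\<bar>)"
        unfolding gram_def by (rule sum_abs)
      also have "\<dots> \<le> (\<Sum>j<N. R * R)"
      proof (rule sum_mono)
        fix j assume "j \<in> {..<N}"
        then have "\<bar>u j i\<bar> \<le> R" "\<bar>u j k\<bar> \<le> R" using P u ik by auto
        then show "\<bar>u j i * u j k\<bar> \<le> R * R" unfolding abs_mult by (intro mult_mono) auto
      qed
      finally show ?thesis by simp
    qed
    then have "\<bar>detn n (gram N u)\<bar> \<le> fact n * (real N * (R * R)) ^ n" by (rule abs_detn_le)
    then show ?thesis by linarith
  qed
  then have bdd: "bdd_above S" by (auto simp: S_def bdd_above_def)
  have "detn n (gram N w) \<le> Sup S" by (rule cSup_upper[OF wS bdd])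
  then have "Sup S > 0" using w(2) by linarith
  then have "Sup S / 2 < Sup S" by simp
  then obtain s where s: "s \<in> S" "Sup S / 2 < s"
    using less_cSupD[of S "Sup S / 2"] wS by blast
  then obtain u where u: "\<forall>j<N. u j \<in> P" "s = detn n (gram N u)" by (auto simp: S_def)
  have "detn n (gram N u') \<le> 2 * detn n (gram N u)" if "\<forall>j<N. u' j \<in> P" for u'
  proof -
    have "detn n (gram N u') \<in> S" using that by (auto simp: S_def)
    then have "detn n (gram N u') \<le> Sup S" by (rule cSup_upper[OF _ bdd])
    then show ?thesis using s(2) u(2) by linarith
  qed
  moreover have "detn n (gram N u) > 0" using s(2) u(2) \<open>Sup S > 0\<close> by linarith
  ultimately show ?thesis using u(1) by blast
qed

text \<open>By Cauchy--Binet both sides are sums of squared minors, and a further vector only adds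
  terms.\<close>

lemma detn_gram_mono:
  "detn n (gram N u) \<le> detn n (gram (Suc N) u)"
proof -
  have "(\<Sum>f \<in> {..<n} \<rightarrow>\<^sub>E {..<N}. (detn n (\<lambda>i. u (f i)))\<^sup>2) \<le> (\<Sum>f \<in> {..<n} \<rightarrow>\<^sub>E {..<Suc N}. (detn n (\<lambda>i. u (f i)))\<^sup>2)"
    by (intro sum_mono2 finite_PiE PiE_mono) auto
  then have "fact n * detn n (gram N u) \<le> fact n * detn n (gram (Suc N) u)"
    by (simp only: sum_detn_square finite_lessThan gram_def)
  then show ?thesis by simp
qed

text \<open>The optimality of \<open>u\<close> for the replacement of each single \<open>u\<^sub>j\<close> by \<open>v\<close> bounds the leverages
  \<open>u\<^sub>j\<^sup>T M'\<^sup>-\<^sup>1 u\<^sub>j\<close> from below, where \<open>M' = M + v v\<^sup>T\<close>; as the leverages of all \<open>2 n + 1\<close>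
  vectors add up to \<open>n\<close>, that of \<open>v\<close> is at most \<open>3 / 4\<close>.\<close>

lemma almost_max_gram_polar:
  fixes u :: "nat \<Rightarrow> nat \<Rightarrow> real"
  assumes pos: "detn n (gram (2 * n) u) > 0"
    and opt: "\<And>j. j < 2 * n \<Longrightarrow> detn n (gram (2 * n) (u(j := v))) \<le> 2 * detn n (gram (2 * n) u)"
  shows "(dotn n v x)\<^sup>2 \<le> 3 * (\<Sum>j<2 * n. (dotn n (u j) x)\<^sup>2)"
proof -
  define N where "N = 2 * n"
  define u' where "u' = u(N := v)"
  define M where "M = gram N u"
  define M' where "M' = gram (Suc N) u'"
  have gM: "gram N u' = M" by (intro ext) (simp add: gram_def u'_def M_def)
  have M': "M' i k = M i k + v i * v k" for i k
    using gM by (simp add: M'_def gram_def u'_def fun_eq_iff)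
  have Msym: "M i k = M k i" for i k by (simp add: M_def gram_def mult.commute)
  have posM: "detn n M > 0" using pos by (simp add: M_def N_def)
  have "detn n M \<le> detn n M'" using detn_gram_mono[of n N u'] by (simp add: gM M'_def)
  then have pos': "detn n M' > 0" using posM by linarith
  obtain Y where Y: "\<And>i j. i < n \<Longrightarrow> j < n \<Longrightarrow> mulf n M' Y i j = idf i j"
    "\<And>i j. i < n \<Longrightarrow> j < n \<Longrightarrow> mulf n Y M' i j = idf i j"
    using detn_inverse[of n M'] pos' by (metis less_irrefl)
  define lev where "lev w = (\<Sum>i<n. w i * (\<Sum>k<n. Y i k * w k))" for w
  have det: "detn n (\<lambda>i k. M' i k - w i * w k) = detn n M' * (1 - lev w)" for w
    unfolding lev_def by (rule detn_minus_rank_one[OF Y(1)])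
  define s where "s = lev v"
  have detM: "detn n M = detn n M' * (1 - s)"
    using det[of v] detn_cong[of n "\<lambda>i k. M' i k - v i * v k" M] by (simp add: M' s_def)
  \<comment> \<open>Exchanging u_j for \<open>v\<close> turns M into M' - u_j u_j^T, while M itself
    is M' - v v^T; near-optimality thus compares two rank-one reductions of M'.\<close>
  have le: "detn n M' * (1 - lev (u j)) \<le> 2 * (detn n M' * (1 - s))" if j: "j < N" for j
  proof -
    have "gram N (u(j := v)) i k = M' i k - u j i * u j k" for i k
    proof -
      have "(\<Sum>l<N. f l) = f j + (\<Sum>l\<in>{..<N}-{j}. f l)" for f :: "nat \<Rightarrow> real"
        using j by (intro sum.remove) auto
      moreover have "(\<Sum>l\<in>{..<N}-{j}. (u(j := v)) l i * (u(j := v)) l k) = (\<Sum>l\<in>{..<N}-{j}. u l i * u l k)"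
        by (intro sum.cong) auto
      ultimately show ?thesis unfolding M' M_def gram_def by simp
    qed
    then have "detn n (gram N (u(j := v))) = detn n M' * (1 - lev (u j))"
      using det[of "u j"] detn_cong[of n "gram N (u(j := v))" "\<lambda>i k. M' i k - u j i * u j k"] by simp
    then show ?thesis
      using opt[of j] j detM by (simp add: N_def M_def)
  qed
  \<comment> \<open>The leverages of the u_j add up to tr (Y M) = tr (Y M') - s, and
    \<open>Y\<close> is the inverse of \<open>M'\<close>.\<close>
  have tr: "(\<Sum>j<N. lev (u j)) = real n - s"
  proof -
    have "(\<Sum>j<N. lev (u j)) = (\<Sum>j<N. \<Sum>i<n. \<Sum>k<n. Y i k * (u j i * u j k))"
      by (simp add: lev_def sum_distrib_left mult_ac)
    also have "\<dots> = (\<Sum>i<n. \<Sum>j<N. \<Sum>k<n. Y i k * (u j i * u j k))" by (rule sum.swap)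
    also have "\<dots> = (\<Sum>i<n. \<Sum>k<n. \<Sum>j<N. Y i k * (u j i * u j k))"
      by (rule sum.cong[OF refl], rule sum.swap)
    also have "\<dots> = (\<Sum>i<n. \<Sum>k<n. Y i k * M i k)"
      by (simp only: M_def gram_def sum_distrib_left)
    also have "\<dots> = (\<Sum>i<n. (\<Sum>k<n. Y i k * M' k i) - v i * (\<Sum>k<n. Y i k * v k))"
    proof (intro sum.cong refl)
      fix i
      have "(\<Sum>k<n. Y i k * M i k) = (\<Sum>k<n. Y i k * M' k i - v i * (Y i k * v k))"
        by (rule sum.cong[OF refl]) (simp add: M' Msym[of _ i] algebra_simps)
      then show "(\<Sum>k<n. Y i k * M i k) = (\<Sum>k<n. Y i k * M' k i) - v i * (\<Sum>k<n. Y i k * v k)"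
        by (simp add: sum_subtractf sum_distrib_left)
    qed
    also have "\<dots> = (\<Sum>i<n. mulf n Y M' i i) - s"
      by (simp add: sum_subtractf mulf_def s_def lev_def)
    also have "(\<Sum>i<n. mulf n Y M' i i) = (\<Sum>i<n. 1)"
      using Y(2) by (intro sum.cong) (auto simp: idf_def)
    finally show ?thesis by simp
  qed
  have "detn n M' * (real n + s) = (\<Sum>j<N. detn n M' * (1 - lev (u j)))"
    unfolding sum_distrib_left[symmetric] sum_subtractf tr by (simp add: N_def)
  also have "\<dots> \<le> (\<Sum>j<N. 2 * (detn n M' * (1 - s)))"
    using le by (intro sum_mono) auto
  also have "\<dots> = detn n M' * (4 * real n * (1 - s))" by (simp add: N_def)
  finally have "real n + s \<le> 4 * real n * (1 - s)"
    using pos' by (simp only: mult_le_cancel_left_pos)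
  then have "s * (4 * real n + 1) \<le> 3 / 4 * (4 * real n + 1)" by (simp add: algebra_simps)
  then have s34: "s \<le> 3 / 4" by (subst (asm) mult_le_cancel_right) auto
  \<comment> \<open>\<open>a\<close> solves M' a = v: the sum of the products (u'_j . x) (u'_j . a)
    is v . x, and that of the (u'_j . a)^2 is the leverage s, so Cauchy--Schwarz applies.\<close>
  define a where "a i = (\<Sum>k<n. Y i k * v k)" for i
  have Ma: "(\<Sum>k<n. M' i k * a k) = v i" if "i < n" for i
  proof -
    have "(\<Sum>k<n. M' i k * a k) = (\<Sum>k<n. \<Sum>j<n. M' i k * Y k j * v j)"
      by (simp add: a_def sum_distrib_left mult.assoc)
    also have "\<dots> = (\<Sum>j<n. \<Sum>k<n. M' i k * Y k j * v j)" by (rule sum.swap)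
    also have "\<dots> = (\<Sum>j<n. mulf n M' Y i j * v j)" by (simp add: mulf_def sum_distrib_right)
    also have "\<dots> = (\<Sum>j<n. idf i j * v j)" using Y(1) that by (intro sum.cong) auto
    finally show ?thesis using that by (simp add: sum_idf_mult)
  qed
  have bil: "(\<Sum>j<Suc N. dotn n (u' j) y * dotn n (u' j) a) = dotn n y v" for y
    unfolding sum_dotn_mult M'_def[symmetric] unfolding dotn_def
    by (intro sum.cong) (auto simp: Ma)
  have sa: "(\<Sum>j<Suc N. (dotn n (u' j) a)\<^sup>2) = s"
    using bil[of a] by (simp only: power2_eq_square) (simp add: s_def lev_def a_def dotn_def mult.commute)
  define q where "q = (\<Sum>j<N. (dotn n (u j) x)\<^sup>2)"
  have qx: "(\<Sum>j<Suc N. (dotn n (u' j) x)\<^sup>2) = q + (dotn n v x)\<^sup>2"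
    by (simp add: q_def u'_def)
  have "(dotn n v x)\<^sup>2 = (\<Sum>j<Suc N. dotn n (u' j) x * dotn n (u' j) a)\<^sup>2"
    unfolding bil by (simp add: dotn_def mult.commute)
  also have "\<dots> \<le> (\<Sum>j<Suc N. (dotn n (u' j) x)\<^sup>2) * (\<Sum>j<Suc N. (dotn n (u' j) a)\<^sup>2)"
    by (rule Cauchy_Schwarz_ineq_sum)
  also have "\<dots> = (q + (dotn n v x)\<^sup>2) * s" unfolding qx sa ..
  also have "\<dots> \<le> (q + (dotn n v x)\<^sup>2) * (3 / 4)"
    using s34 by (intro mult_left_mono add_nonneg_nonneg) (auto simp: q_def intro: sum_nonneg)
  finally have "(dotn n v x)\<^sup>2 \<le> (q + (dotn n v x)\<^sup>2) * (3 / 4)" .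
  moreover have "X \<le> 3 * q" if "X \<le> (q + X) * (3 / 4)" for X
    using that by (simp add: field_simps)
  ultimately have "(dotn n v x)\<^sup>2 \<le> 3 * q" by blast
  then show ?thesis by (simp add: q_def N_def)
qed

text \<open>Averaging: the N^n squared minors add up to n! det M, so one of them is at least the
  mean.\<close>

lemma ex_large_minor:
  assumes "detn n (gram N u) > 0"
  shows "\<exists>f \<in> {..<n} \<rightarrow>\<^sub>E {..<N}. fact n * detn n (gram N u) \<le> real (N ^ n) * (detn n (\<lambda>i. u (f i)))\<^sup>2"
proof (rule ccontr)
  let ?F = "{..<n} \<rightarrow>\<^sub>E {..<N}"
  assume "\<not> ?thesis"
  then have lt: "real (N ^ n) * (detn n (\<lambda>i. u (f i)))\<^sup>2 < fact n * detn n (gram N u)" if "f \<in> ?F" for f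
    using that by force
  have sq: "(\<Sum>f\<in>?F. (detn n (\<lambda>i. u (f i)))\<^sup>2) = fact n * detn n (gram N u)"
    by (simp only: sum_detn_square finite_lessThan gram_def)
  have card: "card ?F = N ^ n" by (simp add: card_PiE)
  have fin: "finite ?F" by (intro finite_PiE) auto
  have ne: "?F \<noteq> {}"
  proof
    assume "?F = {}"
    then have "fact n * detn n (gram N u) = 0" using sq by (simp only: sum.empty)
    then show False using assms by simp
  qed
  have "real (N ^ n) * (\<Sum>f\<in>?F. (detn n (\<lambda>i. u (f i)))\<^sup>2) < (\<Sum>f\<in>?F. fact n * detn n (gram N u))"
    unfolding sum_distrib_left by (rule sum_strict_mono[OF fin ne lt])
  then show False unfolding sq by (simp add: card)
qed

text \<open>Swapping two equal rows leaves the matrix unchanged but reverses the sign. Distinct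
  indices later make a sum over the selected vectors a partial sum over all u_j.\<close>

lemma detn_rows_inj:
  assumes "detn n (\<lambda>i. u (f i)) \<noteq> 0"
  shows "inj_on f {..<n}"
proof (rule inj_onI, rule ccontr)
  fix i j assume ij: "i \<in> {..<n}" "j \<in> {..<n}" "f i = f j" "i \<noteq> j"
  let ?p = "Transposition.transpose i j"
  have p: "?p permutes {..<n}" using ij by (intro permutes_swap_id) auto
  have "f (?p k) = f k" for k using ij(3) by (simp add: Transposition.transpose_def)
  then have "detn n (\<lambda>k. u (f k)) = of_int (sign ?p) * detn n (\<lambda>k. u (f k))"
    using detn_permute_rows[OF p, of "\<lambda>k. u (f k)"] by simp
  then show False using assms ij(4) by (simp add: sign_swap_id)
qed

section \<open>The upper estimate\<close>

lemma dotn_diff_right: "dotn n u (\<lambda>i. x i - y i) = dotn n u x - dotn n u y"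
  by (simp add: dotn_def right_diff_distrib sum_subtractf)

text \<open>The bipolar theorem for L - L. Let a0 - b0 be the point of L - L nearest to x and w = x
  - (a0 - b0). The functional w attains its maximum g over L - L at a0 - b0; if w is non-zero, then
  w / g lies in the polar body but takes the value (|w|^2 + g) / g > 1 at x.\<close>

lemma difference_body_separation:
  assumes L: "convex_body n L"
    and x: "\<And>u. (\<And>a b. a \<in> L \<Longrightarrow> b \<in> L \<Longrightarrow> dotn n u a - dotn n u b \<le> 1) \<Longrightarrow> dotn n u x \<le> 1"
  shows "\<exists>a\<in>L. \<exists>b\<in>L. \<forall>i<n. x i = a i - b i"
proof -
  let ?X = "powertop_real {..<n}"
  have comp: "compactin ?X L" and conv: "convex_Rn n L" using L by (auto simp: convex_body_def)
  obtain p r where p: "p \<in> L" "r > 0" "\<And>y. y \<in> Rn n \<Longrightarrow> (\<forall>i<n. \<bar>y i - p i\<bar> \<le> r) \<Longrightarrow> y \<in> L"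
    using convex_body_cube[OF L] by blast
  define F where "F z = (\<Sum>i<n. (x i - (fst z i - snd z i))\<^sup>2)" for z :: "(nat \<Rightarrow> real) \<times> (nat \<Rightarrow> real)"
  have c1: "continuous_map (prod_topology ?X ?X) euclideanreal (\<lambda>z. fst z i)" if "i < n" for i
    using continuous_map_compose[OF continuous_map_fst continuous_map_product_projection[of i "{..<n}" "\<lambda>_. euclideanreal"], of ?X] that
    by (simp add: comp_def)
  have c2: "continuous_map (prod_topology ?X ?X) euclideanreal (\<lambda>z. snd z i)" if "i < n" for i
    using continuous_map_compose[OF continuous_map_snd continuous_map_product_projection[of i "{..<n}" "\<lambda>_. euclideanreal"], of ?X] that
    by (simp add: comp_def)
  have "continuous_map (prod_topology ?X ?X) euclideanreal F"
    unfolding F_def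
    by (intro continuous_map_sum continuous_map_real_pow continuous_map_diff c1 c2) auto
  moreover have "compactin (prod_topology ?X ?X) (L \<times> L)"
    using comp by (simp add: compactin_Times)
  ultimately have "compactin euclideanreal (F ` (L \<times> L))" by (rule image_compactin[rotated])
  then have "compact (F ` (L \<times> L))" by simp
  moreover have "F ` (L \<times> L) \<noteq> {}" using p(1) by auto
  ultimately obtain z where z: "z \<in> L \<times> L" "\<And>y. y \<in> L \<times> L \<Longrightarrow> F z \<le> F y"
    using compact_attains_inf[of "F ` (L \<times> L)"] by blast
  obtain a0 b0 where z0: "z = (a0, b0)" by (cases z)
  have ab0: "a0 \<in> L" "b0 \<in> L" using z(1) z0 by auto
  have min: "(\<Sum>i<n. (x i - (a0 i - b0 i))\<^sup>2) \<le> (\<Sum>i<n. (x i - (a i - b i))\<^sup>2)" if "a \<in> L" "b \<in> L" for a b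
    using z(2)[of "(a, b)"] that by (simp add: F_def z0)
  define w where "w i = x i - (a0 i - b0 i)" for i
  define e where "e = (\<Sum>i<n. (w i)\<^sup>2)"
  have e0: "0 \<le> e" by (simp add: e_def sum_nonneg)
  show ?thesis
  proof (cases "e = 0")
    case True
    then have "\<forall>i\<in>{..<n}. (w i)\<^sup>2 = 0" unfolding e_def by (subst (asm) sum_nonneg_eq_0_iff) auto
    then have "\<forall>i<n. x i = a0 i - b0 i" by (simp add: w_def)
    then show ?thesis using ab0 by blast
  next
    case False
    define g where "g = dotn n w a0 - dotn n w b0"
    have sup: "dotn n w a - dotn n w b \<le> g" if ab: "a \<in> L" "b \<in> L" for a b
    proof (rule ccontr)
      define \<delta> where "\<delta> i = (a i - b i) - (a0 i - b0 i)" for i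
      define c where "c = dotn n w \<delta>"
      define S where "S = (\<Sum>i<n. (\<delta> i)\<^sup>2)"
      have cg: "c = dotn n w a - dotn n w b - g"
        by (simp add: c_def \<delta>_def[abs_def] dotn_diff_right g_def)
      assume "\<not> dotn n w a - dotn n w b \<le> g"
      then have c: "c > 0" using cg by simp
      have S: "S \<ge> 0" by (simp add: S_def sum_nonneg)
      \<comment> \<open>So short a step from a0 - b0 towards a - b would reduce the distance to x:
        the linear gain 2 t c beats the quadratic loss t^2 S.\<close>
      define t where "t = min 1 (c / (S + 1))"
      have t: "0 < t" "t \<le> 1" using c S by (auto simp: t_def)
      have "t * (S + 1) \<le> c / (S + 1) * (S + 1)"
        using S by (intro mult_right_mono) (auto simp: t_def)
      then have tS: "t * (S + 1) \<le> c" using S by simp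
      have "e \<le> (\<Sum>i<n. (x i - ((\<lambda>i\<in>{..<n}. (1 - t) * a0 i + t * a i) i - (\<lambda>i\<in>{..<n}. (1 - t) * b0 i + t * b i) i))\<^sup>2)"
        unfolding e_def w_def using t ab ab0 by (intro min convex_RnD[OF conv]) auto
      also have "\<dots> = (\<Sum>i<n. (w i)\<^sup>2 - 2 * t * (w i * \<delta> i) + t\<^sup>2 * (\<delta> i)\<^sup>2)"
        by (intro sum.cong refl) (simp add: w_def \<delta>_def power2_eq_square algebra_simps)
      also have "\<dots> = e - 2 * t * c + t\<^sup>2 * S"
        by (simp add: sum.distrib sum_subtractf sum_distrib_left e_def c_def S_def dotn_def)
      finally have "t * (2 * c) \<le> t * (t * S)" by (simp add: power2_eq_square mult_ac)
      then have "2 * c \<le> t * S" using t by (simp only: mult_le_cancel_left_pos)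
      moreover have "t * (S + 1) = t * S + t" by (simp add: algebra_simps)
      ultimately show False using tS c t by linarith
    qed
    \<comment> \<open>A small positive multiple of w joins \<open>p\<close> to another point of the
      cube around it, so w is positive somewhere on L - L.\<close>
    have gpos: "g > 0"
    proof -
      define m where "m = 1 + (\<Sum>i<n. \<bar>w i\<bar>)"
      have m: "m > 0" by (simp add: m_def add_pos_nonneg sum_nonneg)
      define y where "y = (\<lambda>i\<in>{..<n}. p i + r * (w i / m))"
      have "y \<in> L"
      proof (rule p(3))
        show "\<forall>i<n. \<bar>y i - p i\<bar> \<le> r"
        proof (intro allI impI)
          fix i assume i: "i < n"
          have "\<bar>w i\<bar> \<le> (\<Sum>i<n. \<bar>w i\<bar>)" using i by (intro member_le_sum) auto
          then have "\<bar>w i\<bar> \<le> m" by (simp add: m_def)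
          then have "\<bar>w i / m\<bar> \<le> 1" using m by (simp add: abs_divide)
          then have "r * \<bar>w i / m\<bar> \<le> r * 1" using p(2) by (intro mult_left_mono) auto
          moreover have "\<bar>y i - p i\<bar> = r * \<bar>w i / m\<bar>" using i p(2) by (simp add: y_def abs_mult)
          ultimately show "\<bar>y i - p i\<bar> \<le> r" by linarith
        qed
      qed (simp add: y_def)
      then have "dotn n w y - dotn n w p \<le> g" using p(1) by (rule sup)
      moreover have "dotn n w y - dotn n w p = r / m * e"
      proof -
        have "dotn n w y - dotn n w p = (\<Sum>i<n. w i * y i - w i * p i)"
          by (simp add: dotn_def sum_subtractf)
        also have "\<dots> = (\<Sum>i<n. r / m * (w i)\<^sup>2)"
          by (intro sum.cong refl) (simp add: y_def power2_eq_square algebra_simps)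
        finally show ?thesis by (simp add: e_def sum_distrib_left)
      qed
      moreover have "r / m * e > 0" using p(2) m False e0 by simp
      ultimately show ?thesis by linarith
    qed
    have div: "dotn n (\<lambda>i. w i / g) y = dotn n w y / g" for y
      by (simp add: dotn_def sum_divide_distrib)
    have "dotn n (\<lambda>i. w i / g) x \<le> 1"
    proof (rule x)
      fix a b assume "a \<in> L" "b \<in> L"
      then show "dotn n (\<lambda>i. w i / g) a - dotn n (\<lambda>i. w i / g) b \<le> 1"
        using sup[of a b] gpos by (simp add: div diff_divide_distrib[symmetric])
    qed
    then have "dotn n w x \<le> g" using gpos by (simp add: div)
    moreover have "dotn n w x = e + g"
    proof -
      have "dotn n w x = (\<Sum>i<n. (w i)\<^sup>2 + (w i * a0 i - w i * b0 i))"
        unfolding dotn_def by (intro sum.cong refl) (simp add: w_def power2_eq_square algebra_simps)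
      then show ?thesis by (simp add: sum.distrib sum_subtractf e_def g_def dotn_def)
    qed
    ultimately show ?thesis using False e0 by linarith
  qed
qed

text \<open>From (1 + 1/n)^n \<le> e \<le> 3. It bounds N^n / n! by 6^n for N = 2 n.\<close>

lemma power_le_power3_fact: "real n ^ n \<le> 3 ^ n * fact n"
proof (induction n)
  case (Suc n)
  have "real (Suc n) ^ n \<le> 3 * real n ^ n"
  proof (cases "n = 0")
    case False
    have "(1 + 1 / real n) ^ n \<le> exp 1"
      using exp_ge_one_plus_x_over_n_power_n[of n 1] False by simp
    then have "(1 + 1 / real n) ^ n \<le> 3" using exp_le by linarith
    then have "(1 + 1 / real n) ^ n * real n ^ n \<le> 3 * real n ^ n" by (rule mult_right_mono) simp
    moreover have "(1 + 1 / real n) ^ n * real n ^ n = real (Suc n) ^ n"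
      using False by (simp add: power_mult_distrib[symmetric] field_simps)
    ultimately show ?thesis by simp
  qed simp
  then have "real (Suc n) * real (Suc n) ^ n \<le> real (Suc n) * (3 * real n ^ n)"
    by (rule mult_left_mono) simp
  also have "\<dots> \<le> real (Suc n) * (3 * (3 ^ n * fact n))"
    using Suc by (intro mult_left_mono) auto
  finally show ?case by (simp add: mult_ac)
qed simp

text \<open>The polar body of \<open>L - L\<close> contains \<open>2 n\<close> vectors \<open>u\<^sub>j\<close> almost maximising \<open>det M\<close>,
  \<open>M = \<Sum>\<^sub>j u\<^sub>j u\<^sub>j\<^sup>T\<close>. Near-optimality puts the ellipsoid \<open>x\<^sup>T M x \<le> 1/3\<close>, and so the image of a cube
  under \<open>M\<^sup>-\<^sup>1 U\<^sup>T\<close>, into \<open>L - L\<close>, while the rows of \<open>U\<close>, any \<open>n\<close> of the \<open>u\<^sub>j\<close>, map \<open>L\<close> into a cube;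
  \<open>U\<close> is chosen such that \<open>(det U)\<^sup>2\<close> is comparable to \<open>det M\<close>.\<close>

lemma ex_large_image_in_cuboid:
  assumes n: "1 \<le> n" and L: "convex_body n L" and d: "\<And>k. k < n \<Longrightarrow> 0 < d k"
  shows "\<exists>A b. detn n A \<noteq> 0 \<and> (\<forall>y\<in>L. \<forall>k<n. \<bar>addf n b (mvf n A y) k\<bar> \<le> d k) \<and>
    (1 / (24 * sqrt (real n))) ^ n * (\<Prod>k<n. d k) \<le> vol n ((\<lambda>y. addf n b (mvf n A y)) ` L)"
proof -
  have compL: "compactin (powertop_real {..<n}) L" and conv: "convex_Rn n L"
    using L by (auto simp: convex_body_def)
  have LR: "L \<subseteq> Rn n" using compactin_subset_topspace[OF compL] by simp
  obtain p r where p: "p \<in> L" "r > 0" "\<And>y. y \<in> Rn n \<Longrightarrow> (\<forall>i<n. \<bar>y i - p i\<bar> \<le> r) \<Longrightarrow> y \<in> L"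
    using convex_body_cube[OF L] by blast
  obtain B where B: "\<And>x i. x \<in> L \<Longrightarrow> i < n \<Longrightarrow> \<bar>x i\<bar> \<le> B"
    using compactin_powertop_bounded[OF compL] by blast
  define P where "P = {u. \<forall>a\<in>L. \<forall>b\<in>L. dotn n u a - dotn n u b \<le> 1}"
  define N where "N = 2 * n"
  have Pb: "\<bar>u i\<bar> \<le> 1 / r" if u: "u \<in> P" and i: "i < n" for u i
  proof -
    define a where "a \<epsilon> = (\<lambda>j\<in>{..<n}. p j + (if j = i then \<epsilon> else 0))" for \<epsilon>
    have aL: "a \<epsilon> \<in> L" if "\<bar>\<epsilon>\<bar> \<le> r" for \<epsilon>
      using that p(2) by (intro p(3)) (auto simp: a_def)
    have da: "dotn n u (a \<epsilon>) = dotn n u p + \<epsilon> * u i" for \<epsilon>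
    proof -
      have "dotn n u (a \<epsilon>) = (\<Sum>j<n. u j * p j + (if j = i then \<epsilon> * u j else 0))"
        unfolding dotn_def by (intro sum.cong refl) (simp add: a_def algebra_simps)
      then show ?thesis using i by (simp add: sum.distrib dotn_def)
    qed
    have "dotn n u (a r) - dotn n u p \<le> 1" "dotn n u (a (- r)) - dotn n u p \<le> 1"
      using u p(1,2) aL[of r] aL[of "- r"] by (auto simp: P_def)
    then have "r * \<bar>u i\<bar> \<le> 1" unfolding da by (simp add: abs_if)
    then show ?thesis using p(2) by (simp add: field_simps)
  qed
  \<comment> \<open>Coordinates differ by at most 2 |B| on \<open>L\<close>, so
    \<open>\<beta>\<close> times a unit vector lies in the polar body; with n zero vectors added,
    these form an admissible family of positive determinant. The summand 1 keeps the denominator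
    positive.\<close>
  define \<beta> where "\<beta> = 1 / (2 * \<bar>B\<bar> + 1)"
  have \<beta>: "\<beta> > 0" by (simp add: \<beta>_def add_nonneg_pos)
  define w where "w j = (\<lambda>i. if j < n then \<beta> * idf j i else 0)" for j
  have wP: "w j \<in> P" for j
  proof -
    have "dotn n (w j) a - dotn n (w j) b \<le> 1" if ab: "a \<in> L" "b \<in> L" for a b
    proof (cases "j < n")
      case True
      have w': "dotn n (w j) x = \<beta> * x j" for x
        using True by (simp add: dotn_def w_def mult.assoc sum_distrib_left[symmetric] sum_idf_mult)
      have "a j - b j \<le> 2 * \<bar>B\<bar> + 1" using B[OF ab(1) True] B[OF ab(2) True] by linarith
      then have "\<beta> * (a j - b j) \<le> \<beta> * (2 * \<bar>B\<bar> + 1)" using \<beta> by (intro mult_left_mono) auto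
      also have "\<dots> = 1" by (simp add: \<beta>_def add_nonneg_pos)
      finally show ?thesis by (simp add: w' right_diff_distrib)
    qed (simp add: dotn_def w_def)
    then show ?thesis by (simp add: P_def)
  qed
  have wdet: "detn n (gram N w) > 0"
  proof -
    have "gram N w i k = (if i = k then \<beta> * \<beta> else 0)" if "i < n" "k < n" for i k
    proof -
      have "gram N w i k = (\<Sum>j<N. if j = i then (if i = k then \<beta> * \<beta> else 0) else 0)"
        using that unfolding gram_def by (intro sum.cong) (auto simp: w_def idf_def)
      then show ?thesis using that by (simp add: N_def)
    qed
    then have "detn n (gram N w) = (\<Prod>i<n. \<beta> * \<beta>)"
      using detn_cong[of n "gram N w" "\<lambda>i k. if i = k then \<beta> * \<beta> else 0"] by (simp add: detn_diagonal)
    then show ?thesis using \<beta> by simp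
  qed
  obtain u where u: "\<And>j. j < N \<Longrightarrow> u j \<in> P" "detn n (gram N u) > 0"
    and opt: "\<And>u'. (\<And>j. j < N \<Longrightarrow> u' j \<in> P) \<Longrightarrow> detn n (gram N u') \<le> 2 * detn n (gram N u)"
    using ex_almost_max_gram[of P n "1 / r" N w] Pb wP wdet by blast
  define M where "M = gram N u"
  have polar: "(dotn n v x)\<^sup>2 \<le> 3 * (\<Sum>j<N. (dotn n (u j) x)\<^sup>2)" if v: "v \<in> P" for v x
    unfolding N_def
  proof (rule almost_max_gram_polar)
    show "detn n (gram (2 * n) u) > 0" using u(2) by (simp add: N_def)
    fix j assume "j < 2 * n"
    show "detn n (gram (2 * n) (u(j := v))) \<le> 2 * detn n (gram (2 * n) u)"
      using opt[of "u(j := v)"] u(1) v by (simp add: N_def)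
  qed
  obtain f where f: "f \<in> {..<n} \<rightarrow>\<^sub>E {..<N}"
    and fdet: "fact n * detn n M \<le> real (N ^ n) * (detn n (\<lambda>i. u (f i)))\<^sup>2"
    using ex_large_minor[OF u(2)] unfolding M_def by blast
  define U where "U = (\<lambda>i. u (f i))"
  have detM: "detn n M > 0" using u(2) by (simp add: M_def)
  have "0 < fact n * detn n M" using detM by simp
  then have "0 < real (N ^ n) * (detn n U)\<^sup>2" using fdet unfolding U_def by linarith
  then have detU: "detn n U \<noteq> 0" by auto
  have finj: "inj_on f {..<n}" by (rule detn_rows_inj[of n u]) (use detU in \<open>simp add: U_def\<close>)
  have fN: "f i < N" if "i < n" for i using PiE_mem[OF f, of i] that by simp
  obtain Y where Y: "\<And>i j. i < n \<Longrightarrow> j < n \<Longrightarrow> mulf n M Y i j = idf i j"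
    using detn_inverse[of n M] detM by (metis less_irrefl)
  have detY: "detn n M * detn n Y = 1"
    using detn_mulf[of n M Y] detn_cong[of n "mulf n M Y" idf] Y detn_idf[of n] by simp
  \<comment> \<open>For x = W a this makes x^T M x at most h^2 n = 1/16; then v . x \<le> sqrt
    (3/16) < 1/2 for v in \<open>P\<close>, which puts 2 x into L - L.\<close>
  define h where "h = 1 / (4 * sqrt (real n))"
  have h: "h > 0" "h * h * real n = 1 / 16" using n by (auto simp: h_def)
  define Dh where "Dh = (\<lambda>i j::nat. if i = j then h else 0)"
  define Dd where "Dd = (\<lambda>i j::nat. if i = j then d i else 0)"
  \<comment> \<open>\<open>W\<close> is \<open>h\<close> times M^-1 U^T. \<open>A\<close> scales the
    rows of \<open>U\<close> to the cuboid, and \<open>b\<close> moves the image of \<open>p\<close>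
    to the origin.\<close>
  define W where "W = mulf n Y (mulf n (\<lambda>i k. U k i) Dh)"
  define A where "A = mulf n Dd U"
  define b where "b = (\<lambda>k. - (d k * dotn n (U k) p))"
  define T where "T = (\<lambda>y. addf n b (mvf n A y))"
  have mvDd: "mvf n Dd y k = d k * y k" if "k < n" for y k
  proof -
    have "(\<Sum>j<n. Dd k j * y j) = (\<Sum>j<n. if j = k then d k * y k else 0)"
      by (intro sum.cong) (auto simp: Dd_def)
    then show ?thesis using that by (simp add: mvf_def)
  qed
  have mvDh: "mvf n Dh y k = h * y k" if "k < n" for y k
  proof -
    have "(\<Sum>j<n. Dh k j * y j) = (\<Sum>j<n. if j = k then h * y k else 0)"
      by (intro sum.cong) (auto simp: Dh_def)
    then show ?thesis using that by (simp add: mvf_def)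
  qed
  have mvU: "mvf n U y k = dotn n (U k) y" if "k < n" for y k
    using that by (simp add: mvf_def dotn_def)
  have Ty: "T y k = d k * (dotn n (U k) y - dotn n (U k) p)" if "k < n" for y k
    using that by (simp add: T_def addf_def A_def mvf_mulf mvDd mvU b_def right_diff_distrib)
  define \<Delta> where "\<Delta> = (\<Prod>k<n. d k)"
  have detD: "detn n Dd = \<Delta>" "detn n Dh = h ^ n"
    by (simp_all add: Dd_def Dh_def detn_diagonal \<Delta>_def)
  have D: "\<Delta> > 0" unfolding \<Delta>_def using d by (intro prod_pos) auto
  have detA: "detn n A \<noteq> 0" using detU D by (simp add: A_def detn_mulf detD)
  have cube: "\<bar>T y k\<bar> \<le> d k" if y: "y \<in> L" and k: "k < n" for y k
  proof -
    have "U k \<in> P" using u(1)[OF fN[OF k]] by (simp add: U_def)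
    then have "\<bar>dotn n (U k) y - dotn n (U k) p\<bar> \<le> 1"
      using y p(1) by (auto simp: P_def abs_le_iff)
    then have "d k * \<bar>dotn n (U k) y - dotn n (U k) p\<bar> \<le> d k * 1"
      using d[OF k] by (intro mult_left_mono) auto
    then show ?thesis using d[OF k] by (simp add: Ty[OF k] abs_mult)
  qed
  have inD: "\<exists>y1\<in>L. \<exists>y2\<in>L. \<forall>i<n. 2 * mvf n W a i = y1 i - y2 i" if a: "\<And>i. i < n \<Longrightarrow> \<bar>a i\<bar> \<le> 1" for a
  proof (rule difference_body_separation[OF L])
    define x where "x = mvf n W a"
    define q where "q = (\<Sum>j<N. (dotn n (u j) x)\<^sup>2)"
    have Mx: "(\<Sum>k<n. M i k * x k) = h * (\<Sum>l<n. U l i * a l)" if i: "i < n" for i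
    proof -
      have "mvf n M x = mvf n (mulf n M Y) (mvf n (\<lambda>i k. U k i) (mvf n Dh a))"
        by (simp only: x_def W_def mvf_mulf)
      also have "\<dots> = mvf n idf (mvf n (\<lambda>i k. U k i) (mvf n Dh a))"
        by (rule mvf_cong) (rule Y)
      also have "\<dots> = mvf n (\<lambda>i k. U k i) (mvf n Dh a)"
        by (rule mvf_idf) simp
      finally have "mvf n M x i = (\<Sum>l<n. U l i * mvf n Dh a l)"
        using i by (simp add: mvf_def)
      moreover have "mvf n M x i = (\<Sum>k<n. M i k * x k)" using i by (simp add: mvf_def)
      moreover have "(\<Sum>l<n. U l i * mvf n Dh a l) = h * (\<Sum>l<n. U l i * a l)"
        unfolding sum_distrib_left by (rule sum.cong[OF refl]) (simp add: mvDh)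
      ultimately show ?thesis by (simp only:)
    qed
    have "q = dotn n x (\<lambda>i. \<Sum>k<n. M i k * x k)"
      unfolding q_def M_def power2_eq_square by (rule sum_dotn_mult)
    also have "\<dots> = (\<Sum>i<n. \<Sum>l<n. h * (x i * (U l i * a l)))"
      unfolding dotn_def
    proof (rule sum.cong[OF refl])
      fix i assume "i \<in> {..<n}"
      then have "x i * (\<Sum>k<n. M i k * x k) = x i * (h * (\<Sum>l<n. U l i * a l))"
        by (simp only: Mx lessThan_iff)
      also have "\<dots> = (\<Sum>l<n. h * (x i * (U l i * a l)))"
        by (simp add: sum_distrib_left mult_ac)
      finally show "x i * (\<Sum>k<n. M i k * x k) = (\<Sum>l<n. h * (x i * (U l i * a l)))" .
    qed
    also have "\<dots> = (\<Sum>l<n. \<Sum>i<n. h * (x i * (U l i * a l)))" by (rule sum.swap)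
    also have "\<dots> = (\<Sum>l<n. (h * a l) * dotn n (U l) x)"
      by (simp add: dotn_def sum_distrib_left mult_ac)
    finally have q1: "q = (\<Sum>l<n. (h * a l) * dotn n (U l) x)" .
    have "q\<^sup>2 \<le> (\<Sum>l<n. (h * a l)\<^sup>2) * (\<Sum>l<n. (dotn n (U l) x)\<^sup>2)"
      unfolding q1 by (rule Cauchy_Schwarz_ineq_sum)
    also have "\<dots> \<le> (1 / 16) * q"
    proof (rule mult_mono)
      have "(\<Sum>l<n. (h * a l)\<^sup>2) \<le> (\<Sum>l<n. h * h)"
      proof (rule sum_mono)
        fix l assume "l \<in> {..<n}"
        then have "(a l)\<^sup>2 \<le> 1" using a[of l] by (simp add: abs_square_le_1)
        then have "(h * h) * (a l)\<^sup>2 \<le> (h * h) * 1" using h by (intro mult_left_mono) auto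
        then show "(h * a l)\<^sup>2 \<le> h * h" by (simp only: power_mult_distrib power2_eq_square[of h] mult_1_right)
      qed
      also have "(\<Sum>l<n. h * h) = h * h * real n" by (simp add: mult.commute)
      also have "\<dots> = 1 / 16" by (rule h(2))
      finally show "(\<Sum>l<n. (h * a l)\<^sup>2) \<le> 1 / 16" .
      \<comment> \<open>Injectivity of \<open>f\<close> makes this a partial sum of
        \<open>q\<close>, so that \<open>q\<close> occurs on both sides: q^2 \<le> q / 16.\<close>
      have "(\<Sum>l<n. (dotn n (U l) x)\<^sup>2) = (\<Sum>j\<in>f ` {..<n}. (dotn n (u j) x)\<^sup>2)"
        using finj by (simp add: sum.reindex U_def)
      also have "\<dots> \<le> q" unfolding q_def using fN by (intro sum_mono2) auto
      finally show "(\<Sum>l<n. (dotn n (U l) x)\<^sup>2) \<le> q" .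
    qed (auto intro: sum_nonneg)
    finally have "q * q \<le> (1 / 16) * q" by (simp only: power2_eq_square)
    moreover have "0 \<le> q" by (simp add: q_def sum_nonneg)
    ultimately have q: "q \<le> 1 / 16" by (cases "q = 0") auto
    fix v assume "\<And>a b. a \<in> L \<Longrightarrow> b \<in> L \<Longrightarrow> dotn n v a - dotn n v b \<le> 1"
    then have "v \<in> P" by (simp add: P_def)
    then have "(dotn n v x)\<^sup>2 \<le> 3 * q" unfolding q_def by (rule polar)
    then have "(dotn n v x)\<^sup>2 \<le> (1 / 2)\<^sup>2" using q by (simp add: power2_eq_square)
    then have "dotn n v x \<le> 1 / 2" by (rule power2_le_imp_le) simp
    moreover have "dotn n v (\<lambda>i. 2 * mvf n W a i) = 2 * dotn n v x"
      by (simp add: dotn_def x_def sum_distrib_left mult_ac)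
    ultimately show "dotn n v (\<lambda>i. 2 * mvf n W a i) \<le> 1" by linarith
  qed
  \<comment> \<open>The image \<open>Q\<close> of the cube \<open>C\<close> under A W lies in half
    the difference body of the image of \<open>L\<close>, and det G is \<open>\<Delta>\<close> h^n
    (det U)^2 / det M.\<close>
  define G where "G = mulf n A W"
  define C where "C = (\<Pi>\<^sub>E i\<in>{..<n}. {-1..(-1) + 2 :: real})"
  define Q where "Q = (\<lambda>a. addf n (\<lambda>_. 0) (mvf n G a)) ` C"
  have Cm: "C \<in> sets (lbn n)" unfolding C_def by (intro sets_PiM_I_finite) auto
  have Cv: "emeasure (lbn n) C = ennreal (2 ^ n)"
    unfolding C_def by (subst emeasure_cuboid) auto
  have detG: "detn n G = \<Delta> * h ^ n * ((detn n U)\<^sup>2 * detn n Y)"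
    using detn_transpose[of n U]
    by (simp add: G_def A_def W_def detn_mulf detD power2_eq_square)
  have Ypos: "detn n Y = 1 / detn n M" using detY detM by (simp add: field_simps)
  have G0: "detn n G > 0" unfolding detG Ypos using D h detU detM by simp
  have Qm: "Q \<in> sets (lbn n)" "emeasure (lbn n) Q = ennreal (detn n G) * ennreal (2 ^ n)"
    using emeasure_affine_image[of n G C "\<lambda>_. 0"] G0 Cm Cv by (auto simp: Q_def)
  have TL: "T ` L \<in> sets (lbn n)" "emeasure (lbn n) (T ` L) = ennreal \<bar>detn n A\<bar> * emeasure (lbn n) L"
    using emeasure_affine_image[OF detA compactin_powertop_sets[OF compL], of b] by (auto simp: T_def)
  have Lpos: "emeasure (lbn n) L > 0" "emeasure (lbn n) L < \<infinity>"
    by (rule convex_body_emeasure_pos[OF L], rule emeasure_compactin_finite[OF compL])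
  have TLc: "convex_Rn n (T ` L)"
    unfolding convex_Rn_def
  proof (intro ballI allI impI)
    fix y z :: "nat \<Rightarrow> real" and s t :: real
    assume "y \<in> T ` L" "z \<in> T ` L" and st: "0 \<le> s" "0 \<le> t" "s + t = 1"
    then obtain y' z' where yz: "y' \<in> L" "z' \<in> L" "y = T y'" "z = T z'" by auto
    define v where "v = (\<lambda>i\<in>{..<n}. s * y' i + t * z' i)"
    have vL: "v \<in> L"
      unfolding v_def by (rule conv[unfolded convex_Rn_def, rule_format, OF yz(1,2) st])
    have dv: "dotn n (U k) v = s * dotn n (U k) y' + t * dotn n (U k) z'" for k
      by (simp add: dotn_def v_def distrib_left sum.distrib sum_distrib_left mult_ac)
    have t: "t = 1 - s" using st(3) by simp
    have "T v k = s * T y' k + t * T z' k" if "k < n" for k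
      unfolding Ty[OF that] dv t by (simp add: algebra_simps)
    then have "(\<lambda>i\<in>{..<n}. s * y i + t * z i) = T v"
      by (intro ext) (simp add: yz(3,4) T_def addf_def)
    then show "(\<lambda>i\<in>{..<n}. s * y i + t * z i) \<in> T ` L" using vL by simp
  qed
  have half: "\<exists>y\<in>T ` L. \<exists>z\<in>T ` L. \<forall>i<n. x i = (y i - z i) / 2" if x: "x \<in> Q" for x
  proof -
    obtain a where a: "a \<in> C" "x = addf n (\<lambda>_. 0) (mvf n G a)" using x by (auto simp: Q_def)
    have "\<bar>a i\<bar> \<le> 1" if "i < n" for i
      using PiE_mem[OF a(1)[unfolded C_def], of i] that by auto
    then obtain y1 y2 where y: "y1 \<in> L" "y2 \<in> L" "\<And>i. i < n \<Longrightarrow> 2 * mvf n W a i = y1 i - y2 i"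
      using inD[of a] by blast
    have "x k = (T y1 k - T y2 k) / 2" if k: "k < n" for k
    proof -
      have "2 * dotn n (U k) (mvf n W a) = dotn n (U k) y1 - dotn n (U k) y2"
      proof -
        have "2 * dotn n (U k) (mvf n W a) = (\<Sum>i<n. U k i * (2 * mvf n W a i))"
          by (simp add: dotn_def sum_distrib_left mult_ac)
        also have "\<dots> = (\<Sum>i<n. U k i * (y1 i - y2 i))"
          using y(3) by (intro sum.cong) auto
        finally show ?thesis by (simp add: dotn_def right_diff_distrib sum_subtractf)
      qed
      moreover have "x k = d k * dotn n (U k) (mvf n W a)"
        using k by (simp add: a(2) addf_def G_def A_def mvf_mulf mvDd mvU)
      moreover have "T y1 k - T y2 k = d k * (dotn n (U k) y1 - dotn n (U k) y2)"
        using k by (simp add: Ty right_diff_distrib)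
      ultimately show ?thesis by simp
    qed
    then show ?thesis using y(1,2) by blast
  qed
  have fin: "emeasure (lbn n) (T ` L) < \<infinity>"
    using TL(2) Lpos(2) by (simp add: ennreal_mult_less_top)
  have "emeasure (lbn n) Q \<le> 2 ^ n * emeasure (lbn n) (T ` L)"
  proof (rule emeasure_half_difference_body[OF TL(1) TLc _ _ Qm(1) half])
    show "emeasure (lbn n) (T ` L) \<noteq> 0" using TL(2) Lpos detA by simp
    show "emeasure (lbn n) (T ` L) \<noteq> \<infinity>" using fin by simp
  qed
  moreover have "emeasure (lbn n) (T ` L) = ennreal (vol n (T ` L))"
    unfolding vol_def by (rule emeasure_eq_ennreal_measure) (use fin in simp)
  moreover have v0: "vol n (T ` L) \<ge> 0" by (simp add: vol_def)
  ultimately have "ennreal (detn n G * 2 ^ n) \<le> ennreal (2 ^ n * vol n (T ` L))"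
    using G0 Qm(2) by (simp add: ennreal_mult ennreal_power[symmetric])
  then have "detn n G * 2 ^ n \<le> 2 ^ n * vol n (T ` L)"
    using v0 by (subst (asm) ennreal_le_iff) auto
  then have volG: "detn n G \<le> vol n (T ` L)" by (simp add: mult.commute)
  \<comment> \<open>The selected minor loses at most N^n / n! \<le> 6^n against det M.\<close>
  have six: "(1 / 6) ^ n \<le> (detn n U)\<^sup>2 * detn n Y"
  proof -
    have "real n ^ n * detn n M \<le> 3 ^ n * fact n * detn n M"
      using power_le_power3_fact[of n] detM by (intro mult_right_mono) auto
    also have "\<dots> \<le> 3 ^ n * (real (N ^ n) * (detn n U)\<^sup>2)"
      unfolding mult.assoc U_def using fdet by (intro mult_left_mono) auto
    also have "\<dots> = real n ^ n * (6 ^ n * (detn n U)\<^sup>2)"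
    proof -
      have "(6 :: real) ^ n = 3 ^ n * 2 ^ n" by (subst power_mult_distrib[symmetric]) simp
      moreover have "real (N ^ n) = 2 ^ n * real n ^ n" by (simp add: N_def power_mult_distrib)
      ultimately show ?thesis by (simp only: mult_ac)
    qed
    finally have "detn n M \<le> 6 ^ n * (detn n U)\<^sup>2"
      using n by (subst (asm) mult_le_cancel_left_pos) auto
    then have "(1 / 6) ^ n * detn n M \<le> (1 / 6) ^ n * (6 ^ n * (detn n U)\<^sup>2)"
      by (rule mult_left_mono) simp
    also have "(1 / 6) ^ n * (6 ^ n * (detn n U)\<^sup>2) = (detn n U)\<^sup>2"
      by (simp add: power_one_over)
    finally have "(1 / 6) ^ n \<le> (detn n U)\<^sup>2 / detn n M"
      using detM by (simp only: pos_le_divide_eq)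
    then show ?thesis by (simp only: Ypos times_divide_eq_right mult_1_right)
  qed
  have "(1 / (24 * sqrt (real n))) ^ n * \<Delta> = \<Delta> * h ^ n * (1 / 6) ^ n"
  proof -
    \<comment> \<open>24 = 4 * 6, from the choice of \<open>h\<close> and from the minor.\<close>
    have "1 / (24 * sqrt (real n)) = h * (1 / 6)" by (simp add: h_def)
    then show ?thesis by (simp only: power_mult_distrib mult_ac)
  qed
  also have "\<dots> \<le> detn n G"
    unfolding detG using six D h by (intro mult_left_mono) auto
  finally have "(1 / (24 * sqrt (real n))) ^ n * \<Delta> \<le> vol n (T ` L)"
    using volG by linarith
  then show ?thesis
    using detA cube unfolding T_def \<Delta>_def by blast
qed

text \<open>288 = 12 * 24: the bound for the volume of the cross-polytope relative to the product of
  the d_k, and the loss of the image of \<open>L\<close> inside the cuboid.\<close>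

lemma lvr_le_sqrt:
  assumes n: "1 \<le> n" and K: "convex_body n K" "unconditional n K"
  shows "lvr n K \<le> ereal (288 * sqrt (real n))"
  unfolding lvr_def
proof (rule SUP_least)
  fix L assume "L \<in> {L. convex_body n L}"
  then have L: "convex_body n L" by simp
  obtain d where d: "\<And>k. k < n \<Longrightarrow> 0 < d k"
    and box: "\<And>y. y \<in> Rn n \<Longrightarrow> (\<forall>k<n. \<bar>y k\<bar> \<le> d k) \<Longrightarrow> y \<in> K"
    and l1: "\<And>y. y \<in> K \<Longrightarrow> (\<Sum>k<n. \<bar>y k\<bar> / d k) \<le> real n"
    using unconditional_position[OF K] by blast
  have comp: "compactin (powertop_real {..<n}) K" using K(1) by (simp add: convex_body_def)
  have KR: "K \<subseteq> Rn n" using compactin_subset_topspace[OF comp] by simp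
  have D: "(\<Prod>k<n. d k) > 0" using d by (intro prod_pos) auto
  have volK: "vol n K \<le> 12 ^ n * (\<Prod>k<n. d k)" by (rule vol_le_l1_ball[OF d KR l1])
  obtain A b where A: "detn n A \<noteq> 0" "\<And>y k. y \<in> L \<Longrightarrow> k < n \<Longrightarrow> \<bar>addf n b (mvf n A y) k\<bar> \<le> d k"
    and vol: "(1 / (24 * sqrt (real n))) ^ n * (\<Prod>k<n. d k) \<le> vol n ((\<lambda>y. addf n b (mvf n A y)) ` L)"
    using ex_large_image_in_cuboid[of n L d, OF n L d] by blast
  define T where "T = (\<lambda>y. addf n b (mvf n A y))"
  have T: "invertible_affine n T" unfolding T_def by (rule invertible_affineI[OF A(1)])
  have TL: "T ` L \<subseteq> K"
  proof
    fix y assume "y \<in> T ` L"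
    then obtain y' where y': "y' \<in> L" "y = T y'" by blast
    show "y \<in> K"
    proof (rule box)
      show "y \<in> Rn n" by (simp add: y'(2) T_def)
      show "\<forall>k<n. \<bar>y k\<bar> \<le> d k" using A(2)[OF y'(1)] by (simp add: y'(2) T_def)
    qed
  qed
  have q: "sqrt (real n) > 0" using n by simp
  have lowT: "(1 / (24 * sqrt (real n))) ^ n * (\<Prod>k<n. d k) \<le> vol n (T ` L)"
    using vol by (simp only: T_def)
  have low0: "0 < (1 / (24 * sqrt (real n))) ^ n * (\<Prod>k<n. d k)" using q D by simp
  have "vol n K / vol n (T ` L) \<le> 12 ^ n * (\<Prod>k<n. d k) / ((1 / (24 * sqrt (real n))) ^ n * (\<Prod>k<n. d k))"
    using volK lowT low0 D by (intro frac_le) auto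
  also have "\<dots> = 12 ^ n / (1 / (24 * sqrt (real n))) ^ n"
    using D by (intro nonzero_mult_divide_mult_cancel_right) linarith
  also have "\<dots> = (12 / (1 / (24 * sqrt (real n)))) ^ n" by (rule power_divide[symmetric])
  also have "12 / (1 / (24 * sqrt (real n))) = 288 * sqrt (real n)" by simp
  finally have "(vol n K / vol n (T ` L)) powr (1 / real n) \<le> ((288 * sqrt (real n)) ^ n) powr (1 / real n)"
    by (intro powr_mono2) (auto simp: vol_def)
  also have "\<dots> = 288 * sqrt (real n)" using q n by (intro power_powr_inverse) auto
  finally have "ereal ((vol n K / vol n (T ` L)) powr (1 / real n)) \<le> ereal (288 * sqrt (real n))" by simp
  moreover have "vr n K L \<le> ereal ((vol n K / vol n (T ` L)) powr (1 / real n))"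
    unfolding vr_def using T TL by (intro INF_lower) auto
  ultimately show "vr n K L \<le> ereal (288 * sqrt (real n))" by (rule order_trans[rotated])
qed

theorem theorem1p4:
  "\<exists>c>0. \<exists>C>0. \<forall>n\<ge>1. \<forall>K. convex_body n K \<and> unconditional n K \<longrightarrow>
     ereal (c * sqrt (real n)) \<le> lvr n K \<and> lvr n K \<le> ereal (C * sqrt (real n))"
proof -
  obtain c :: real where c: "c > 0" "\<And>n K. 1 \<le> n \<Longrightarrow> convex_body n K \<and> unconditional n K \<Longrightarrow>
      ereal (c * sqrt (real n)) \<le> lvr n K"
    using lvr_ge_sqrt by blast
  have "\<forall>n\<ge>1. \<forall>K. convex_body n K \<and> unconditional n K \<longrightarrow>
     ereal (c * sqrt (real n)) \<le> lvr n K \<and> lvr n K \<le> ereal (288 * sqrt (real n))"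
    using c(2) lvr_le_sqrt by blast
  moreover have "(288::real) > 0" by simp
  ultimately show ?thesis using c(1) by blast
qed

end
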